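(* Let $p>3$ be a prime. (i) Let $d\in\{0,\ldots,p-1\}$. Then $$\sum_{k=0}^{p-1}\frac{\binom{2k}{k+d}\binom{2k}{k}\binom{3k}{k}}{108^k}\equiv 0\pmod{p^2}\quad\text{if } d\equiv\frac{1+\left(\frac{p}{3}\right)}{2}\pmod 2,$$ $$\sum_{k=0}^{p-1}\frac{\binom{2k}{k+d}\binom{2k}{k}\binom{4k}{2k}}{256^k}\equiv 0\pmod{p^2}\quad\text{if } d\equiv\frac{1+\left(\frac{-2}{p}\right)}{2}\pmod 2,$$ $$\sum_{k=0}^{p-1}\frac{\binom{2k}{k+d}\binom{3k}{k}\binom{6k}{3k}}{12^{3k}}\equiv 0\pmod{p^2}\quad\text{if } d\equiv\frac{1+\left(\frac{-1}{p}\right)}{2}\pmod 2.$$ (ii) If $p\equiv 3\pmod 8$ and $p=x^2+2y^2$ with $x,y\in\mathbb{Z}$, then $$\sum_{k=0}^{p-1}\frac{\binom{2k}{k}^2\binom{4k}{2k}}{256^k}\equiv 4x^2-2p\pmod{p^2}.$$ (iii) If $p\equiv 5\pmod{12}$ and $p=x^2+y^2$ with $x,y\in\mathbb{Z}$, $2\nmid x$ and $2\mid y$, then $$\sum_{k=0}^{p-1}\frac{\binom{2k}{k}\binom{3k}{k}\binom{6k}{3k}}{12^{3k}}\equiv 2p-4x^2\pmod{p^2}.$$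
   Context: $\left(\frac{\cdot}{\cdot}\right)$ denotes the Legendre symbol. Congruences modulo powers of $p$ between rational numbers whose denominators are prime to $p$ are understood in the ring of $p$-adic integers (equivalently, in $\mathbb{Z}_{(p)}$). As usual, $\binom{n}{m}=0$ for integers $m>n\ge 0$. *)

theory Defs
  imports Complex_Main "HOL-Number_Theory.Number_Theory"
begin

text \<open>
  The localization of the integers at \<open>p\<close>, as a subset of the rationals.  Note that
  \<^const>\<open>quotient_of\<close> returns a fraction in lowest terms with positive denominator.
\<close>

definition Z_loc :: "nat \<Rightarrow> rat set" where
  "Z_loc p = {x. coprime (snd (quotient_of x)) (int p)}"

text \<open>
  Congruence modulo \<open>p ^ n\<close> in the ring \<^const>\<open>Z_loc\<close>.  Both sides are required to be
  \<open>p\<close>-integral.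
\<close>

definition loc_cong :: "nat \<Rightarrow> nat \<Rightarrow> rat \<Rightarrow> rat \<Rightarrow> bool" where
  "loc_cong p n x y \<longleftrightarrow>
     x \<in> Z_loc p \<and> y \<in> Z_loc p \<and> (\<exists>z\<in>Z_loc p. x - y = of_nat p ^ n * z)"

end

theory Submission
  imports Defs
begin

text \<open>
  Write \<open>h = (p - 1) / 2\<close>.  The three families are one family.  For \<open>a = - 1/3, - 1/4, - 1/6\<close> the summand is
  \<open>(2k choose (k + d)) / 4 ^ k\<close> times \<open>(a gchoose k) * ((- 1 - a) gchoose k)\<close>
  (\<open>legendre_coeff_third\<close> and its two companions).  For a natural number \<open>a = n\<close> the latter product is the
  coefficient of \<open>((1 - x) / 2) ^ k\<close> in the Legendre polynomial \<open>P_n(x)\<close>; since \<open>(2k choose (k + d))\<close> is the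
  coefficient of \<open>z ^ d\<close> in \<open>(z + 2 + 1/z) ^ k\<close>, the sum at \<open>a = n\<close> is the coefficient of \<open>z ^ d\<close> in
  \<open>P_n(- (z + 1/z) / 2)\<close>.  It vanishes for odd \<open>n - d\<close> because \<open>P_n\<close> has the parity of \<open>n\<close>, and for
  \<open>d = 0\<close>, \<open>n = 2m\<close> it is the square of \<open>(- 1/2) gchoose m\<close>.

  To pass from \<open>n\<close> to the fraction \<open>a\<close>, write \<open>a = n + p t\<close> with \<open>0 \<le> n < p\<close>.  Modulo \<open>p ^ 2\<close> the truncated
  sum is an affine function of \<open>t\<close>, hence determined by its values at \<open>t = 0\<close> and \<open>t = - 1\<close>.  The second one
  is again known: the sum is invariant under \<open>a \<mapsto> - 1 - a\<close>, which sends \<open>n - p\<close> to \<open>p - 1 - n\<close>.  As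
  \<open>p - 1\<close> is even, \<open>n\<close> and \<open>p - 1 - n\<close> have the same parity, so both values vanish when \<open>n - d\<close> is odd;
  the quadratic symbols in the first part of the theorem just record the parity of \<open>n\<close>.

  For the other two parts put \<open>M = 4\<close> or \<open>M = 6\<close> and \<open>p + 1 = M (2m + 1)\<close>.  The same interpolation, with
  \<open>t = - 1/M\<close>, turns the sum into \<open>(1 + t) c ^ 2 - t c' ^ 2\<close> where \<open>c = (- 1/2) gchoose m\<close> and
  \<open>c' = (- 1/2) gchoose (h - m)\<close>.  Both are congruent to \<open>h choose m\<close> modulo \<open>p\<close>, so modulo \<open>p ^ 2\<close> this is
  the square of \<open>(1 + t) c - t c'\<close> (\<open>trunc_sum_cong_square\<close>).

  That number is an Eisenstein sum.  Let \<open>\<chi>\<close> be a character of order \<open>2M\<close> of the field with \<open>p ^ 2\<close> elements.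
  It restricts to the Legendre symbol on the prime field, so \<open>E = \<Sum> \<chi>(z) (tr z / p)\<close>, with \<open>z\<close> running over
  the \<open>p + 1\<close> lines through \<open>0\<close>, is well defined.  Since \<open>\<chi>(z ^ p) = \<chi>(z) ^ (M - 1)\<close>, it is of the form
  \<open>X + Y \<rho>\<close> with integers \<open>X\<close>, \<open>Y\<close> and \<open>\<rho> ^ 2 = - 2\<close> or \<open>- 1\<close>.  All of this is carried out modulo \<open>p ^ 2\<close>
  in an imaginary quadratic order in which \<open>p\<close> is inert, with a generator \<open>g\<close> of the Teichmueller group.
  The Legendre symbol of \<open>s\<close> is congruent to \<open>(1 - h) s ^ h + h s ^ (3h)\<close> modulo \<open>p ^ 2\<close>, so \<open>E\<close> becomes a
  combination of geometric sums and can be evaluated as a combination of three binomial coefficients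
  (\<open>Esum_chi_exp\<close>), which is again \<open>(1 + t) c - t c'\<close> (\<open>E_unit_cong\<close>).  The conjugate sum \<open>E'\<close> is divisible
  by \<open>p\<close> (\<open>Esum_chi_exp_conj\<close>), and Wilson's theorem gives \<open>E E' \<equiv> p\<close> modulo \<open>p ^ 2\<close>.  A crude estimate of \<open>X\<close> and
  \<open>Y\<close> turns this congruence into \<open>X ^ 2 + 2 Y ^ 2 = p\<close> or \<open>X ^ 2 + Y ^ 2 = p\<close>, and \<open>2 X = E + E'\<close> yields
  \<open>E ^ 2 \<equiv> 4 X ^ 2 - 2 p\<close>.  Such representations of a prime are essentially unique; for the form
  \<open>X ^ 2 + Y ^ 2\<close> the remaining ambiguity is settled by showing that \<open>X\<close> is even.
\<close>

section \<open>Congruences in the localization and affine functions\<close>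

locale prime_gt_3 =
  fixes p :: nat
  assumes p_prime: "prime p" and p_gt_3: "p > 3"
begin

lemma Z_loc_iff: "x \<in> Z_loc p \<longleftrightarrow> (\<exists>b::int. coprime b (int p) \<and> x * of_int b \<in> \<int>)"
proof
  assume "x \<in> Z_loc p"
  obtain n d where nd: "quotient_of x = (n, d)" by (cases "quotient_of x")
  have "d > 0" using nd by (rule quotient_of_denom_pos)
  then have "x * of_int d = of_int n" using quotient_of_div[OF nd] by simp
  then show "\<exists>b::int. coprime b (int p) \<and> x * of_int b \<in> \<int>"
    using \<open>x \<in> Z_loc p\<close> nd by (intro exI[of _ d]) (auto simp: Z_loc_def)
next
  assume "\<exists>b::int. coprime b (int p) \<and> x * of_int b \<in> \<int>"
  then obtain b c :: int where b: "coprime b (int p)" and c: "x * of_int b = of_int c"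
    by (auto elim: Ints_cases)
  obtain n d where nd: "quotient_of x = (n, d)" by (cases "quotient_of x")
  have d: "d > 0" using nd by (rule quotient_of_denom_pos)
  have "of_int (n * b) = (of_int (c * d) :: rat)"
    using c d quotient_of_div[OF nd] by (simp add: field_simps)
  then have "n * b = c * d" by (simp only: of_int_eq_iff)
  then have "d dvd n * b" by simp
  then have "d dvd b"
    using quotient_of_coprime[OF nd] by (simp add: coprime_commute coprime_dvd_mult_right_iff)
  then have "coprime d (int p)" using b coprime_divisors[of d b "int p" "int p"] by simp
  then show "x \<in> Z_loc p" by (simp add: Z_loc_def nd)
qed

lemma Z_loc_of_int [simp]: "of_int a \<in> Z_loc p"
  unfolding Z_loc_iff by (intro exI[of _ 1]) auto

lemma Z_loc_of_nat [simp]: "of_nat a \<in> Z_loc p"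
  using Z_loc_of_int[of "int a"] by simp

lemma Z_loc_numeral [simp]: "numeral a \<in> Z_loc p" "0 \<in> Z_loc p" "1 \<in> Z_loc p"
  using Z_loc_of_int[of "numeral a"] Z_loc_of_int[of 0] Z_loc_of_int[of 1] by simp_all

lemma Z_loc_add [simp]: assumes "x \<in> Z_loc p" "y \<in> Z_loc p" shows "x + y \<in> Z_loc p"
proof -
  obtain b c where b: "coprime b (int p)" "x * of_int b \<in> \<int>"
    and c: "coprime c (int p)" "y * of_int c \<in> \<int>"
    using assms unfolding Z_loc_iff by blast
  have "(x * of_int b) * of_int c + (y * of_int c) * of_int b \<in> \<int>"
    using b(2) c(2) by (simp add: Ints_mult)
  also have "(x * of_int b) * of_int c + (y * of_int c) * of_int b = (x + y) * of_int (b * c)"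
    by (simp add: algebra_simps)
  finally show ?thesis
    unfolding Z_loc_iff using b c by (intro exI[of _ "b * c"]) auto
qed

lemma Z_loc_mult [simp]: assumes "x \<in> Z_loc p" "y \<in> Z_loc p" shows "x * y \<in> Z_loc p"
proof -
  obtain b c where b: "coprime b (int p)" "x * of_int b \<in> \<int>"
    and c: "coprime c (int p)" "y * of_int c \<in> \<int>"
    using assms unfolding Z_loc_iff by blast
  have "(x * of_int b) * (y * of_int c) \<in> \<int>"
    using b(2) c(2) by (simp add: Ints_mult)
  also have "(x * of_int b) * (y * of_int c) = (x * y) * of_int (b * c)"
    by (simp add: algebra_simps)
  finally show ?thesis
    unfolding Z_loc_iff using b c by (intro exI[of _ "b * c"]) auto
qed

lemma Z_loc_uminus [simp]: "x \<in> Z_loc p \<Longrightarrow> - x \<in> Z_loc p"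
  using Z_loc_mult[of "-1" x] Z_loc_of_int[of "-1"] by simp

lemma Z_loc_diff [simp]: "x \<in> Z_loc p \<Longrightarrow> y \<in> Z_loc p \<Longrightarrow> x - y \<in> Z_loc p"
  using Z_loc_add[of x "- y"] by simp

lemma Z_loc_power [simp]: "x \<in> Z_loc p \<Longrightarrow> x ^ n \<in> Z_loc p"
  by (induction n) auto

lemma Z_loc_sum [simp]: "(\<And>i. i \<in> I \<Longrightarrow> f i \<in> Z_loc p) \<Longrightarrow> sum f I \<in> Z_loc p"
  by (induction I rule: infinite_finite_induct) auto

lemma Z_loc_divide: "x \<in> Z_loc p \<Longrightarrow> \<not> p dvd n \<Longrightarrow> x / of_nat n \<in> Z_loc p"
proof -
  assume x: "x \<in> Z_loc p" and n: "\<not> p dvd n"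
  have "coprime n p" using p_prime n by (metis coprime_commute prime_imp_coprime)
  then have "coprime (int n) (int p)" by simp
  moreover have "n \<noteq> 0" using n by (metis dvd_0_right)
  ultimately have "1 / of_nat n \<in> Z_loc p"
    unfolding Z_loc_iff by (intro exI[of _ "int n"]) auto
  then show ?thesis using Z_loc_mult[OF x] by fastforce
qed

lemma Z_loc_divide_less: "x \<in> Z_loc p \<Longrightarrow> 0 < n \<Longrightarrow> n < p \<Longrightarrow> x / of_nat n \<in> Z_loc p"
  by (rule Z_loc_divide) (auto dest: nat_dvd_not_less)

lemma Z_loc_divide_2 [simp]: "x \<in> Z_loc p \<Longrightarrow> x / 2 \<in> Z_loc p"
  using Z_loc_divide_less[of x 2] p_gt_3 by simp

lemma Z_loc_divide_3 [simp]: "x \<in> Z_loc p \<Longrightarrow> x / 3 \<in> Z_loc p"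
  using Z_loc_divide_less[of x 3] p_gt_3 by simp

lemma Z_loc_divide_4 [simp]: "x \<in> Z_loc p \<Longrightarrow> x / 4 \<in> Z_loc p"
  using Z_loc_divide_2[of "x / 2"] by simp

lemma Z_loc_divide_6 [simp]: "x \<in> Z_loc p \<Longrightarrow> x / 6 \<in> Z_loc p"
  using Z_loc_divide_2[of "x / 3"] by simp

lemma loc_cong_iff:
  "loc_cong p n x y \<longleftrightarrow> x \<in> Z_loc p \<and> y \<in> Z_loc p \<and> (x - y) / of_nat p ^ n \<in> Z_loc p"
proof -
  have "(of_nat p :: rat) ^ n \<noteq> 0" using p_gt_3 by simp
  then have "x - y = of_nat p ^ n * z \<longleftrightarrow> (x - y) / of_nat p ^ n = z" for z
    by (auto simp: field_simps)
  then show ?thesis by (auto simp: loc_cong_def)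
qed

lemma loc_congI: "x \<in> Z_loc p \<Longrightarrow> y \<in> Z_loc p \<Longrightarrow> z \<in> Z_loc p \<Longrightarrow> x - y = of_nat p ^ n * z \<Longrightarrow> loc_cong p n x y"
  by (auto simp: loc_cong_def)

lemma loc_cong_refl [simp]: "x \<in> Z_loc p \<Longrightarrow> loc_cong p n x x"
  by (simp add: loc_cong_iff)

lemma loc_cong_sym: "loc_cong p n x y \<Longrightarrow> loc_cong p n y x"
  using Z_loc_uminus[of "(x - y) / of_nat p ^ n"]
  by (auto simp: loc_cong_iff minus_divide_left)

lemma loc_cong_trans [trans]:
  "loc_cong p n x y \<Longrightarrow> loc_cong p n y z \<Longrightarrow> loc_cong p n x z"
  using Z_loc_add[of "(x - y) / of_nat p ^ n" "(y - z) / of_nat p ^ n"]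
  by (auto simp: loc_cong_iff simp flip: add_divide_distrib)

lemma loc_cong_add: "loc_cong p n x y \<Longrightarrow> loc_cong p n x' y' \<Longrightarrow> loc_cong p n (x + x') (y + y')"
  using Z_loc_add[of "(x - y) / of_nat p ^ n" "(x' - y') / of_nat p ^ n"]
  by (auto simp: loc_cong_iff algebra_simps simp flip: add_divide_distrib)

lemma loc_cong_mult:
  assumes "loc_cong p n x y" "loc_cong p n x' y'"
  shows "loc_cong p n (x * x') (y * y')"
proof -
  obtain z z' where z: "z \<in> Z_loc p" "x - y = of_nat p ^ n * z"
    and z': "z' \<in> Z_loc p" "x' - y' = of_nat p ^ n * z'"
    using assms by (auto simp: loc_cong_def)
  have "x * x' - y * y' = (x - y) * x' + y * (x' - y')" by (simp add: algebra_simps)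
  also have "\<dots> = of_nat p ^ n * (z * x' + y * z')" by (simp add: z z' algebra_simps)
  finally show ?thesis using assms z z' by (intro loc_congI[of _ _ "z * x' + y * z'"]) (auto simp: loc_cong_def)
qed

lemma loc_cong_power: "loc_cong p n x y \<Longrightarrow> loc_cong p n (x ^ k) (y ^ k)"
  by (induction k) (auto intro: loc_cong_mult)

lemma of_int_Z_loc_divide:
  assumes "of_int a / of_nat p ^ n \<in> Z_loc p" shows "int p ^ n dvd a"
proof -
  obtain b c :: int where b: "coprime b (int p)" and c: "(of_int a / of_nat p ^ n) * of_int b = (of_int c :: rat)"
    using assms by (auto simp: Z_loc_iff elim: Ints_cases)
  have "of_int (a * b) = (of_int (c * int p ^ n) :: rat)"
    using c p_gt_3 by (simp add: field_simps)
  then have "a * b = c * int p ^ n" by (simp only: of_int_eq_iff)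
  then have "int p ^ n dvd a * b" by simp
  moreover have "coprime (int p ^ n) b" using b by (simp add: coprime_commute)
  ultimately show ?thesis by (simp add: coprime_dvd_mult_left_iff)
qed

lemma loc_cong_of_int_iff: "loc_cong p n (of_int a) (of_int b) \<longleftrightarrow> [a = b] (mod (int p ^ n))"
proof
  assume "loc_cong p n (of_int a) (of_int b)"
  then have "of_int (a - b) / of_nat p ^ n \<in> Z_loc p" by (simp add: loc_cong_iff)
  then show "[a = b] (mod (int p ^ n))"
    using of_int_Z_loc_divide cong_iff_dvd_diff by blast
next
  assume "[a = b] (mod (int p ^ n))"
  then obtain c where "a - b = int p ^ n * c" by (auto simp: cong_iff_dvd_diff)
  then have "of_int (a - b) = (of_int (int p ^ n * c) :: rat)" by simp
  then show "loc_cong p n (of_int a) (of_int b)"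
    by (intro loc_congI[of _ _ "of_int c"]) auto
qed

text \<open>
  Products of two affine functions stay affine because the step is a multiple of \<open>p\<close>: the quadratic
  term carries the factor \<open>p ^ 2\<close>.
\<close>

definition affine_mod :: "(rat \<Rightarrow> rat) \<Rightarrow> bool" where
  "affine_mod f \<longleftrightarrow> (\<exists>c\<in>Z_loc p. \<exists>c'\<in>Z_loc p. \<forall>t\<in>Z_loc p. loc_cong p 2 (f t) (c + of_nat p * c' * t))"

lemma affine_mod_linear: "x \<in> Z_loc p \<Longrightarrow> y \<in> Z_loc p \<Longrightarrow> affine_mod (\<lambda>t. x + of_nat p * y * t)"
  unfolding affine_mod_def by (rule bexI[of _ x], rule bexI[of _ y]) auto

lemma affine_mod_const: "x \<in> Z_loc p \<Longrightarrow> affine_mod (\<lambda>t. x)"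
  using affine_mod_linear[of x 0] by simp

lemma affine_mod_add:
  assumes "affine_mod f" "affine_mod g" shows "affine_mod (\<lambda>t. f t + g t)"
proof -
  obtain a a' b b' where ab: "a \<in> Z_loc p" "a' \<in> Z_loc p" "b \<in> Z_loc p" "b' \<in> Z_loc p"
    "\<And>t. t \<in> Z_loc p \<Longrightarrow> loc_cong p 2 (f t) (a + of_nat p * a' * t)"
    "\<And>t. t \<in> Z_loc p \<Longrightarrow> loc_cong p 2 (g t) (b + of_nat p * b' * t)"
    using assms unfolding affine_mod_def by blast
  have "loc_cong p 2 (f t + g t) ((a + b) + of_nat p * (a' + b') * t)" if "t \<in> Z_loc p" for t
    using loc_cong_add[OF ab(5,6)[OF that]] by (simp add: algebra_simps)
  then show ?thesis unfolding affine_mod_def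
    by (intro bexI[of _ "a + b"] bexI[of _ "a' + b'"]) (use ab in auto)
qed

lemma affine_mod_mult:
  assumes "affine_mod f" "affine_mod g" shows "affine_mod (\<lambda>t. f t * g t)"
proof -
  obtain a a' b b' where ab: "a \<in> Z_loc p" "a' \<in> Z_loc p" "b \<in> Z_loc p" "b' \<in> Z_loc p"
    "\<And>t. t \<in> Z_loc p \<Longrightarrow> loc_cong p 2 (f t) (a + of_nat p * a' * t)"
    "\<And>t. t \<in> Z_loc p \<Longrightarrow> loc_cong p 2 (g t) (b + of_nat p * b' * t)"
    using assms unfolding affine_mod_def by blast
  have "loc_cong p 2 (f t * g t) (a * b + of_nat p * (a * b' + a' * b) * t)" if t: "t \<in> Z_loc p" for t
  proof -
    have "loc_cong p 2 ((a + of_nat p * a' * t) * (b + of_nat p * b' * t))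
        (a * b + of_nat p * (a * b' + a' * b) * t)"
      by (rule loc_congI[of _ _ "a' * b' * t ^ 2"])
        (use ab t in \<open>auto simp: algebra_simps power2_eq_square\<close>)
    then show ?thesis using loc_cong_mult[OF ab(5,6)[OF t]] loc_cong_trans by blast
  qed
  then show ?thesis unfolding affine_mod_def
    by (intro bexI[of _ "a * b"] bexI[of _ "a * b' + a' * b"]) (use ab in auto)
qed

lemma affine_mod_sum:
  "(\<And>i. i \<in> I \<Longrightarrow> affine_mod (f i)) \<Longrightarrow> affine_mod (\<lambda>t. \<Sum>i\<in>I. f i t)"
  by (induction I rule: infinite_finite_induct) (auto intro: affine_mod_const affine_mod_add)

lemma affine_mod_divide:
  "affine_mod f \<Longrightarrow> \<not> p dvd n \<Longrightarrow> affine_mod (\<lambda>t. f t / of_nat n)"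
  using affine_mod_mult[of f "\<lambda>t. 1 / of_nat n"] affine_mod_const[OF Z_loc_divide[of 1 n]] by simp

text \<open>
  The restriction to \<open>k < p\<close> keeps the denominator \<open>k!\<close> invertible.
\<close>

lemma affine_mod_gbinomial:
  assumes "x \<in> Z_loc p" "y \<in> Z_loc p" "k < p"
  shows "affine_mod (\<lambda>t. (x + of_nat p * y * t) gchoose k)"
  using assms(3)
proof (induction k)
  case 0
  then show ?case by (simp add: affine_mod_const)
next
  case (Suc k)
  have eq: "(z gchoose Suc k) = (z gchoose k) * (z - of_nat k) / of_nat (Suc k)" for z :: rat
    using gbinomial_mult_1[of z k] by (simp add: field_simps)
  have "affine_mod (\<lambda>t. (x - of_nat k) + of_nat p * y * t)"
    using assms by (intro affine_mod_linear) auto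
  then have "affine_mod (\<lambda>t. (x + of_nat p * y * t) - of_nat k)"
    by (simp add: algebra_simps)
  moreover have "\<not> p dvd Suc k" using Suc.prems by (auto dest: dvd_imp_le)
  ultimately show ?case
    unfolding eq using Suc by (intro affine_mod_divide affine_mod_mult) auto
qed

text \<open>
  The form in which affinity is used: any two values determine all the others.
\<close>

lemma affine_mod_interpolate:
  assumes "affine_mod f" "a \<in> Z_loc p" "b \<in> Z_loc p" "l \<in> Z_loc p"
  shows "loc_cong p 2 (f ((1 - l) * a + l * b)) ((1 - l) * f a + l * f b)"
proof -
  obtain c c' where c: "c \<in> Z_loc p" "c' \<in> Z_loc p"
    "\<And>t. t \<in> Z_loc p \<Longrightarrow> loc_cong p 2 (f t) (c + of_nat p * c' * t)"
    using assms unfolding affine_mod_def by blast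
  have "loc_cong p 2 ((1 - l) * f a + l * f b)
      ((1 - l) * (c + of_nat p * c' * a) + l * (c + of_nat p * c' * b))"
    using assms c by (intro loc_cong_add loc_cong_mult loc_cong_refl) auto
  also have "(1 - l) * (c + of_nat p * c' * a) + l * (c + of_nat p * c' * b) =
      c + of_nat p * c' * ((1 - l) * a + l * b)"
    by (simp add: algebra_simps)
  finally have 1: "loc_cong p 2 ((1 - l) * f a + l * f b) (c + of_nat p * c' * ((1 - l) * a + l * b))" .
  have "loc_cong p 2 (f ((1 - l) * a + l * b)) (c + of_nat p * c' * ((1 - l) * a + l * b))"
    using assms by (intro c) auto
  then show ?thesis using 1 loc_cong_sym loc_cong_trans by blast
qed

end

section \<open>Fourier coefficients of Legendre polynomials\<close>

text \<open>
  For \<open>a = n\<close> a natural number this is the coefficient of \<open>((1 - x) / 2) ^ k\<close> in the Legendre polynomial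
  \<open>P_n(x)\<close>; the argument is rational so that non-integral degrees are covered as well.
\<close>

definition legendre_coeff :: "nat \<Rightarrow> rat \<Rightarrow> rat" where
  "legendre_coeff k a = (a gchoose k) * ((- 1 - a) gchoose k)"

lemma legendre_coeff_0 [simp]: "legendre_coeff 0 a = 1"
  by (simp add: legendre_coeff_def)

lemma gbinomial_Suc_rec: "((z::rat) gchoose Suc k) = (z gchoose k) * (z - of_nat k) / of_nat (Suc k)"
  using gbinomial_mult_1[of z k] by (simp add: field_simps)

lemma legendre_coeff_Suc: "(of_nat k + 1) ^ 2 * legendre_coeff (Suc k) a = - ((a + of_nat k + 1) * (a - of_nat k) * legendre_coeff k a)"
proof -
  have "(of_nat k + 1) * (z gchoose Suc k) = (z gchoose k) * (z - of_nat k)" for z :: rat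
    using gbinomial_mult_1[of z k] by (simp add: field_simps)
  note eq = this[of a] this[of "- 1 - a"]
  have "(of_nat k + 1) ^ 2 * legendre_coeff (Suc k) a
      = ((of_nat k + 1) * (a gchoose Suc k)) * ((of_nat k + 1) * ((- 1 - a) gchoose Suc k))"
    by (simp add: legendre_coeff_def power2_eq_square)
  also have "\<dots> = - ((a + of_nat k + 1) * (a - of_nat k) * legendre_coeff k a)"
    unfolding eq by (simp add: legendre_coeff_def algebra_simps)
  finally show ?thesis .
qed

lemma legendre_coeff_reflect: "legendre_coeff k (- 1 - a) = legendre_coeff k a"
  by (simp add: legendre_coeff_def mult.commute)

text \<open>
  Up to sign, \<open>legendre_coeff k a\<close> is the product of the \<open>2k\<close> consecutive numbers from \<open>a - k + 1\<close> to \<open>a + k\<close>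
  divided by \<open>(k!) ^ 2\<close>, so raising both \<open>a\<close> and \<open>k\<close> by one only appends two factors at the upper end.
\<close>

lemma legendre_coeff_Suc_shift_up:
  "(of_nat k + 1) ^ 2 * legendre_coeff (Suc k) (a + 1) = - ((a + of_nat k + 2) * (a + of_nat k + 1) * legendre_coeff k a)"
proof (induction k)
  case 0
  show ?case by (simp add: legendre_coeff_def algebra_simps)
next
  case (Suc k)
  let ?x = "of_nat k :: rat"
  have x: "of_nat (Suc k) = ?x + 1" by simp
  have eq: "(?x + 1 + 1) ^ 2 * legendre_coeff (Suc (Suc k)) (a + 1) = - ((a + ?x + 3) * (a - ?x) * legendre_coeff (Suc k) (a + 1))"
    using legendre_coeff_Suc[of "Suc k" "a + 1"] unfolding x by (simp add: algebra_simps)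
  have "(?x + 1) ^ 2 * ((?x + 1 + 1) ^ 2 * legendre_coeff (Suc (Suc k)) (a + 1))
      = - ((a + ?x + 3) * (a - ?x)) * ((?x + 1) ^ 2 * legendre_coeff (Suc k) (a + 1))"
    unfolding eq by (simp only: mult_minus_left mult_minus_right ac_simps)
  also have "\<dots> = - ((a + ?x + 3) * (a + ?x + 2)) * ((?x + 1) ^ 2 * legendre_coeff (Suc k) a)"
    unfolding Suc legendre_coeff_Suc[of k a] by (simp add: algebra_simps)
  finally have "(?x + 1) ^ 2 * ((?x + 1 + 1) ^ 2 * legendre_coeff (Suc (Suc k)) (a + 1))
      = (?x + 1) ^ 2 * (- ((a + (?x + 1) + 2) * (a + (?x + 1) + 1) * legendre_coeff (Suc k) a))"
    by (simp add: algebra_simps)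
  moreover have "(?x + 1) ^ 2 \<noteq> 0"
    by (metis of_nat_Suc of_nat_neq_0 add.commute power_not_zero)
  ultimately show ?case unfolding x using mult_left_cancel by blast
qed

lemma legendre_coeff_Suc_shift_down:
  "(of_nat k + 1) ^ 2 * legendre_coeff (Suc k) (a - 1) = - ((a - of_nat k - 1) * (a - of_nat k) * legendre_coeff k a)"
proof -
  have "(of_nat k + 1) ^ 2 * legendre_coeff (Suc k) (- 1 - a + 1)
      = - ((- 1 - a + of_nat k + 2) * (- 1 - a + of_nat k + 1) * legendre_coeff k (- 1 - a))"
    by (rule legendre_coeff_Suc_shift_up)
  moreover have "legendre_coeff (Suc k) (- 1 - a + 1) = legendre_coeff (Suc k) (a - 1)"
    using legendre_coeff_reflect[of "Suc k" "a - 1"] by simp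
  ultimately show ?thesis unfolding legendre_coeff_reflect by (simp add: algebra_simps)
qed

text \<open>
  Bonnet's recurrence \<open>(a + 1) P_(a + 1) + a P_(a - 1) = (2a + 1) x P_a\<close>, read off coefficientwise in powers
  of \<open>(1 - x) / 2\<close>.
\<close>

lemma legendre_coeff_three_term:
  "(a + 1) * legendre_coeff (Suc k) (a + 1) + a * legendre_coeff (Suc k) (a - 1) = (2 * a + 1) * (legendre_coeff (Suc k) a - 2 * legendre_coeff k a)"
proof -
  have "(of_nat k + 1) ^ 2 * ((a + 1) * legendre_coeff (Suc k) (a + 1) + a * legendre_coeff (Suc k) (a - 1))
      = (of_nat k + 1) ^ 2 * ((2 * a + 1) * (legendre_coeff (Suc k) a - 2 * legendre_coeff k a))"
  proof -
    have "(of_nat k + 1) ^ 2 * ((a + 1) * legendre_coeff (Suc k) (a + 1) + a * legendre_coeff (Suc k) (a - 1))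
       = (a + 1) * ((of_nat k + 1) ^ 2 * legendre_coeff (Suc k) (a + 1)) + a * ((of_nat k + 1) ^ 2 * legendre_coeff (Suc k) (a - 1))"
      by (simp add: algebra_simps)
    also have "\<dots> = (2 * a + 1) * ((of_nat k + 1) ^ 2 * legendre_coeff (Suc k) a - 2 * (of_nat k + 1) ^ 2 * legendre_coeff k a)"
      unfolding legendre_coeff_Suc_shift_up[of k a] legendre_coeff_Suc_shift_down[of k a] legendre_coeff_Suc[of k a] by (simp add: algebra_simps power2_eq_square)
    finally show ?thesis by (simp add: algebra_simps)
  qed
  moreover have "(of_nat k + 1 :: rat) ^ 2 \<noteq> 0"
    by (metis of_nat_Suc of_nat_neq_0 add.commute power_not_zero)
  ultimately show ?thesis by simp
qed

lemma legendre_coeff_eq_0: "n < k \<Longrightarrow> legendre_coeff k (of_nat n) = 0"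
  unfolding legendre_coeff_def by (simp flip: binomial_gbinomial add: binomial_eq_0)

text \<open>
  Integer lower indices make Pascal's rule hold without side conditions, so that the shifts
  \<open>d - 1\<close> and \<open>d + 1\<close> below need no case distinctions.
\<close>

definition int_binomial :: "nat \<Rightarrow> int \<Rightarrow> rat" where
  "int_binomial n j = (if j < 0 then 0 else of_nat (n choose nat j))"

lemma int_binomial_Suc: "int_binomial (Suc n) j = int_binomial n j + int_binomial n (j - 1)"
proof (cases "j \<le> 0")
  case False
  then obtain i where "j = int (Suc i)" by (metis not_le zero_less_imp_eq_int gr0_implies_Suc)
  then show ?thesis by (simp add: int_binomial_def nat_add_distrib)
qed (auto simp: int_binomial_def)

text \<open>
  The coefficient of \<open>z ^ d\<close> in \<open>(z + 2 + 1/z) ^ k\<close>.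
\<close>

definition central_binomial :: "nat \<Rightarrow> int \<Rightarrow> rat" where
  "central_binomial k d = int_binomial (2 * k) (int k + d)"

lemma central_binomial_of_nat: "central_binomial k (int d) = of_nat (2 * k choose (k + d))"
  by (simp add: central_binomial_def int_binomial_def nat_add_distrib)

lemma central_binomial_Suc: "central_binomial (Suc k) d = central_binomial k (d - 1) + 2 * central_binomial k d + central_binomial k (d + 1)"
proof -
  have "central_binomial (Suc k) d = int_binomial (Suc (Suc (2 * k))) (int k + d + 1)"
    by (simp add: central_binomial_def algebra_simps)
  then show ?thesis by (simp add: central_binomial_def int_binomial_Suc algebra_simps)
qed

text \<open>
  The coefficient of \<open>z ^ d\<close> in \<open>P_n(- (z + 1/z) / 2)\<close>, that is, the Fourier coefficients of
  \<open>P_n(- cos \<theta>)\<close>.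
\<close>

definition legendre_fourier :: "nat \<Rightarrow> int \<Rightarrow> rat" where
  "legendre_fourier n d = (\<Sum>k\<le>n. legendre_coeff k (of_nat n) / 4 ^ k * central_binomial k d)"

lemma legendre_fourier_eq_sum:
  assumes "n \<le> K" shows "legendre_fourier n d = (\<Sum>k\<le>K. legendre_coeff k (of_nat n) / 4 ^ k * central_binomial k d)"
  unfolding legendre_fourier_def using assms by (intro sum.mono_neutral_left) (auto simp: legendre_coeff_eq_0)

lemma legendre_fourier_0: "legendre_fourier 0 d = (if d = 0 then 1 else 0)"
  by (auto simp: legendre_fourier_def central_binomial_def int_binomial_def binomial_eq_0)

lemma sum_three_term:
  "(\<Sum>k\<le>Suc K. ((a + 1) * legendre_coeff k (a + 1) + a * legendre_coeff k (a - 1)) / 4 ^ k * central_binomial k d)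
    = (2 * a + 1) * ((\<Sum>k\<le>Suc K. legendre_coeff k a / 4 ^ k * central_binomial k d)
        - (\<Sum>k\<le>K. legendre_coeff k a / 4 ^ k * central_binomial (Suc k) d) / 2)"
proof -
  have "((a + 1) * legendre_coeff (Suc k) (a + 1) + a * legendre_coeff (Suc k) (a - 1)) / 4 ^ Suc k * central_binomial (Suc k) d
     = (2 * a + 1) * (legendre_coeff (Suc k) a / 4 ^ Suc k * central_binomial (Suc k) d - legendre_coeff k a / 4 ^ k * central_binomial (Suc k) d / 2)" for k
    unfolding legendre_coeff_three_term by (simp add: field_simps)
  then show ?thesis
    by (simp only: sum.atMost_Suc_shift sum_subtractf sum_divide_distrib)
      (simp add: algebra_simps sum_subtractf sum_distrib_left sum_divide_distrib)
qed

text \<open>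
  Bonnet's recurrence at \<open>x = - (z + 1/z) / 2\<close>; multiplication by \<open>x\<close> shifts the index \<open>d\<close> by one in both
  directions.
\<close>

lemma legendre_fourier_recurrence:
  "of_nat (n + 2) * legendre_fourier (n + 2) d + of_nat (n + 1) * legendre_fourier n d
     = - (of_nat (2 * n + 3) / 2) * (legendre_fourier (n + 1) (d - 1) + legendre_fourier (n + 1) (d + 1))"
proof -
  define a :: rat where "a = of_nat (n + 1)"
  have a: "of_nat (n + 2) = a + 1" "of_nat n = a - 1" "of_nat (2 * n + 3) = 2 * a + 1"
    by (simp_all add: a_def)
  define c where "c e = central_binomial e d" for e
  have legendre_fourier: "legendre_fourier n d = (\<Sum>k\<le>Suc (n + 1). legendre_coeff k (a - 1) / 4 ^ k * central_binomial k d)"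
    "legendre_fourier (n + 2) d = (\<Sum>k\<le>Suc (n + 1). legendre_coeff k (a + 1) / 4 ^ k * central_binomial k d)"
    "legendre_fourier (n + 1) d = (\<Sum>k\<le>Suc (n + 1). legendre_coeff k a / 4 ^ k * central_binomial k d)"
    "legendre_fourier (n + 1) e = (\<Sum>k\<le>n + 1. legendre_coeff k a / 4 ^ k * central_binomial k e)" for e
    using legendre_fourier_eq_sum[of n "Suc (n + 1)" d] legendre_fourier_eq_sum[of "n + 2" "Suc (n + 1)" d]
      legendre_fourier_eq_sum[of "n + 1" "Suc (n + 1)" d] legendre_fourier_def[of "n + 1" e]
    by (simp_all only: a a_def)
  have "(a + 1) * legendre_fourier (n + 2) d + a * legendre_fourier n d
      = (\<Sum>k\<le>Suc (n + 1). ((a + 1) * legendre_coeff k (a + 1) + a * legendre_coeff k (a - 1)) / 4 ^ k * central_binomial k d)"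
    unfolding legendre_fourier(1,2) sum_distrib_left sum.distrib[symmetric]
    by (intro sum.cong) (auto simp: field_simps)
  also have "\<dots> = (2 * a + 1) * (legendre_fourier (n + 1) d - (\<Sum>k\<le>n + 1. legendre_coeff k a / 4 ^ k * central_binomial (Suc k) d) / 2)"
    unfolding sum_three_term legendre_fourier(3) ..
  also have "(\<Sum>k\<le>n + 1. legendre_coeff k a / 4 ^ k * central_binomial (Suc k) d)
      = legendre_fourier (n + 1) (d - 1) + 2 * legendre_fourier (n + 1) d + legendre_fourier (n + 1) (d + 1)"
    unfolding legendre_fourier(4) sum_distrib_left sum.distrib[symmetric] central_binomial_Suc
    by (intro sum.cong) (auto simp: field_simps)
  also have "(2 * a + 1) * (legendre_fourier (n + 1) d - (legendre_fourier (n + 1) (d - 1) + 2 * legendre_fourier (n + 1) d + legendre_fourier (n + 1) (d + 1)) / 2)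
      = - ((2 * a + 1) / 2) * (legendre_fourier (n + 1) (d - 1) + legendre_fourier (n + 1) (d + 1))"
    by (simp add: field_simps)
  finally show ?thesis unfolding a using a_def by simp
qed

lemma legendre_fourier_1: "legendre_fourier 1 d = - (legendre_fourier 0 (d - 1) + legendre_fourier 0 (d + 1)) / 2"
proof -
  have "legendre_fourier 1 d = central_binomial 0 d - central_binomial 1 d / 2"
    by (simp add: legendre_fourier_def legendre_coeff_def)
  also have "central_binomial 1 d = central_binomial 0 (d - 1) + 2 * central_binomial 0 d + central_binomial 0 (d + 1)"
    using central_binomial_Suc[of 0 d] by simp
  also have "central_binomial 0 d - (central_binomial 0 (d - 1) + 2 * central_binomial 0 d + central_binomial 0 (d + 1)) / 2
      = - (legendre_fourier 0 (d - 1) + legendre_fourier 0 (d + 1)) / 2"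
    by (simp add: legendre_fourier_def field_simps)
  finally show ?thesis .
qed

text \<open>
  \<open>P_n\<close> has the parity of \<open>n\<close>; the recurrence propagates this from \<open>n = 0\<close> and \<open>n = 1\<close>.
\<close>

lemma legendre_fourier_odd_eq_0: "odd (int n - d) \<Longrightarrow> legendre_fourier n d = 0"
proof (induction n arbitrary: d rule: less_induct)
  case (less n)
  consider "n = 0" | "n = 1" | m where "n = m + 2"
    by (metis One_nat_def Suc_1 add_2_eq_Suc' not0_implies_Suc)
  then show ?case
  proof cases
    case 1
    then show ?thesis using less by (auto simp: legendre_fourier_0)
  next
    case 2
    then show ?thesis using less.prems legendre_fourier_1[of d] legendre_fourier_0[of "d - 1"] legendre_fourier_0[of "d + 1"]
      by (cases "d = 1"; cases "d = - 1") auto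
  next
    case 3
    have "of_nat (m + 2) * legendre_fourier (m + 2) d = 0"
      using legendre_fourier_recurrence[of m d] less.IH[of m d] less.IH[of "m + 1" "d - 1"] less.IH[of "m + 1" "d + 1"]
        less.prems 3 by auto
    moreover have "of_nat (m + 2) \<noteq> (0::rat)" by (metis add_2_eq_Suc' of_nat_neq_0)
    ultimately show ?thesis using 3 by simp
  qed
qed

abbreviation half_binomial :: "nat \<Rightarrow> rat" where "half_binomial k \<equiv> (- 1 / 2) gchoose k"

lemma half_binomial_Suc: "half_binomial (Suc k) = - (2 * of_nat k + 1) / (2 * (of_nat k + 1)) * half_binomial k"
  unfolding gbinomial_Suc_rec by (simp add: field_simps)

lemma legendre_fourier_outside_eq_0: "\<bar>d\<bar> > int n \<Longrightarrow> legendre_fourier n d = 0"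
  unfolding legendre_fourier_def by (intro sum.neutral) (auto simp: central_binomial_def int_binomial_def binomial_eq_0 abs_if split: if_splits)

text \<open>
  For \<open>x = - (z + 1/z) / 2\<close> the generating function \<open>\<Sum> P_n(x) u ^ n\<close> of the Legendre polynomials factors as
  \<open>(1 + z u) powr (- 1/2) * (1 + u / z) powr (- 1/2)\<close>, which explains the product form.  The proof checks the product against the recurrence; the indices with \<open>a = 0\<close> or \<open>b = 0\<close> are the
  ends of the Fourier support, where one of the neighbouring coefficients is zero.
\<close>

lemma legendre_fourier_closed_form: "legendre_fourier (a + b) (int a - int b) = half_binomial a * half_binomial b"
proof (induction "a + b" arbitrary: a b rule: less_induct)
  case less
  consider "a + b = 0" | "a + b = 1" | m where "a + b = m + 2"
    by (metis One_nat_def Suc_1 add_2_eq_Suc' not0_implies_Suc)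
  then show ?case
  proof cases
    case 1
    then show ?thesis by (simp add: legendre_fourier_0)
  next
    case 2
    then have "a = 1 \<and> b = 0 \<or> a = 0 \<and> b = 1" by auto
    then show ?thesis using legendre_fourier_1[of 1] legendre_fourier_1[of "- 1"] by (auto simp: legendre_fourier_0)
  next
    case 3
    have rec: "of_nat (m + 2) * legendre_fourier (m + 2) (int a - int b) =
      - (of_nat (2 * m + 3) / 2) * (legendre_fourier (m + 1) (int a - int b - 1) + legendre_fourier (m + 1) (int a - int b + 1))
      - of_nat (m + 1) * legendre_fourier m (int a - int b)"
      using legendre_fourier_recurrence[of m "int a - int b"] by (simp add: algebra_simps)
    have nz: "of_nat (m + 2) \<noteq> (0::rat)" by (metis add_2_eq_Suc' of_nat_neq_0)
    consider "a = 0" | "b = 0" | a' b' where "a = Suc a'" "b = Suc b'"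
      by (metis not0_implies_Suc)
    then show ?thesis
    proof cases
      case 1
      then have b: "b = m + 2" using 3 by simp
      have "legendre_fourier (m + 1) (int a - int b + 1) = half_binomial 0 * half_binomial (m + 1)"
        using less(1)[of 0 "m + 1"] 1 b by (simp add: algebra_simps)
      moreover have "legendre_fourier (m + 1) (int a - int b - 1) = 0" "legendre_fourier m (int a - int b) = 0"
        using 1 b by (auto intro!: legendre_fourier_outside_eq_0)
      ultimately have "of_nat (m + 2) * legendre_fourier (m + 2) (int a - int b) = of_nat (m + 2) * half_binomial (m + 2)"
        unfolding rec using half_binomial_Suc[of "m + 1"] by (simp add: field_simps)
      then show ?thesis using nz 1 b by simp
    next
      case 2
      then have b: "a = m + 2" using 3 by simp
      have "legendre_fourier (m + 1) (int a - int b - 1) = half_binomial (m + 1) * half_binomial 0"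
        using less(1)[of "m + 1" 0] 2 b by (simp add: algebra_simps)
      moreover have "legendre_fourier (m + 1) (int a - int b + 1) = 0" "legendre_fourier m (int a - int b) = 0"
        using 2 b by (auto intro!: legendre_fourier_outside_eq_0)
      ultimately have "of_nat (m + 2) * legendre_fourier (m + 2) (int a - int b) = of_nat (m + 2) * half_binomial (m + 2)"
        unfolding rec using half_binomial_Suc[of "m + 1"] by (simp add: field_simps)
      then show ?thesis using nz 2 b by simp
    next
      case (3 a' b')
      have m: "m = a' + b'" using 3 \<open>a + b = m + 2\<close> by simp
      have "legendre_fourier (m + 1) (int a - int b - 1) = half_binomial a' * half_binomial (Suc b')"
        using less(1)[of a' "Suc b'"] 3 m by (simp add: algebra_simps)
      moreover have "legendre_fourier (m + 1) (int a - int b + 1) = half_binomial (Suc a') * half_binomial b'"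
        using less(1)[of "Suc a'" b'] 3 m by (simp add: algebra_simps)
      moreover have "legendre_fourier m (int a - int b) = half_binomial a' * half_binomial b'"
        using less(1)[of a' b'] 3 m by (simp add: algebra_simps)
      ultimately have "of_nat (m + 2) * legendre_fourier (m + 2) (int a - int b)
          = - (of_nat (2 * m + 3) / 2) * (half_binomial a' * half_binomial (Suc b') + half_binomial (Suc a') * half_binomial b')
            - of_nat (m + 1) * (half_binomial a' * half_binomial b')"
        unfolding rec by simp
      also have "\<dots> = of_nat (m + 2) * (half_binomial (Suc a') * half_binomial (Suc b'))"
        unfolding half_binomial_Suc m by (simp add: divide_simps) (simp add: algebra_simps)
      finally have "of_nat (m + 2) * legendre_fourier (m + 2) (int a - int b)
          = of_nat (m + 2) * (half_binomial (Suc a') * half_binomial (Suc b'))" .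
      then show ?thesis using nz 3 m by simp
    qed
  qed
qed

text \<open>
  The recurrence of \<open>legendre_coeff\<close> at \<open>a = - r\<close> has the factors \<open>k + r\<close> and \<open>k + 1 - r\<close>; a hypergeometric term
  is determined by its initial value and its ratio.
\<close>

lemma legendre_coeff_eqI:
  assumes "F 0 = 1" and "\<And>k. (of_nat k + 1) ^ 2 * F (Suc k) = (of_nat k + r) * (of_nat k + 1 - r) * F k"
  shows "F k = legendre_coeff k (- r)"
proof (induction k)
  case 0
  then show ?case using assms by simp
next
  case (Suc k)
  have "(of_nat k + 1) ^ 2 * F (Suc k) = (of_nat k + 1) ^ 2 * legendre_coeff (Suc k) (- r)"
    unfolding assms(2) legendre_coeff_Suc Suc by (simp add: algebra_simps)
  moreover have "(of_nat k + 1 :: rat) ^ 2 \<noteq> 0"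
    by (metis of_nat_Suc of_nat_neq_0 add.commute power_not_zero)
  ultimately show ?case using mult_left_cancel by blast
qed

lemma fact_Suc_rat: "(fact (Suc n) :: rat) = (of_nat n + 1) * fact n"
  by simp

lemma legendre_coeff_third: "of_nat ((2 * k choose k) * (3 * k choose k)) / 27 ^ k = legendre_coeff k (- (1 / 3))"
proof -
  define F :: "nat \<Rightarrow> rat" where "F k = fact (3 * k) / (fact k ^ 3 * 27 ^ k)" for k
  have "F k = legendre_coeff k (- (1 / 3))"
  proof (rule legendre_coeff_eqI)
    fix k
    have e: "3 * Suc k = Suc (Suc (Suc (3 * k)))" by simp
    define x :: rat where "x = of_nat k"
    have x: "x + 1 \<noteq> 0" unfolding x_def by (metis of_nat_Suc of_nat_neq_0 add.commute)
    show "(of_nat k + 1) ^ 2 * F (Suc k) = (of_nat k + 1 / 3) * (of_nat k + 1 - 1 / 3) * F k"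
      unfolding F_def e fact_Suc_rat using x
      by (simp add: x_def[symmetric] divide_simps power2_eq_square power3_eq_cube) (simp add: algebra_simps)
  qed (simp add: F_def)
  moreover have "of_nat ((2 * k choose k) * (3 * k choose k)) = (fact (3 * k) / fact k ^ 3 :: rat)"
    by (simp add: binomial_fact power3_eq_cube mult_2[symmetric])
  ultimately show ?thesis by (simp add: F_def)
qed

lemma legendre_coeff_quarter: "of_nat ((2 * k choose k) * (4 * k choose (2 * k))) / 64 ^ k = legendre_coeff k (- (1 / 4))"
proof -
  define F :: "nat \<Rightarrow> rat" where "F k = fact (4 * k) / (fact k ^ 2 * fact (2 * k) * 64 ^ k)" for k
  have "F k = legendre_coeff k (- (1 / 4))"
  proof (rule legendre_coeff_eqI)
    fix k
    have e: "4 * Suc k = Suc (Suc (Suc (Suc (4 * k))))" "2 * Suc k = Suc (Suc (2 * k))" by simp_all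
    define x :: rat where "x = of_nat k"
    have "x \<ge> 0" by (simp add: x_def)
    then have x: "x + 1 \<noteq> 0" "2 * x + 1 \<noteq> 0" "2 * x + 2 \<noteq> 0" by auto
    show "(of_nat k + 1) ^ 2 * F (Suc k) = (of_nat k + 1 / 4) * (of_nat k + 1 - 1 / 4) * F k"
      unfolding F_def e fact_Suc_rat using x
      by (simp add: x_def[symmetric] divide_simps power2_eq_square) (simp add: algebra_simps)
  qed (simp add: F_def)
  moreover have "of_nat ((2 * k choose k) * (4 * k choose (2 * k))) = (fact (4 * k) / (fact k ^ 2 * fact (2 * k)) :: rat)"
    by (simp add: binomial_fact power2_eq_square mult_2[symmetric])
  ultimately show ?thesis by (simp add: F_def)
qed

lemma legendre_coeff_sixth: "of_nat ((3 * k choose k) * (6 * k choose (3 * k))) / 432 ^ k = legendre_coeff k (- (1 / 6))"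
proof -
  define F :: "nat \<Rightarrow> rat" where "F k = fact (6 * k) / (fact k * fact (2 * k) * fact (3 * k) * 432 ^ k)" for k
  have "F k = legendre_coeff k (- (1 / 6))"
  proof (rule legendre_coeff_eqI)
    fix k
    have e: "6 * Suc k = Suc (Suc (Suc (Suc (Suc (Suc (6 * k))))))"
      "3 * Suc k = Suc (Suc (Suc (3 * k)))" "2 * Suc k = Suc (Suc (2 * k))" by simp_all
    define x :: rat where "x = of_nat k"
    have "x \<ge> 0" by (simp add: x_def)
    then have x: "x + 1 \<noteq> 0" "2 * x + 1 \<noteq> 0" "2 * x + 2 \<noteq> 0" "3 * x + 1 \<noteq> 0" "3 * x + 2 \<noteq> 0" "3 * x + 3 \<noteq> 0" by auto
    show "(of_nat k + 1) ^ 2 * F (Suc k) = (of_nat k + 1 / 6) * (of_nat k + 1 - 1 / 6) * F k"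
      unfolding F_def e fact_Suc_rat using x
      by (simp add: x_def[symmetric] divide_simps power2_eq_square) (simp add: algebra_simps)
  qed (simp add: F_def)
  moreover have "of_nat ((3 * k choose k) * (6 * k choose (3 * k))) = (fact (6 * k) / (fact k * fact (2 * k) * fact (3 * k)) :: rat)"
    by (simp add: binomial_fact)
  ultimately show ?thesis by (simp add: F_def)
qed

section \<open>The truncated sums modulo the square of p\<close>

context prime_gt_3
begin

text \<open>
  The case of arbitrary rational \<open>a\<close> is what makes the interpolation in \<open>a\<close> possible.
\<close>

definition trunc_sum :: "int \<Rightarrow> rat \<Rightarrow> rat" where
  "trunc_sum d a = (\<Sum>k=0..p-1. legendre_coeff k a / 4 ^ k * central_binomial k d)"

lemma trunc_sum_third: "(\<Sum>k=0..p-1. of_nat ((2*k choose (k+d)) * (2*k choose k) * (3*k choose k)) / 108 ^ k)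
    = trunc_sum (int d) (- (1 / 3))"
proof -
  have "(108 :: rat) ^ k = 27 ^ k * 4 ^ k" for k by (simp flip: power_mult_distrib)
  then show ?thesis
    unfolding trunc_sum_def central_binomial_of_nat legendre_coeff_third[symmetric] by (intro sum.cong) (auto simp: field_simps)
qed

lemma trunc_sum_quarter: "(\<Sum>k=0..p-1. of_nat ((2*k choose (k+d)) * (2*k choose k) * (4*k choose (2*k))) / 256 ^ k)
    = trunc_sum (int d) (- (1 / 4))"
proof -
  have "(256 :: rat) ^ k = 64 ^ k * 4 ^ k" for k by (simp flip: power_mult_distrib)
  then show ?thesis
    unfolding trunc_sum_def central_binomial_of_nat legendre_coeff_quarter[symmetric] by (intro sum.cong) (auto simp: field_simps)
qed

lemma trunc_sum_sixth: "(\<Sum>k=0..p-1. of_nat ((2*k choose (k+d)) * (3*k choose k) * (6*k choose (3*k))) / 12 ^ (3*k))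
    = trunc_sum (int d) (- (1 / 6))"
proof -
  have "(12 :: rat) ^ (3 * k) = 432 ^ k * 4 ^ k" for k by (simp add: power_mult flip: power_mult_distrib)
  then show ?thesis
    unfolding trunc_sum_def central_binomial_of_nat legendre_coeff_sixth[symmetric] by (intro sum.cong) (auto simp: field_simps)
qed

lemma not_p_dvd: "\<not> p dvd 3" "\<not> p dvd 4" "\<not> p dvd 6"
proof -
  have "\<not> p dvd 2" using p_gt_3 by (auto dest: dvd_imp_le)
  moreover show "\<not> p dvd 3" using p_gt_3 by (auto dest: dvd_imp_le)
  ultimately have "\<not> p dvd 2 * 2" "\<not> p dvd 2 * 3" using p_prime prime_dvd_mult_iff by blast+
  then show "\<not> p dvd 4" "\<not> p dvd 6" by simp_all
qed

lemma affine_mod_trunc_sum: "affine_mod (\<lambda>t. trunc_sum d (of_nat n + of_nat p * t))"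
  unfolding trunc_sum_def
proof (intro affine_mod_sum affine_mod_mult)
  fix k assume "k \<in> {0..p-1}"
  then have k: "k < p" using p_gt_3 by auto
  have "affine_mod (\<lambda>t. (of_nat n + of_nat p * 1 * t) gchoose k)"
    "affine_mod (\<lambda>t. ((- 1 - of_nat n) + of_nat p * (- 1) * t) gchoose k)"
    using k by (intro affine_mod_gbinomial; simp)+
  from affine_mod_mult[OF this] have "affine_mod (\<lambda>t. legendre_coeff k (of_nat n + of_nat p * t))"
    by (simp add: legendre_coeff_def algebra_simps)
  moreover have "\<not> p dvd 4 ^ k"
    using p_prime prime_dvd_power[of p 4 k] not_p_dvd(2) by blast
  ultimately have "affine_mod (\<lambda>t. legendre_coeff k (of_nat n + of_nat p * t) / of_nat (4 ^ k))"
    by (rule affine_mod_divide)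
  then show "affine_mod (\<lambda>t. legendre_coeff k (of_nat n + of_nat p * t) / 4 ^ k)" by simp
  show "affine_mod (\<lambda>t. central_binomial k d)"
    by (rule affine_mod_const) (simp add: central_binomial_def int_binomial_def)
qed

lemma trunc_sum_of_nat: "n < p \<Longrightarrow> trunc_sum d (of_nat n) = legendre_fourier n d"
  unfolding trunc_sum_def using legendre_fourier_eq_sum[of n "p - 1" d] by (simp add: atMost_atLeast0)

text \<open>
  The second interpolation node: \<open>n - p\<close> and \<open>p - 1 - n\<close> are exchanged by \<open>a \<mapsto> - 1 - a\<close>.
\<close>

lemma trunc_sum_of_nat_minus_p:
  assumes "n < p" shows "trunc_sum d (of_nat n - of_nat p) = legendre_fourier (p - 1 - n) d"
proof -
  have eq: "of_nat n - of_nat p = - 1 - (of_nat (p - 1 - n) :: rat)"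
    using assms by (simp add: of_nat_diff)
  have "trunc_sum d (of_nat n - of_nat p) = trunc_sum d (of_nat (p - 1 - n))"
    unfolding trunc_sum_def eq legendre_coeff_reflect ..
  also have "\<dots> = legendre_fourier (p - 1 - n) d" using assms by (intro trunc_sum_of_nat) simp
  finally show ?thesis .
qed

lemma trunc_sum_cong_fourier:
  assumes "n < p" "t \<in> Z_loc p"
  shows "loc_cong p 2 (trunc_sum d (of_nat n + of_nat p * t)) ((1 + t) * legendre_fourier n d - t * legendre_fourier (p - 1 - n) d)"
  using affine_mod_interpolate[OF affine_mod_trunc_sum[of d n], of 0 "- 1" "- t"] assms
    trunc_sum_of_nat[of n d] trunc_sum_of_nat_minus_p[of n d]
  by simp

text \<open>
  Both interpolation values vanish, since \<open>n\<close> and \<open>p - 1 - n\<close> have the same parity.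
\<close>

lemma trunc_sum_vanish:
  assumes "n < p" "r * n + 1 = c * p" "\<not> p dvd r" "odd (int n - d)"
  shows "loc_cong p 2 (trunc_sum d (- (1 / of_nat r))) 0"
proof -
  have r: "r \<noteq> 0" using assms(3) by (metis dvd_0_right)
  define t :: rat where "t = - (of_nat c / of_nat r)"
  have "of_nat (r * n + 1) = (of_nat (c * p) :: rat)" using assms(2) by simp
  then have eq: "of_nat n + of_nat p * t = - (1 / of_nat r)"
    using r by (simp add: t_def divide_simps) (simp add: algebra_simps)
  have "odd p" using p_prime p_gt_3 by (intro prime_odd_nat) auto
  then have "odd (int (p - 1 - n) - d)" using assms(1,4) by (simp add: of_nat_diff)
  then have "legendre_fourier n d = 0" "legendre_fourier (p - 1 - n) d = 0" using assms legendre_fourier_odd_eq_0 by auto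
  moreover have "t \<in> Z_loc p" unfolding t_def by (intro Z_loc_uminus Z_loc_divide assms) simp
  ultimately show ?thesis
    using trunc_sum_cong_fourier[OF assms(1), of t d] unfolding eq by simp
qed

lemma odd_p: "odd p"
  using p_prime p_gt_3 by (intro prime_odd_nat) auto

lemma p_mod_3: "p mod 3 = 1 \<or> p mod 3 = 2"
proof -
  have "\<not> 3 dvd p" using p_prime p_gt_3 using primes_dvd_imp_eq[of 3 p] by auto
  then show ?thesis by presburger
qed

lemma Legendre_p_3: "Legendre (int p) 3 = (if p mod 3 = 1 then 1 else - 1)"
proof (cases "p mod 3 = 1")
  case True
  then have "int p mod 3 = 1" by (metis of_nat_1 of_nat_numeral zmod_int)
  moreover from this have "QuadRes 3 (int p)"
    unfolding QuadRes_def by (intro exI[of _ 1]) (simp add: cong_def)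
  ultimately show ?thesis using True by (simp add: Legendre_def cong_def)
next
  case False
  then have 2: "p mod 3 = 2" using p_mod_3 by simp
  then have p2: "int p mod 3 = 2" by (metis of_nat_numeral zmod_int)
  have "\<not> QuadRes 3 (int p)"
  proof
    assume "QuadRes 3 (int p)"
    then obtain y :: int where "y ^ 2 mod 3 = 2" using p2 by (auto simp: QuadRes_def cong_def)
    moreover have "y mod 3 = 0 \<or> y mod 3 = 1 \<or> y mod 3 = 2" by presburger
    ultimately show False using power_mod[of y 3 2] by auto
  qed
  then show ?thesis using False p2 by (simp add: Legendre_def cong_def)
qed

lemma sign_cong_imp_eq:
  assumes "[a = b] (mod int p)" "a \<in> {- 1, 0, 1}" "b \<in> {- 1, 0, 1}" shows "a = b"
proof -
  have "int p dvd a - b" using assms(1) by (simp add: cong_iff_dvd_diff)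
  moreover have "\<bar>a - b\<bar> < int p" using assms p_gt_3 by auto
  ultimately show ?thesis by (metis dvd_imp_le_int eq_iff_diff_eq_0 not_le abs_of_nat)
qed

lemma Legendre_values: "Legendre a q \<in> {- 1, 0, 1}"
  by (auto simp: Legendre_def)

lemma Legendre_eqI:
  assumes "[a ^ ((p - 1) div 2) = b] (mod int p)" "b \<in> {- 1, 1}"
  shows "Legendre a (int p) = b"
proof -
  have "[Legendre a (int p) = a ^ ((p - 1) div 2)] (mod int p)"
    using euler_criterion[of p a] p_prime p_gt_3 by simp
  then have "[Legendre a (int p) = b] (mod int p)" using assms(1) cong_trans by blast
  then show ?thesis by (rule sign_cong_imp_eq) (use assms(2) Legendre_values in auto)
qed

lemma Legendre_minus_1: "Legendre (- 1) (int p) = (if p mod 4 = 1 then 1 else - 1)"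
proof (rule Legendre_eqI)
  have "p mod 4 = 1 \<or> p mod 4 = 3" using odd_p by presburger
  then have "even ((p - 1) div 2) \<longleftrightarrow> p mod 4 = 1" by (auto; presburger)
  then show "[(- 1) ^ ((p - 1) div 2) = (if p mod 4 = 1 then 1 else - 1 :: int)] (mod int p)"
    by (auto simp: minus_one_power_iff)
qed auto

end

section \<open>The squares of Eisenstein sums as binomial expressions\<close>

context prime_gt_3
begin

definition h :: nat where "h = (p - 1) div 2"

lemma p_eq: "p = 2 * h + 1"
  using odd_p by (auto simp: h_def elim!: oddE)

lemma h_rat: "of_nat h = (of_nat p - 1 :: rat) / 2"
proof -
  have "of_nat p = (of_nat (2 * h + 1) :: rat)" using p_eq by simp
  then show ?thesis by simp
qed

lemma h_ge_2: "h \<ge> 2"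
  using p_eq p_gt_3 by linarith

lemma affine_mod_imp_cong_1:
  assumes "affine_mod f" "a \<in> Z_loc p" "b \<in> Z_loc p"
  shows "\<exists>e\<in>Z_loc p. f a = f b + of_nat p * e"
proof -
  obtain c c' where c: "c \<in> Z_loc p" "c' \<in> Z_loc p"
    "\<And>t. t \<in> Z_loc p \<Longrightarrow> loc_cong p 2 (f t) (c + of_nat p * c' * t)"
    using assms unfolding affine_mod_def by blast
  obtain z z' where z: "z \<in> Z_loc p" "f a - (c + of_nat p * c' * a) = of_nat p ^ 2 * z"
    and z': "z' \<in> Z_loc p" "f b - (c + of_nat p * c' * b) = of_nat p ^ 2 * z'"
    using c(3)[OF assms(2)] c(3)[OF assms(3)] unfolding loc_cong_def by blast
  have "f a = f b + of_nat p * (c' * (a - b) + of_nat p * (z - z'))"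
    using z(2) z'(2) by (simp add: algebra_simps power2_eq_square)
  moreover have "c' * (a - b) + of_nat p * (z - z') \<in> Z_loc p" using assms c z z' by auto
  ultimately show ?thesis by blast
qed

text \<open>
  \<open>h = - 1/2 + p/2\<close>, so \<open>h choose k\<close> and \<open>(- 1/2) gchoose k\<close> are two values of one affine function.
\<close>

lemma half_binomial_cong_binomial:
  assumes "k < p" shows "\<exists>e\<in>Z_loc p. half_binomial k = of_nat (h choose k) + of_nat p * e"
proof -
  have "affine_mod (\<lambda>s. (- (1 / 2) + of_nat p * 1 * s) gchoose k)"
    using assms by (intro affine_mod_gbinomial) auto
  from affine_mod_imp_cong_1[OF this, of 0 "1 / 2"]
  obtain e where e: "e \<in> Z_loc p" "((- (1 / 2) + of_nat p * 1 * 0) gchoose k) =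
     ((- (1 / 2) + of_nat p * 1 * (1 / 2)) gchoose k) + of_nat p * e" by auto
  have "- (1 / 2) + of_nat p * 1 * (1 / 2) = (of_nat h :: rat)" by (simp add: h_rat field_simps)
  then show ?thesis using e by (intro bexI[of _ e]) (auto simp: binomial_gbinomial)
qed

text \<open>
  \<open>3h = - 3/2 + p * 3/2\<close> and \<open>h - 1 = - 3/2 + p/2\<close>: the value at \<open>3/2\<close> is three times the value at
  \<open>1/2\<close> minus twice the value at \<open>0\<close>, and absorption brings both back to the upper indices \<open>h\<close> and
  \<open>- 1/2\<close>.  This replaces expansions of binomial coefficients by harmonic numbers.
\<close>

lemma binomial_3h_cong:
  assumes "Suc k < p"
  shows "loc_cong p 2 (of_nat h * of_nat (3 * h choose k))
     (of_nat (Suc k) * (4 * of_nat h * half_binomial (Suc k) + 3 * of_nat (h choose Suc k)))"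
proof -
  have "affine_mod (\<lambda>s. (- 3 / 2 + of_nat p * 1 * s) gchoose k)"
    using assms Z_loc_of_int[of "- 3"] by (intro affine_mod_gbinomial Z_loc_divide_2) auto
  from affine_mod_interpolate[OF this, of 0 "1 / 2" 3]
  have "loc_cong p 2 ((- 3 / 2 + of_nat p * (3 / 2)) gchoose k)
     (3 * ((- 3 / 2 + of_nat p / 2) gchoose k) - 2 * ((- 3 / 2) gchoose k))" by simp
  moreover have "- 3 / 2 + of_nat p * (3 / 2) = (of_nat (3 * h) :: rat)"
    "- 3 / 2 + of_nat p / 2 = (of_nat h - 1 :: rat)"
    by (simp_all add: h_rat field_simps)
  ultimately have 1: "loc_cong p 2 (of_nat (3 * h choose k))
     (3 * ((of_nat h - 1) gchoose k) - 2 * ((- 3 / 2) gchoose k))"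
    by (simp only: binomial_gbinomial)
  define n :: rat where "n = of_nat (Suc k)"
  have G: "((- 3 / 2) gchoose k) = - 2 * (n * half_binomial (Suc k))"
    using gbinomial_absorption[of k "- 1 / 2 :: rat"] by (simp add: n_def)
  have B: "of_nat h * ((of_nat h - 1 :: rat) gchoose k) = n * of_nat (h choose Suc k)"
    using gbinomial_absorption[of k "of_nat h :: rat"] by (simp add: binomial_gbinomial n_def)
  have "of_nat h * (3 * ((of_nat h - 1) gchoose k) - 2 * ((- 3 / 2) gchoose k))
      = 3 * (of_nat h * ((of_nat h - 1) gchoose k)) - 2 * of_nat h * ((- 3 / 2) gchoose k)"
    by (simp add: algebra_simps)
  also have "\<dots> = n * (4 * of_nat h * half_binomial (Suc k) + 3 * of_nat (h choose Suc k))"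
    unfolding B G by (simp add: algebra_simps)
  finally have "of_nat h * (3 * ((of_nat h - 1) gchoose k) - 2 * ((- 3 / 2) gchoose k))
     = of_nat (Suc k) * (4 * of_nat h * half_binomial (Suc k) + 3 * of_nat (h choose Suc k))"
    unfolding n_def .
  then show ?thesis using loc_cong_mult[OF loc_cong_refl[of "of_nat h" 2] 1] by simp
qed

lemma not_dvd_fact: "n < p \<Longrightarrow> \<not> int p dvd fact n"
  using prime_dvd_fact_iff[OF p_prime, of n]
  by (metis int_dvd_int_iff not_le of_nat_fact)

text \<open>
  The factors before \<open>p\<close> are handled by Wilson's theorem, and those after \<open>p\<close> are \<open>1, \<dots>, j\<close> modulo \<open>p\<close>.
\<close>

lemma fact_p_plus: "\<exists>w. fact (p + j) = int p * w \<and> [w = - fact j] (mod int p)"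
proof (induction j)
  case 0
  have "fact p = int p * fact (p - 1)" using p_gt_3 by (simp add: fact_reduce)
  then show ?case using wilson_theorem[OF p_prime] by auto
next
  case (Suc j)
  then obtain w where w: "fact (p + j) = int p * w" "[w = - fact j] (mod int p)" by blast
  have "fact (p + Suc j) = int p * (w * (int p + int (Suc j)))"
    using w(1) by (simp add: algebra_simps)
  moreover have "[w * (int p + int (Suc j)) = - fact j * (0 + int (Suc j))] (mod int p)"
    using w(2) by (intro cong_mult cong_add) (auto simp: cong_def)
  moreover have "- fact j * (0 + int (Suc j)) = - fact (Suc j)" by simp
  ultimately show ?case by metis
qed

lemma wilson_split: "k < p \<Longrightarrow> [fact k * fact (p - 1 - k) = (- 1 :: int) ^ Suc k] (mod int p)"
proof (induction k)
  case 0
  then show ?case using wilson_theorem[OF p_prime] by simp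
next
  case (Suc k)
  define j where "j = p - 2 - k"
  have j: "p - 1 - k = Suc j" "p - 1 - Suc k = j" "int p = int k + int j + 2"
    using Suc.prems by (auto simp: j_def of_nat_diff)
  have "fact (Suc k) * fact j + fact k * fact (Suc j) = (fact k * fact j * int p :: int)"
    unfolding j(3) by (simp add: algebra_simps)
  then have "[fact (Suc k) * fact j = - (fact k * fact (Suc j))] (mod int p)"
    by (simp add: cong_iff_dvd_diff)
  also have "[- (fact k * fact (Suc j)) = - ((- 1 :: int) ^ Suc k)] (mod int p)"
    using Suc.IH Suc.prems unfolding j(1) by (simp only: cong_minus_minus_iff Suc_lessD)
  finally show ?case unfolding j(2) by simp
qed


end

text \<open>
  \<open>M = 4\<close> means \<open>p = 8m + 3\<close> and \<open>M = 6\<close> means \<open>p = 12m + 5\<close>.  The oddness of \<open>(p + 1) / M\<close> makes a character of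
  order \<open>2M\<close> of the field with \<open>p ^ 2\<close> elements restrict to the Legendre symbol on the prime field.
\<close>

locale eisenstein_prime = prime_gt_3 +
  fixes M m :: nat
  assumes p_plus_1: "p + 1 = M * (2 * m + 1)" and M_cases: "M = 4 \<or> M = 6"
begin

lemma m_less: "2 * m + 1 \<le> h" "m < h" "2 * m < p"
  using p_plus_1 M_cases p_eq h_ge_2 by auto

text \<open>
  The value modulo \<open>p ^ 2\<close> of that one of the two conjugate Eisenstein sums which is prime to \<open>p\<close>, as it
  comes out of the geometric sums.
\<close>

definition E_unit :: int where
  "E_unit = (int p + 1) * ((1 - int h) * int (h choose (h - m))
     + int h * (int (3 * h choose (h - m - 1)) + int (3 * h choose (h - m + p))))"

text \<open>
  The value of the other Eisenstein sum.  The binomial coefficient is divisible by \<open>p\<close>, because \<open>p \<le> 3h\<close> while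
  \<open>h + m\<close> and \<open>2h - m\<close> are less than \<open>p\<close>.
\<close>

definition E_nonunit :: int where
  "E_nonunit = (int p + 1) * (int h * int (3 * h choose (h + m)))"

text \<open>
  The parameter \<open>t\<close> for which \<open>2m + p t = 1/M - 1\<close>.
\<close>

definition frac_shift :: rat where "frac_shift = - (1 / of_nat M)"

lemma frac_shift_Z_loc [simp]: "frac_shift \<in> Z_loc p"
  using M_cases by (auto simp: frac_shift_def)

lemma m_frac_shift: "of_nat m = (- frac_shift * (of_nat p + 1) - 1) / 2"
proof -
  have "of_nat (p + 1) = (of_nat (M * (2 * m + 1)) :: rat)" using p_plus_1 by simp
  then show ?thesis using M_cases by (auto simp: frac_shift_def field_simps)
qed

lemma binomial_parts:
  obtains e e' where "e \<in> Z_loc p" "e' \<in> Z_loc p"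
    "half_binomial m = of_nat (h choose m) + of_nat p * e"
    "half_binomial (h - m) = of_nat (h choose m) + of_nat p * e'"
proof -
  have "m < p" "h - m < p" using m_less p_eq by auto
  moreover have "h choose (h - m) = h choose m"
    using m_less by (intro binomial_symmetric[symmetric]) auto
  ultimately show ?thesis using half_binomial_cong_binomial[of m] half_binomial_cong_binomial[of "h - m"] that by metis
qed

text \<open>
  All binomial coefficients in \<open>E_unit\<close> reduce to \<open>h choose m\<close> and to \<open>(- 1/2) gchoose m\<close>,
  \<open>(- 1/2) gchoose (h - m)\<close>; the last two differ from the first by multiples of \<open>p\<close>, and what remains is a
  polynomial identity modulo \<open>p ^ 2\<close>.
\<close>

lemma E_unit_cong: "loc_cong p 2 (of_int E_unit) ((1 + frac_shift) * half_binomial m - frac_shift * half_binomial (h - m))"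
proof -
  obtain e e' where e: "e \<in> Z_loc p" "e' \<in> Z_loc p"
    "half_binomial m = of_nat (h choose m) + of_nat p * e"
    "half_binomial (h - m) = of_nat (h choose m) + of_nat p * e'"
    using binomial_parts .
  define b :: rat where "b = of_nat (h choose m)"
  define P :: rat where "P = of_nat p"
  define H :: rat where "H = of_nat h"
  have b: "of_nat (h choose (h - m)) = b"
    using m_less by (simp add: b_def binomial_symmetric[symmetric])
  have bZ: "b \<in> Z_loc p" "P \<in> Z_loc p" "H \<in> Z_loc p" by (auto simp: b_def P_def H_def)
  have gZ: "half_binomial m \<in> Z_loc p" "half_binomial (h - m) \<in> Z_loc p" using e bZ by auto
  have 1: "loc_cong p 2 (H * of_nat (3 * h choose (h - m - 1)))
     (of_nat (h - m) * (4 * H * half_binomial (h - m) + 3 * b))"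
    using binomial_3h_cong[of "h - m - 1"] m_less p_eq b by (simp add: Suc_diff_Suc H_def)
  have 2: "loc_cong p 2 (H * of_nat (3 * h choose (h - m + p)))
     (of_nat m * (4 * H * half_binomial m + 3 * b))"
  \<comment> \<open>For \<open>m = 0\<close>, that is \<open>p = 5\<close>, the lower index exceeds \<open>3h\<close> and both sides vanish.\<close>
  proof (cases m)
    case 0
    then show ?thesis using p_eq by (simp add: binomial_eq_0)
  next
    case (Suc m')
    have "3 * h choose (h - m + p) = 3 * h choose (3 * h - (h - m + p))"
      using Suc m_less p_eq by (intro binomial_symmetric) auto
    also have "3 * h - (h - m + p) = m'" using Suc m_less p_eq by auto
    finally show ?thesis using binomial_3h_cong[of m'] Suc m_less by (simp add: H_def b_def)
  qed
  have "loc_cong p 2 (of_int E_unit)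
     ((P + 1) * ((1 - H) * b + (of_nat (h - m) * (4 * H * half_binomial (h - m) + 3 * b)
        + of_nat m * (4 * H * half_binomial m + 3 * b))))" (is "loc_cong p 2 _ ?X")
    using loc_cong_mult[OF loc_cong_refl[of "P + 1" 2] loc_cong_add[OF loc_cong_refl[of "(1 - H) * b" 2] loc_cong_add[OF 1 2]]] bZ
    by (simp add: E_unit_def H_def P_def b distrib_left)
  also have "loc_cong p 2 ?X ((1 + frac_shift) * half_binomial m - frac_shift * half_binomial (h - m))"
  proof -
    define W where "W = - frac_shift * half_binomial m + (1 + frac_shift) * half_binomial (h - m)"
    define T where "T = (1 + frac_shift) * half_binomial m - frac_shift * half_binomial (h - m)"
    have H: "H = (P - 1) / 2" using h_rat by (simp add: H_def P_def)
    have m: "of_nat m = (- frac_shift * (P + 1) - 1) / 2" using m_frac_shift by (simp add: P_def)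
    have hm: "of_nat (h - m) = (P + frac_shift * (P + 1)) / 2"
      using m_less m H by (simp add: of_nat_diff H_def[symmetric] field_simps)
    define r where "r = (1 + frac_shift) * e' - frac_shift * e"
    have X: "?X = (P + 1) * (P * b + (P - 1) * (P * W - T))"
      unfolding hm m H W_def T_def by (simp add: field_simps)
    have W: "W = b + P * r"
      unfolding W_def e b_def[symmetric] P_def[symmetric] r_def by (simp add: algebra_simps)
    have WT: "W \<in> Z_loc p" "T \<in> Z_loc p" unfolding W_def T_def using gZ by auto
    have "?X - T = P ^ 2 * (b - T + P * W) + (P * b - P * W)"
      unfolding X power2_eq_square by (simp add: algebra_simps)
    also have "P * b - P * W = - (P ^ 2 * r)"
      unfolding W power2_eq_square by (simp add: algebra_simps)
    finally have "?X - T = of_nat p ^ 2 * (b - T + P * W - r)"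
      unfolding P_def[symmetric] by (simp add: algebra_simps)
    moreover have "b - T + P * W - r \<in> Z_loc p" using WT e bZ by (simp add: r_def)
    moreover have "?X \<in> Z_loc p" using gZ bZ by auto
    ultimately show ?thesis unfolding T_def[symmetric] using WT loc_congI by blast
  qed
  finally show ?thesis .
qed

lemma E_unit_cong_binomial: "[E_unit = int (h choose m)] (mod int p)"
proof -
  obtain e e' where e: "e \<in> Z_loc p" "e' \<in> Z_loc p"
    "half_binomial m = of_nat (h choose m) + of_nat p * e"
    "half_binomial (h - m) = of_nat (h choose m) + of_nat p * e'"
    using binomial_parts .
  obtain z where z: "z \<in> Z_loc p" "of_int E_unit - ((1 + frac_shift) * half_binomial m - frac_shift * half_binomial (h - m)) = of_nat p ^ 2 * z"
    using E_unit_cong by (auto simp: loc_cong_def)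
  have "of_int E_unit - of_int (int (h choose m)) = of_nat p ^ 1 * (of_nat p * z + (1 + frac_shift) * e - frac_shift * e')"
    using z(2) unfolding e by (simp add: algebra_simps power2_eq_square)
  then have "loc_cong p 1 (of_int E_unit) (of_int (int (h choose m)))"
    by (rule loc_congI[rotated 3]) (use e z in auto)
  then show ?thesis unfolding loc_cong_of_int_iff by simp
qed

text \<open>
  With weights \<open>1 + t\<close> and \<open>- t\<close> of sum \<open>1\<close>, the weighted mean of two squares and the square of the weighted
  mean differ by a multiple of the squared difference, here a multiple of \<open>p ^ 2\<close>.
\<close>

lemma trunc_sum_cong_square: "loc_cong p 2 (trunc_sum 0 (- (1 / of_nat M))) (of_int (E_unit ^ 2))"
proof -
  obtain e e' where e: "e \<in> Z_loc p" "e' \<in> Z_loc p"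
    "half_binomial m = of_nat (h choose m) + of_nat p * e"
    "half_binomial (h - m) = of_nat (h choose m) + of_nat p * e'"
    using binomial_parts .
  have gZ: "half_binomial m \<in> Z_loc p" "half_binomial (h - m) \<in> Z_loc p" using e by auto
  have "- (1 / of_nat M) = - 1 - (of_nat (2 * m) + of_nat p * frac_shift)"
    using m_frac_shift by (simp add: frac_shift_def algebra_simps add_divide_distrib)
  then have "trunc_sum 0 (- (1 / of_nat M)) = trunc_sum 0 (of_nat (2 * m) + of_nat p * frac_shift)"
    unfolding trunc_sum_def by (simp only: legendre_coeff_reflect)
  moreover have "legendre_fourier (2 * m) 0 = half_binomial m ^ 2"
    using legendre_fourier_closed_form[of m m] by (simp add: mult_2 power2_eq_square)
  moreover have "p - 1 - 2 * m = (h - m) + (h - m)" using p_eq m_less by simp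
  then have "legendre_fourier (p - 1 - 2 * m) 0 = half_binomial (h - m) ^ 2"
    using legendre_fourier_closed_form[of "h - m" "h - m"] by (simp add: power2_eq_square)
  ultimately have "loc_cong p 2 (trunc_sum 0 (- (1 / of_nat M))) ((1 + frac_shift) * half_binomial m ^ 2 - frac_shift * half_binomial (h - m) ^ 2)"
    using trunc_sum_cong_fourier[of "2 * m" frac_shift 0] m_less by simp
  also have "loc_cong p 2 \<dots> (((1 + frac_shift) * half_binomial m - frac_shift * half_binomial (h - m)) ^ 2)"
  proof -
    have "half_binomial m - half_binomial (h - m) = of_nat p * (e - e')" unfolding e by (simp add: algebra_simps)
    moreover have "(1 + frac_shift) * g ^ 2 - frac_shift * g' ^ 2 - ((1 + frac_shift) * g - frac_shift * g') ^ 2 = - frac_shift * (1 + frac_shift) * (g - g') ^ 2" for g g'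
      by (simp add: algebra_simps power2_eq_square)
    ultimately have "(1 + frac_shift) * half_binomial m ^ 2 - frac_shift * half_binomial (h - m) ^ 2 - ((1 + frac_shift) * half_binomial m - frac_shift * half_binomial (h - m)) ^ 2
        = of_nat p ^ 2 * (- frac_shift * (1 + frac_shift) * (e - e') ^ 2)"
      by (simp add: power_mult_distrib)
    then show ?thesis by (rule loc_congI[rotated 3]) (use gZ e(1,2) in auto)
  qed
  also have "loc_cong p 2 \<dots> (of_int (E_unit ^ 2))"
    using loc_cong_power[OF loc_cong_sym[OF E_unit_cong], of 2] by simp
  finally show ?thesis .
qed

text \<open>
  After division by \<open>p\<close> everything is a quotient of factorials below \<open>p\<close>.  Wilson's theorem in the form
  \<open>wilson_split\<close> pairs \<open>m!\<close> with \<open>(p - 1 - m)!\<close> and \<open>(h - m)!\<close> with \<open>(h + m)!\<close>, and leaves a sign.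
\<close>

lemma E_unit_E_nonunit:
  obtains c where "E_nonunit = int p * c" "[E_unit * E_nonunit = int p] (mod (int p) ^ 2)"
proof -
  obtain w where w: "fact (p + (h - 1)) = int p * w" "[w = - fact (h - 1)] (mod int p)"
    using fact_p_plus by blast
  have eq: "p + (h - 1) = 3 * h" using p_eq h_ge_2 by simp
  have "fact (h + m) * fact (3 * h - (h + m)) * (3 * h choose (h + m)) = (fact (3 * h) :: nat)"
    using m_less by (intro binomial_fact_lemma) simp
  moreover have "3 * h - (h + m) = p - 1 - m" using p_eq by simp
  ultimately have "int (fact (h + m) * fact (p - 1 - m) * (3 * h choose (h + m))) = int (fact (3 * h))"
    by simp
  then have C: "fact (h + m) * fact (p - 1 - m) * int (3 * h choose (h + m)) = int p * w"
    using w(1) unfolding eq by simp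
  have "\<not> int p dvd fact (h + m)" "\<not> int p dvd fact (p - 1 - m)"
    using not_dvd_fact[of "h + m"] not_dvd_fact[of "p - 1 - m"] p_eq m_less by auto
  moreover have "int p dvd fact (h + m) * fact (p - 1 - m) * int (3 * h choose (h + m))"
    unfolding C by simp
  ultimately have "int p dvd int (3 * h choose (h + m))"
    using p_prime by (simp add: prime_dvd_mult_iff)
  then obtain q where q: "int (3 * h choose (h + m)) = int p * q" by blast
  have qw: "fact (h + m) * fact (p - 1 - m) * q = w"
    using C p_gt_3 unfolding q by (simp add: algebra_simps)
  have "fact m * fact (h - m) * (h choose m) = (fact h :: nat)"
    using m_less by (intro binomial_fact_lemma) simp
  then have "int (fact m * fact (h - m) * (h choose m)) = int (fact h)" by simp
  then have b: "fact m * fact (h - m) * int (h choose m) = fact h" by simp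
  have s1: "[fact m * fact (p - 1 - m) = (- 1 :: int) ^ Suc m] (mod int p)"
    using wilson_split[of m] m_less p_eq by simp
  have "p - 1 - (h - m) = h + m" using p_eq m_less by simp
  then have s2: "[fact (h - m) * fact (h + m) = (- 1 :: int) ^ Suc (h - m)] (mod int p)"
    using wilson_split[of "h - m"] m_less p_eq by simp
  have s3: "[fact h * fact h = (- 1 :: int) ^ Suc h] (mod int p)"
  proof -
    have "p - 1 - h = h" "h < p" using p_eq by auto
    then show ?thesis using wilson_split[of h] by simp
  qed
  define x where "x = int h * int (h choose m) * q"
  have "[x * (- 1) ^ h = x * ((- 1) ^ Suc m * (- 1) ^ Suc (h - m))] (mod int p)"
    using m_less by (simp flip: power_add)
  also have "[x * ((- 1) ^ Suc m * (- 1) ^ Suc (h - m))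
      = x * ((fact m * fact (p - 1 - m)) * (fact (h - m) * fact (h + m)))] (mod int p)"
    by (intro cong_mult cong_refl cong_sym[OF s1] cong_sym[OF s2])
  also have "x * ((fact m * fact (p - 1 - m)) * (fact (h - m) * fact (h + m))) = int h * fact h * w"
    unfolding x_def qw[symmetric] b[symmetric] by (simp add: ac_simps)
  also have "[int h * fact h * w = int h * fact h * (- fact (h - 1))] (mod int p)"
    by (intro cong_mult cong_refl w(2))
  also have "int h * fact h * (- fact (h - 1)) = - (fact h * fact h)"
    using h_ge_2 fact_reduce[of h, where 'a = int] by (simp add: ac_simps)
  also have "[- (fact h * fact h) = - ((- 1) ^ Suc h)] (mod int p)"
    using s3 by (simp only: cong_minus_minus_iff)
  finally have "[x * (- 1) ^ h = 1 * (- 1) ^ h] (mod int p)" by simp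
  then have "[x * (- 1) ^ h * (- 1) ^ h = 1 * (- 1) ^ h * (- 1) ^ h] (mod int p)"
    by (rule cong_scalar_right)
  then have x: "[x = 1] (mod int p)" by (simp add: mult.assoc flip: power_mult_distrib)
  have "[E_unit * ((int p + 1) * (int h * q)) = int (h choose m) * ((0 + 1) * (int h * q))] (mod int p)"
    by (intro cong_mult cong_add cong_refl E_unit_cong_binomial) (simp add: cong_def)
  also have "int (h choose m) * ((0 + 1) * (int h * q)) = x" by (simp add: x_def ac_simps)
  also note x
  finally have "[int p * (E_unit * ((int p + 1) * (int h * q))) = int p * 1] (mod (int p * int p))"
    by (simp only: cong_iff_dvd_diff flip: right_diff_distrib) (simp add: mult_dvd_mono)
  moreover have E': "E_nonunit = int p * ((int p + 1) * (int h * q))"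
    unfolding E_nonunit_def q by (simp add: ac_simps)
  ultimately have "[E_unit * E_nonunit = int p] (mod (int p) ^ 2)"
    by (simp add: ac_simps power2_eq_square)
  then show thesis using E' that by blast
qed

end

section \<open>Imaginary quadratic orders\<close>

text \<open>
  The order generated by the square root of \<open>- D\<close>, as a subset of the complex numbers: ring computations are
  then done in a commutative ring type although \<open>D\<close> is a variable.
\<close>

locale quadratic_order =
  fixes D :: nat
  assumes D_pos: "D > 0"
begin

definition omega :: complex ("\<omega>") where "\<omega> = of_real (sqrt (real D)) * \<i>"

definition Order :: "complex set" ("\<O>") where
  "\<O> = {of_int a + of_int b * \<omega> | a b. True}"

lemma omega_sq: "\<omega> * \<omega> = - of_nat D"
proof -
  have "\<omega> * \<omega> = - of_real (sqrt (real D) * sqrt (real D))"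
    unfolding omega_def of_real_mult by (simp add: algebra_simps)
  then show ?thesis by simp
qed

lemma Re_omega [simp]: "Re \<omega> = 0" and Im_omega: "Im \<omega> = sqrt (real D)"
  by (simp_all add: omega_def)

lemma cnj_omega [simp]: "cnj \<omega> = - \<omega>"
  by (simp add: omega_def)

lemma OrderI: "of_int a + of_int b * \<omega> \<in> \<O>"
  by (auto simp: Order_def)

lemma OrderE:
  assumes "z \<in> \<O>" obtains a b where "z = of_int a + of_int b * \<omega>"
  using assms by (auto simp: Order_def)

lemma Order_of_int [simp]: "of_int a \<in> \<O>"
  using OrderI[of a 0] by simp

lemma Order_simps [simp]: "of_nat n \<in> \<O>" "0 \<in> \<O>" "1 \<in> \<O>" "numeral k \<in> \<O>" "\<omega> \<in> \<O>"
  using Order_of_int[of "int n"] Order_of_int[of 0] Order_of_int[of 1] Order_of_int[of "numeral k"] OrderI[of 0 1]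
  by simp_all

lemma Order_add [simp]: "u \<in> \<O> \<Longrightarrow> v \<in> \<O> \<Longrightarrow> u + v \<in> \<O>"
proof (elim OrderE)
  fix a b c d assume "u = of_int a + of_int b * \<omega>" "v = of_int c + of_int d * \<omega>"
  then have "u + v = of_int (a + c) + of_int (b + d) * \<omega>" by (simp add: algebra_simps)
  then show ?thesis by (metis OrderI)
qed

lemma Order_mult [simp]: "u \<in> \<O> \<Longrightarrow> v \<in> \<O> \<Longrightarrow> u * v \<in> \<O>"
proof (elim OrderE)
  fix a b c d assume uv: "u = of_int a + of_int b * \<omega>" "v = of_int c + of_int d * \<omega>"
  have "u * v = of_int a * of_int c + (of_int a * of_int d + of_int b * of_int c) * \<omega> + of_int b * of_int d * (\<omega> * \<omega>)"
    unfolding uv by (simp add: algebra_simps)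
  then have "u * v = of_int (a * c - int D * b * d) + of_int (a * d + b * c) * \<omega>"
    unfolding omega_sq by (simp add: algebra_simps)
  then show ?thesis by (metis OrderI)
qed

lemma Order_uminus [simp]: "u \<in> \<O> \<Longrightarrow> - u \<in> \<O>"
  using Order_mult[of "of_int (- 1)" u] Order_of_int[of "- 1"] by simp

lemma Order_diff [simp]: "u \<in> \<O> \<Longrightarrow> v \<in> \<O> \<Longrightarrow> u - v \<in> \<O>"
  using Order_add[of u "- v"] by simp

lemma Order_power [simp]: "u \<in> \<O> \<Longrightarrow> u ^ n \<in> \<O>"
  by (induction n) auto

lemma Order_sum [simp]: "(\<And>i. i \<in> I \<Longrightarrow> f i \<in> \<O>) \<Longrightarrow> sum f I \<in> \<O>"
  by (induction I rule: infinite_finite_induct) auto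

lemma Order_cnj [simp]: "u \<in> \<O> \<Longrightarrow> cnj u \<in> \<O>"
  by (elim OrderE) (metis OrderI cnj_omega complex_cnj_add complex_cnj_mult complex_cnj_of_int
      minus_mult_commute mult_minus_right of_int_minus)

definition qcong :: "nat \<Rightarrow> complex \<Rightarrow> complex \<Rightarrow> bool" where
  "qcong n u v \<longleftrightarrow> (\<exists>w\<in>\<O>. u - v = of_nat n * w)"

lemma qcongI: "w \<in> \<O> \<Longrightarrow> u - v = of_nat n * w \<Longrightarrow> qcong n u v"
  by (auto simp: qcong_def)

lemma qcong_refl [simp]: "qcong n u u"
  by (rule qcongI[of 0]) auto

lemma qcong_sym: "qcong n u v \<Longrightarrow> qcong n v u"
  unfolding qcong_def by (metis Order_uminus minus_diff_eq mult_minus_right)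

lemma qcong_add: assumes "qcong n u v" "qcong n u' v'" shows "qcong n (u + u') (v + v')"
proof -
  obtain w w' where "w \<in> \<O>" "w' \<in> \<O>" "u - v = of_nat n * w" "u' - v' = of_nat n * w'"
    using assms by (auto simp: qcong_def)
  then show ?thesis by (intro qcongI[of "w + w'"]) (auto simp: algebra_simps)
qed

lemma qcong_trans [trans]: "qcong n u v \<Longrightarrow> qcong n v w \<Longrightarrow> qcong n u w"
  using qcong_add[of n u v v w] by (auto simp: qcong_def)

lemma qcong_mult:
  assumes "qcong n u v" "qcong n u' v'" "u' \<in> \<O>" "v \<in> \<O>" shows "qcong n (u * u') (v * v')"
proof -
  obtain w w' where w: "w \<in> \<O>" "w' \<in> \<O>" "u - v = of_nat n * w" "u' - v' = of_nat n * w'"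
    using assms by (auto simp: qcong_def)
  have "u * u' - v * v' = (u - v) * u' + v * (u' - v')" by (simp add: algebra_simps)
  also have "\<dots> = of_nat n * (w * u' + v * w')" by (simp add: w algebra_simps)
  finally show ?thesis using w(1,2) assms(3,4) by (intro qcongI[of "w * u' + v * w'"]) auto
qed

lemma qcong_uminus: assumes "qcong n u v" shows "qcong n (- u) (- v)"
proof -
  obtain w where "w \<in> \<O>" "u - v = of_nat n * w" using assms by (auto simp: qcong_def)
  then show ?thesis by (intro qcongI[of "- w"]) (auto simp: algebra_simps)
qed

lemma qcong_diff: "qcong n u v \<Longrightarrow> qcong n u' v' \<Longrightarrow> qcong n (u - u') (v - v')"
  using qcong_add[of n u v "- u'" "- v'"] qcong_uminus[of n u' v'] by simp

lemma qcong_power: "qcong n u v \<Longrightarrow> u \<in> \<O> \<Longrightarrow> v \<in> \<O> \<Longrightarrow> qcong n (u ^ k) (v ^ k)"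
  by (induction k) (auto intro: qcong_mult)

lemma qcong_sum: "(\<And>i. i \<in> I \<Longrightarrow> qcong n (f i) (f' i)) \<Longrightarrow> qcong n (sum f I) (sum f' I)"
  by (induction I rule: infinite_finite_induct) (auto intro: qcong_add)

lemma qcong_iff_diff: "qcong n u v \<longleftrightarrow> qcong n (u - v) 0"
  by (simp add: qcong_def)

lemma qcong_dvd: "qcong n u v \<Longrightarrow> k dvd n \<Longrightarrow> qcong k u v"
proof -
  assume "qcong n u v" "k dvd n"
  then obtain w where "w \<in> \<O>" "u - v = of_nat n * w" by (auto simp: qcong_def)
  moreover obtain j where "n = k * j" using \<open>k dvd n\<close> by blast
  ultimately show ?thesis by (intro qcongI[of "of_nat j * w"]) auto
qed

text \<open>
  Congruences in the order are read off from coordinates because \<open>\<omega>\<close> is purely imaginary; in particular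
  congruences between integers descend to the integers.
\<close>

lemma qcong_0_iff:
  "qcong n (of_int a + of_int b * \<omega>) 0 \<longleftrightarrow> int n dvd a \<and> int n dvd b"
proof
  assume "qcong n (of_int a + of_int b * \<omega>) 0"
  then obtain w where "w \<in> \<O>" and w: "of_int a + of_int b * \<omega> = of_nat n * w"
    by (auto simp: qcong_def)
  then obtain c d where cd: "w = of_int c + of_int d * \<omega>" by (elim OrderE)
  have "real_of_int a = Re (of_int a + of_int b * \<omega>)" by simp
  also have "\<dots> = real_of_int (int n * c)" unfolding w cd by simp
  finally have 1: "a = int n * c" by (simp only: of_int_eq_iff)
  have "real_of_int b * sqrt (real D) = Im (of_int a + of_int b * \<omega>)" by (simp add: Im_omega)
  also have "\<dots> = real_of_int (int n * d) * sqrt (real D)" unfolding w cd by (simp add: Im_omega)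
  finally have "real_of_int b = real_of_int (int n * d)" using D_pos by simp
  then have "b = int n * d" by (simp only: of_int_eq_iff)
  with 1 show "int n dvd a \<and> int n dvd b" by simp
next
  assume "int n dvd a \<and> int n dvd b"
  then obtain c d where "a = int n * c" "b = int n * d" by (auto elim!: dvdE)
  then show "qcong n (of_int a + of_int b * \<omega>) 0"
    by (intro qcongI[OF OrderI[of c d]]) (simp add: algebra_simps)
qed

lemma qcong_of_int_iff: "qcong n (of_int a) (of_int b) \<longleftrightarrow> [a = b] (mod (int n))"
  using qcong_0_iff[of n "a - b" 0] qcong_iff_diff[of n "of_int a" "of_int b"]
  by (simp add: cong_iff_dvd_diff)

lemma qcong_power_prime_add:
  assumes "prime p" "u \<in> \<O>" "v \<in> \<O>"
  shows "qcong p ((u + v) ^ p) (u ^ p + v ^ p)"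
proof -
  have "p > 0" using assms(1) by (rule prime_gt_0_nat)
  have "(u + v) ^ p = (\<Sum>k\<le>p. of_nat (p choose k) * u ^ k * v ^ (p - k))"
    by (rule binomial_ring)
  also have "qcong p \<dots> (\<Sum>k\<le>p. if k = 0 then v ^ p else if k = p then u ^ p else 0)"
  proof (rule qcong_sum)
    fix k assume k: "k \<in> {..p}"
    show "qcong p (of_nat (p choose k) * u ^ k * v ^ (p - k)) (if k = 0 then v ^ p else if k = p then u ^ p else 0)"
    proof (cases "k = 0 \<or> k = p")
      case False
      then have "p dvd (p choose k)" using k assms(1) by (intro dvd_choose_prime) auto
      then obtain j where "p choose k = p * j" by blast
      then show ?thesis using False assms
        by (intro qcongI[of "of_nat j * u ^ k * v ^ (p - k)"]) auto
    qed auto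
  qed
  also have "(\<Sum>k\<le>p. if k = 0 then v ^ p else if k = p then u ^ p else 0)
      = (\<Sum>k\<le>p. (if k = p then u ^ p else 0) + (if k = 0 then v ^ p else 0))"
    using \<open>p > 0\<close> by (intro sum.cong) auto
  also have "\<dots> = u ^ p + v ^ p" by (simp add: sum.distrib)
  finally show ?thesis .
qed

text \<open>
  \<open>u ^ p - v ^ p\<close> is \<open>u - v\<close> times a sum of \<open>p\<close> terms that are all congruent to \<open>v ^ (p - 1)\<close>.
\<close>

lemma qcong_power_lift:
  assumes "qcong p u v" "u \<in> \<O>" "v \<in> \<O>" "p > 0"
  shows "qcong (p ^ 2) (u ^ p) (v ^ p)"
proof -
  obtain n where n: "p = Suc n" using assms(4) by (cases p) auto
  obtain w where w: "w \<in> \<O>" "u - v = of_nat p * w" using assms(1) by (auto simp: qcong_def)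
  have "qcong p (\<Sum>i<Suc n. u ^ i * v ^ (n - i)) (\<Sum>i<Suc n. v ^ i * v ^ (n - i))"
    using assms by (intro qcong_sum qcong_mult qcong_power) auto
  also have "(\<Sum>i<Suc n. v ^ i * v ^ (n - i)) = (\<Sum>i<Suc n. v ^ n)"
    by (intro sum.cong) (auto simp flip: power_add)
  also have "\<dots> = of_nat p * v ^ n" by (simp add: n)
  also have "qcong p \<dots> 0" using assms by (intro qcongI[of "v ^ n"]) auto
  finally obtain w' where w': "w' \<in> \<O>" "(\<Sum>i<Suc n. u ^ i * v ^ (n - i)) = of_nat p * w'"
    by (auto simp: qcong_def)
  have "u ^ p - v ^ p = (u - v) * (\<Sum>i<Suc n. u ^ i * v ^ (n - i))"
    unfolding n by (rule diff_power_eq_sum)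
  also have "\<dots> = of_nat (p ^ 2) * (w * w')"
    unfolding w'(2) w(2) by (simp add: power2_eq_square)
  finally show ?thesis using w w' by (intro qcongI[of "w * w'"]) auto
qed

text \<open>
  The supplementary law for \<open>2\<close>: compute \<open>(1 + i) ^ p\<close> once by Frobenius and once from \<open>(1 + i) ^ 2 = 2 i\<close>.
\<close>

lemma two_power_cong:
  assumes "prime p" "p = 2 * h + 1" "D = 1"
  shows "[2 ^ h = (if h mod 4 = 0 \<or> h mod 4 = 3 then 1 else - 1)] (mod int p)"
proof -
  have "of_nat D = (1 :: complex)" using assms(3) by simp
  then have sq: "\<omega> * \<omega> = - 1" by (simp only: omega_sq)
  have "(1 + \<omega>) ^ p = (1 + \<omega>) * ((1 + \<omega>) * (1 + \<omega>)) ^ h"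
    by (subst assms(2)) (simp only: power_add power_mult power2_eq_square power_one_right mult.commute power_mult_distrib)
  also have "(1 + \<omega>) * (1 + \<omega>) = 2 * \<omega>" using sq by (simp add: algebra_simps)
  finally have 1: "(1 + \<omega>) ^ p = 2 ^ h * (\<omega> ^ h * (1 + \<omega>))" by (simp add: power_mult_distrib)
  have "\<omega> ^ p = (- 1) ^ h * \<omega>"
    by (subst assms(2)) (simp add: power_add power_mult power2_eq_square sq)
  then have 2: "qcong p (2 ^ h * (\<omega> ^ h * (1 + \<omega>))) (1 + (- 1) ^ h * \<omega>)"
    using qcong_power_prime_add[OF assms(1), of 1 \<omega>] unfolding 1 by simp
  define j where "j = h div 4"
  have w4: "\<omega> ^ 4 = 1" using sq by (simp add: power4_eq_xxxx mult.assoc)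
  have w4j: "\<omega> ^ (4 * j) = 1" "(- 1 :: complex) ^ (4 * j) = 1" by (simp_all add: power_mult w4)
  consider "h = 4 * j" | "h = 4 * j + 1" | "h = 4 * j + 2" | "h = 4 * j + 3"
    unfolding j_def by linarith
  then show ?thesis
  proof cases
    case 1
    then have "\<omega> ^ h = 1" "(- 1 :: complex) ^ h = 1" by (simp_all add: w4j)
    then have "qcong p (of_int (2 ^ h - 1) + of_int (2 ^ h - 1) * \<omega>) 0"
      using 2 by (subst (asm) qcong_iff_diff) (simp add: algebra_simps)
    then show ?thesis unfolding qcong_0_iff using 1 by (simp add: cong_iff_dvd_diff)
  next
    case h: 2
    then have eq: "\<omega> ^ h * (1 + \<omega>) = - 1 + \<omega>" "(- 1 :: complex) ^ h = - 1"
      by (simp_all only: power_add w4j) (simp_all add: algebra_simps sq)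
    then have "qcong p (of_int (- (2 ^ h + 1)) + of_int (2 ^ h + 1) * \<omega>) 0"
      using 2 unfolding eq by (subst (asm) qcong_iff_diff) (simp add: algebra_simps)
    then show ?thesis unfolding qcong_0_iff using h by (simp add: cong_iff_dvd_diff)
  next
    case h: 3
    then have eq: "\<omega> ^ h * (1 + \<omega>) = - 1 - \<omega>" "(- 1 :: complex) ^ h = 1"
      by (simp_all only: power_add w4j) (simp_all add: algebra_simps power2_eq_square sq)
    have "qcong p (2 ^ h * (- 1 - \<omega>) - (1 + 1 * \<omega>)) 0"
      using 2 unfolding eq by (subst (asm) qcong_iff_diff)
    moreover have "2 ^ h * (- 1 - \<omega>) - (1 + 1 * \<omega>) = of_int (- (2 ^ h + 1)) + of_int (- (2 ^ h + 1)) * \<omega>"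
      by (simp add: algebra_simps)
    ultimately have "qcong p (of_int (- (2 ^ h + 1)) + of_int (- (2 ^ h + 1)) * \<omega>) 0"
      by (simp only:)
    then have "int p dvd - (2 ^ h + 1)" unfolding qcong_0_iff by blast
    then have "int p dvd 2 ^ h + 1" by (simp only: dvd_minus_iff)
    moreover have "h mod 4 = 2" using h by presburger
    ultimately show ?thesis by (simp add: cong_iff_dvd_diff)
  next
    case h: 4
    then have eq: "\<omega> ^ h * (1 + \<omega>) = 1 - \<omega>" "(- 1 :: complex) ^ h = - 1"
      by (simp_all only: power_add w4j) (simp_all add: algebra_simps power3_eq_cube sq)
    then have "qcong p (of_int (2 ^ h - 1) + of_int (- (2 ^ h - 1)) * \<omega>) 0"
      using 2 unfolding eq by (subst (asm) qcong_iff_diff) (simp add: algebra_simps)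
    then show ?thesis unfolding qcong_0_iff using h by (simp add: cong_iff_dvd_diff)
  qed
qed

end

context prime_gt_3
begin

lemma Legendre_minus_2: "Legendre (- 2) (int p) = (if p mod 8 = 1 \<or> p mod 8 = 3 then 1 else - 1)"
proof (rule Legendre_eqI)
  have "[2 ^ h = (if h mod 4 = 0 \<or> h mod 4 = 3 then 1 else - 1)] (mod int p)"
    by (rule quadratic_order.two_power_cong[OF _ p_prime p_eq refl]) (unfold_locales, simp)
  then have "[(- 1) ^ h * 2 ^ h = (- 1) ^ h * (if h mod 4 = 0 \<or> h mod 4 = 3 then 1 else - 1)] (mod int p)"
    by (rule cong_scalar_left)
  moreover have "(- 2 :: int) ^ h = (- 1) ^ h * 2 ^ h" by (simp flip: power_mult_distrib)
  moreover have "(- 1 :: int) ^ h * (if h mod 4 = 0 \<or> h mod 4 = 3 then 1 else - 1)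
      = (if p mod 8 = 1 \<or> p mod 8 = 3 then 1 else - 1)"
  proof -
    have "h mod 4 = 0 \<or> h mod 4 = 1 \<or> h mod 4 = 2 \<or> h mod 4 = 3" by presburger
    moreover have "p mod 8 = 2 * (h mod 4) + 1" using p_eq by presburger
    moreover have "even h \<longleftrightarrow> even (h mod 4)" by presburger
    ultimately show ?thesis by (auto simp: minus_one_power_iff)
  qed
  ultimately show "[(- 2) ^ ((p - 1) div 2) = (if p mod 8 = 1 \<or> p mod 8 = 3 then 1 else - 1 :: int)] (mod int p)"
    by (simp add: h_def)
qed auto

end

section \<open>Inert primes and the field with p squared elements\<close>

text \<open>
  By Euler's criterion the assumption says that \<open>- D\<close> is a quadratic nonresidue, so the order modulo \<open>p\<close> is a
  field with \<open>p ^ 2\<close> elements.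
\<close>

locale inert_order = prime_gt_3 p + quadratic_order D for p D :: nat +
  assumes nonresidue: "[(- int D) ^ h = - 1] (mod int p)"
begin

lemma p_pos: "p > 0" using p_gt_3 by simp

lemma not_p_dvd_2: "\<not> int p dvd 2"
  using p_gt_3 by (auto dest: zdvd_imp_le)

lemma fermat_int: "\<not> int p dvd a \<Longrightarrow> [a ^ (2 * h) = 1] (mod int p)"
proof -
  assume a: "\<not> int p dvd a"
  define b where "b = nat (a mod int p)"
  have b: "int b = a mod int p" using p_pos by (simp add: b_def)
  have "\<not> int p dvd int b" using a unfolding b by (simp add: dvd_mod_iff)
  then have "\<not> p dvd b" by simp
  then have "[b ^ (p - 1) = 1] (mod p)" using fermat_theorem[OF p_prime] by blast
  then have "[int (b ^ (p - 1)) = int 1] (mod int p)" by (simp only: cong_int_iff)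
  moreover have "p - 1 = 2 * h" using p_eq by simp
  ultimately have "[(a mod int p) ^ (2 * h) = 1] (mod int p)" using b by simp
  moreover have "[a ^ (2 * h) = (a mod int p) ^ (2 * h)] (mod int p)"
    by (intro cong_pow) (simp add: cong_def)
  ultimately show ?thesis using cong_trans by blast
qed

lemma not_p_dvd_D: "\<not> int p dvd int D"
proof
  assume "int p dvd int D"
  then have "int p dvd (- int D) ^ h" using h_ge_2 by (intro dvd_power_le[of _ "- int D" 1 h, simplified]) auto
  then have "int p dvd - 1" using nonresidue cong_dvd_iff by blast
  then show False using p_gt_3 by simp
qed

text \<open>
  If \<open>a ^ 2 \<equiv> - D b ^ 2\<close> with \<open>b\<close> invertible, raising to the power \<open>h\<close> gives \<open>1 \<equiv> - 1\<close>.
\<close>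

lemma norm_not_dvd:
  assumes "\<not> (int p dvd a \<and> int p dvd b)" shows "\<not> int p dvd a * a + int D * (b * b)"
proof
  assume dvd: "int p dvd a * a + int D * (b * b)"
  have pr: "prime (int p)" using p_prime by simp
  show False
  proof (cases "int p dvd b")
    case True
    then have "int p dvd a * a" using dvd by (metis dvd_add_left_iff dvd_mult dvd_mult2)
    then show False using True assms pr by (auto simp: prime_dvd_mult_iff)
  next
    case False
    have a: "\<not> int p dvd a"
    proof
      assume "int p dvd a"
      then have "int p dvd int D * (b * b)" using dvd by (metis dvd_add_right_iff dvd_mult)
      then show False using False not_p_dvd_D pr by (auto simp: prime_dvd_mult_iff)
    qed
    have "[a * a = - int D * (b * b)] (mod int p)" using dvd by (simp add: cong_iff_dvd_diff)
    then have "[(a * a) ^ h = (- int D * (b * b)) ^ h] (mod int p)" by (rule cong_pow)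
    then have "[a ^ (2 * h) = (- int D) ^ h * b ^ (2 * h)] (mod int p)"
      by (simp only: power_mult_distrib power_mult power2_eq_square)
    moreover have "[(- int D) ^ h * b ^ (2 * h) = - 1 * 1] (mod int p)"
      by (intro cong_mult nonresidue fermat_int False)
    ultimately have "[1 = - 1] (mod int p)" using fermat_int[OF a] by (metis cong_sym cong_trans mult_1_right)
    then show False using not_p_dvd_2 by (simp add: cong_iff_dvd_diff)
  qed
qed

lemma cnj_norm:
  "(of_int a + of_int b * \<omega>) * cnj (of_int a + of_int b * \<omega>) = of_int (a * a + int D * (b * b))"
proof -
  have "(of_int a + of_int b * \<omega>) * cnj (of_int a + of_int b * \<omega>) = of_int a * of_int a - of_int b * of_int b * (\<omega> * \<omega>)"
    by (simp add: algebra_simps)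
  then show ?thesis unfolding omega_sq by simp
qed

lemma inverse_mod_p2:
  assumes "z \<in> \<O>" "\<not> qcong p z 0"
  shows "\<exists>v\<in>\<O>. qcong (p ^ 2) (z * v) 1"
proof -
  obtain a b where z: "z = of_int a + of_int b * \<omega>" using assms(1) by (elim OrderE)
  define N where "N = a * a + int D * (b * b)"
  have "\<not> int p dvd N" using assms(2) norm_not_dvd unfolding z qcong_0_iff N_def by blast
  then have "coprime (int p) N" using p_prime by (intro prime_imp_coprime) simp
  then have "coprime N (int (p ^ 2))" by (simp add: coprime_commute)
  then obtain N' where N': "[N * N' = 1] (mod (int (p ^ 2)))" using cong_solve_coprime_int by blast
  have "z * (cnj z * of_int N') = of_int (N * N')"
    using cnj_norm[of a b] unfolding N_def z by (simp flip: mult.assoc)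
  also have "qcong (p ^ 2) \<dots> (of_int 1)" using N' unfolding qcong_of_int_iff .
  finally show ?thesis using assms by (intro bexI[of _ "cnj z * of_int N'"]) auto
qed

lemma qcong_cancel:
  assumes "z \<in> \<O>" "\<not> qcong p z 0" "u \<in> \<O>" "v \<in> \<O>" "qcong (p ^ 2) (z * u) (z * v)"
  shows "qcong (p ^ 2) u v"
proof -
  obtain z' where z': "z' \<in> \<O>" "qcong (p ^ 2) (z * z') 1" using inverse_mod_p2 assms by blast
  have *: "qcong (p ^ 2) w (z' * (z * w))" if "w \<in> \<O>" for w
  proof -
    have "qcong (p ^ 2) (1 * w) ((z * z') * w)"
      using z' that assms(1) by (intro qcong_mult qcong_sym[OF z'(2)]) auto
    then show ?thesis by (simp add: ac_simps)
  qed
  have "qcong (p ^ 2) (z' * (z * u)) (z' * (z * v))"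
    by (rule qcong_mult[OF qcong_refl assms(5)]) (use assms z' in auto)
  from qcong_trans[OF *[OF assms(3)] qcong_trans[OF this qcong_sym[OF *[OF assms(4)]]]]
  show ?thesis .
qed

lemma frobenius:
  assumes "z \<in> \<O>" shows "qcong p (z ^ p) (cnj z)"
proof -
  obtain a b where z: "z = of_int a + of_int b * \<omega>" using assms by (elim OrderE)
  have fermat: "[c ^ p = c] (mod int p)" for c :: int
  proof (cases "int p dvd c")
    case True
    then have "int p dvd c ^ p" using p_pos by (metis dvd_power dvd_trans)
    then show ?thesis using True by (simp add: cong_iff_dvd_diff)
  next
    case False
    have "[c ^ (2 * h) * c = 1 * c] (mod int p)" by (intro cong_scalar_right fermat_int False)
    then show ?thesis by (subst p_eq) (simp add: mult.commute)
  qed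
  have w: "\<omega> ^ p = of_int ((- int D) ^ h) * \<omega>"
  proof -
    have "\<omega> ^ p = (\<omega> * \<omega>) ^ h * \<omega>"
      by (subst p_eq) (simp only: power_add power_mult power2_eq_square power_one_right)
    then show ?thesis unfolding omega_sq by simp
  qed
  have "qcong p (z ^ p) (of_int a ^ p + (of_int b * \<omega>) ^ p)"
    unfolding z by (intro qcong_power_prime_add p_prime) auto
  also have "of_int a ^ p + (of_int b * \<omega>) ^ p = of_int (a ^ p) + of_int (b ^ p * (- int D) ^ h) * \<omega>"
    by (simp add: power_mult_distrib w)
  also have "qcong p \<dots> (of_int a + of_int (b * - 1) * \<omega>)"
    by (intro qcong_add qcong_mult qcong_refl)
      (simp_all only: qcong_of_int_iff fermat cong_mult nonresidue Order_simps Order_of_int)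
  also have "of_int a + of_int (b * - 1) * \<omega> = cnj z" by (simp add: z)
  finally show ?thesis .
qed

text \<open>
  Representatives of the residue classes modulo \<open>p\<close>.  The residue field is built on them only to apply the
  theorem that finite multiplicative groups of fields are cyclic.
\<close>

definition residues_O :: "complex set" where
  "residues_O = (\<lambda>(a, b). of_int a + of_int b * \<omega>) ` ({0..<int p} \<times> {0..<int p})"

definition red :: "complex \<Rightarrow> complex" where
  "red z = (SOME w. w \<in> residues_O \<and> qcong p z w)"

lemma residues_O_subset: "residues_O \<subseteq> \<O>"
  unfolding residues_O_def by (auto intro: OrderI)

lemma residues_O_D: "z \<in> residues_O \<Longrightarrow> z \<in> \<O>"
  using residues_O_subset by blast

lemma red:
  assumes "z \<in> \<O>" shows "red z \<in> residues_O" "qcong p z (red z)"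
proof -
  obtain a b where z: "z = of_int a + of_int b * \<omega>" using assms by (elim OrderE)
  define w where "w = of_int (a mod int p) + of_int (b mod int p) * \<omega>"
  have "w \<in> residues_O" unfolding residues_O_def w_def using p_pos by auto
  moreover have "qcong p z w" unfolding z w_def
    by (intro qcong_add qcong_mult) (auto simp: qcong_of_int_iff cong_def)
  ultimately have "\<exists>w. w \<in> residues_O \<and> qcong p z w" by blast
  from someI_ex[OF this] show "red z \<in> residues_O" "qcong p z (red z)" unfolding red_def by auto
qed

lemma coordinates_unique:
  assumes "a \<in> {0..<int p}" "b \<in> {0..<int p}" "c \<in> {0..<int p}" "d \<in> {0..<int p}"
    "qcong p (of_int a + of_int b * \<omega>) (of_int c + of_int d * \<omega>)"
  shows "a = c \<and> b = d"
proof -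
  have "qcong p (of_int (a - c) + of_int (b - d) * \<omega>) 0"
    using assms(5) by (subst (asm) qcong_iff_diff) (simp add: algebra_simps)
  then have "[a = c] (mod int p)" "[b = d] (mod int p)"
    unfolding qcong_0_iff by (simp_all add: cong_iff_dvd_diff)
  then show ?thesis using assms by (auto simp: cong_def)
qed

lemma residues_O_unique: "u \<in> residues_O \<Longrightarrow> v \<in> residues_O \<Longrightarrow> qcong p u v \<Longrightarrow> u = v"
  unfolding residues_O_def using coordinates_unique by (clarsimp simp del: atLeastLessThan_iff) blast

lemma finite_residues_O: "finite residues_O" and card_residues_O: "card residues_O = p ^ 2"
proof -
  have "inj_on (\<lambda>(a, b). of_int a + of_int b * \<omega>) ({0..<int p} \<times> {0..<int p})"
  proof (rule inj_onI, clarify)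
    fix a b c d assume "a \<in> {0..<int p}" "b \<in> {0..<int p}" "c \<in> {0..<int p}" "d \<in> {0..<int p}"
      "of_int a + of_int b * \<omega> = of_int c + of_int d * \<omega>"
    then show "a = c \<and> b = d" using coordinates_unique[of a b c d] by simp
  qed
  then show "finite residues_O" "card residues_O = p ^ 2"
    unfolding residues_O_def by (simp_all add: card_image card_cartesian_product power2_eq_square)
qed

lemma zero_one_residues: "0 \<in> residues_O" "1 \<in> residues_O"
proof -
  have "(\<lambda>(a, b). of_int a + of_int b * \<omega>) (0, 0) \<in> residues_O" "(\<lambda>(a, b). of_int a + of_int b * \<omega>) (1, 0) \<in> residues_O"
    unfolding residues_O_def using p_gt_3 by (intro imageI; simp)+
  then show "0 \<in> residues_O" "1 \<in> residues_O" by simp_all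
qed

lemma red_eqI: "u \<in> \<O> \<Longrightarrow> v \<in> residues_O \<Longrightarrow> qcong p u v \<Longrightarrow> red u = v"
  using red[of u] residues_O_unique qcong_sym qcong_trans by metis

lemma red_cong: "u \<in> \<O> \<Longrightarrow> v \<in> \<O> \<Longrightarrow> qcong p u v \<Longrightarrow> red u = red v"
  using red[of v] red_eqI qcong_trans by metis

definition F_p2 :: "complex ring" where
  "F_p2 = \<lparr>carrier = residues_O, monoid.mult = (\<lambda>u v. red (u * v)), one = 1,
     ring.zero = 0, add = (\<lambda>u v. red (u + v))\<rparr>"

lemma red_mult_red:
  assumes "u \<in> \<O>" "v \<in> \<O>"
  shows "red (red u * v) = red (u * v)" "red (u * red v) = red (u * v)"
    "red (red u + v) = red (u + v)" "red (u + red v) = red (u + v)"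
  using assms red[of u] red[of v] residues_O_D
  by (auto intro!: red_cong qcong_mult qcong_add intro: qcong_sym)

lemma cring_F_p2: "cring F_p2"
proof (rule cringI)
  note [simp] = residues_O_D red zero_one_residues red_mult_red
  have id: "red u = u" if "u \<in> residues_O" for u using that by (intro red_eqI) auto
  show "abelian_group F_p2"
  proof (rule abelian_groupI)
    fix x assume x: "x \<in> carrier F_p2"
    then have "red (red (- x) + x) = red 0" by (simp add: F_p2_def)
    then show "\<exists>y\<in>carrier F_p2. y \<oplus>\<^bsub>F_p2\<^esub> x = \<zero>\<^bsub>F_p2\<^esub>"
      using x by (intro bexI[of _ "red (- x)"]) (auto simp: F_p2_def id)
  qed (auto simp: F_p2_def id ac_simps)
  show "comm_monoid F_p2"
    by (rule comm_monoidI) (auto simp: F_p2_def id ac_simps)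
qed (auto simp: F_p2_def residues_O_D red red_mult_red distrib_right)

lemma field_F_p2: "field F_p2"
proof (rule cring.cring_fieldI2[OF cring_F_p2])
  show "\<zero>\<^bsub>F_p2\<^esub> \<noteq> \<one>\<^bsub>F_p2\<^esub>" by (simp add: F_p2_def)
  fix a assume a: "a \<in> carrier F_p2" "a \<noteq> \<zero>\<^bsub>F_p2\<^esub>"
  then have a': "a \<in> \<O>" "\<not> qcong p a 0"
    using residues_O_D residues_O_unique zero_one_residues by (auto simp: F_p2_def)
  then obtain v where v: "v \<in> \<O>" "qcong (p ^ 2) (a * v) 1" using inverse_mod_p2 by blast
  then have "qcong p (a * v) 1" using qcong_dvd[of "p ^ 2"] by simp
  then have "red (a * red v) = 1"
    using a' v zero_one_residues by (simp add: red_mult_red red_eqI)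
  then show "\<exists>b\<in>carrier F_p2. a \<otimes>\<^bsub>F_p2\<^esub> b = \<one>\<^bsub>F_p2\<^esub>"
    using red[of v] v by (intro bexI[of _ "red v"]) (auto simp: F_p2_def)
qed

lemma primitive_root_mod_p:
  obtains g where "g \<in> \<O>" "\<not> qcong p g 0"
    "\<And>z. z \<in> \<O> \<Longrightarrow> \<not> qcong p z 0 \<Longrightarrow> \<exists>i::nat. qcong p z (g ^ i)"
proof -
  interpret field F_p2 by (rule field_F_p2)
  have "finite (carrier F_p2)" by (simp add: F_p2_def finite_residues_O)
  from finite_field_mult_group_has_gen[OF this] obtain g where
    g: "g \<in> carrier F_p2 - {\<zero>\<^bsub>F_p2\<^esub>}"
       "carrier (mult_of F_p2) = {g [^]\<^bsub>F_p2\<^esub> i | i::nat. i \<in> UNIV}" by auto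
  have gO: "g \<in> \<O>" using g(1) residues_O_D by (simp add: F_p2_def)
  have pow: "g [^]\<^bsub>F_p2\<^esub> i = red (g ^ i)" for i :: nat
  proof (induction i)
    case 0
    then show ?case using zero_one_residues by (simp add: F_p2_def nat_pow_def red_eqI[of 1 1])
  next
    case (Suc i)
    then show ?case using gO by (simp add: red_mult_red) (simp add: F_p2_def red_mult_red gO mult.commute)
  qed
  show thesis
  proof (rule that[OF gO])
    show "\<not> qcong p g 0" using g(1) residues_O_unique[of g 0] zero_one_residues by (auto simp: F_p2_def)
    fix z assume z: "z \<in> \<O>" "\<not> qcong p z 0"
    have "red z \<in> carrier (mult_of F_p2)"
      using z red[of z] by (auto simp: F_p2_def)
    then obtain i :: nat where "red z = red (g ^ i)" unfolding g(2) pow by auto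
    then have "qcong p z (g ^ i)" using red[OF z(1)] red[of "g ^ i"] gO by (metis Order_power qcong_sym qcong_trans)
    then show "\<exists>i. qcong p z (g ^ i)" by blast
  qed
qed

text \<open>
  Frobenius is complex conjugation, so applying it twice gives the identity.
\<close>

lemma pow_p2_minus_1:
  assumes "z \<in> \<O>" "\<not> qcong p z 0" shows "qcong p (z ^ (p ^ 2 - 1)) 1"
proof -
  obtain v where v: "v \<in> \<O>" "qcong (p ^ 2) (z * v) 1" using inverse_mod_p2 assms by blast
  have v': "qcong p (z * v) 1" using qcong_dvd[OF v(2), of p] by simp
  have "qcong p ((z ^ p) ^ p) (cnj z ^ p)" using assms by (intro qcong_power frobenius) auto
  also have "qcong p (cnj z ^ p) z" using frobenius[of "cnj z"] assms by simp
  finally have "qcong p (z ^ (p ^ 2)) z" by (simp add: power2_eq_square power_mult)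
  moreover have "z ^ (p ^ 2) = z ^ (p ^ 2 - 1) * z"
    using p_pos by (simp flip: power_Suc2)
  ultimately have "qcong p (z ^ (p ^ 2 - 1) * z * v) (z * v)"
    using assms v by (intro qcong_mult) auto
  moreover have "qcong p (z ^ (p ^ 2 - 1) * (z * v)) (z ^ (p ^ 2 - 1) * 1)"
    using assms v v' by (intro qcong_mult) auto
  ultimately show ?thesis using v' by (simp add: mult.assoc) (meson qcong_sym qcong_trans)
qed

text \<open>
  If \<open>g\<close> generates the residue field, then \<open>g ^ p\<close> has the same order modulo \<open>p ^ 2\<close> as modulo \<open>p\<close>: passing to
  \<open>p\<close>-th powers lifts congruences from \<open>p\<close> to \<open>p ^ 2\<close>.  The same lifting turns Frobenius into the exact
  congruence with complex conjugation.
\<close>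

lemma teichmueller_generator:
  obtains g where "g \<in> \<O>" "qcong (p ^ 2) (g ^ (p ^ 2 - 1)) 1"
    "\<forall>j. qcong p (g ^ j) 1 \<longrightarrow> p ^ 2 - 1 dvd j" "qcong (p ^ 2) (g ^ p) (cnj g)"
proof -
  obtain g where g: "g \<in> \<O>" "\<not> qcong p g 0"
    "\<And>z. z \<in> \<O> \<Longrightarrow> \<not> qcong p z 0 \<Longrightarrow> \<exists>i::nat. qcong p z (g ^ i)"
    using primitive_root_mod_p by blast
  define N where "N = p ^ 2 - 1"
  have N: "N > 0" unfolding N_def using power_strict_mono[of 1 p 2] p_gt_3 by simp
  have gN: "qcong p (g ^ N) 1" unfolding N_def using g by (intro pow_p2_minus_1)
  have periodic: "qcong p (g ^ i) (g ^ (i mod j))" if "qcong p (g ^ j) 1" for i j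
  proof -
    have "g ^ i = (g ^ j) ^ (i div j) * g ^ (i mod j)" by (simp flip: power_mult power_add)
    also have "qcong p \<dots> (1 ^ (i div j) * g ^ (i mod j))"
      using g that by (intro qcong_mult qcong_power) auto
    finally show ?thesis by simp
  qed
  \<comment> \<open>If \<open>g ^ j \<equiv> 1\<close>, the first \<open>j\<close> powers of \<open>g\<close> already exhaust the \<open>p ^ 2 - 1\<close> nonzero classes.\<close>
  have order: "N \<le> j" if j: "qcong p (g ^ j) 1" "j > 0" for j
  proof -
    have "residues_O - {0} \<subseteq> (\<lambda>i. red (g ^ i)) ` {..<j}"
    proof
      fix z assume z: "z \<in> residues_O - {0}"
      then have "z \<in> \<O>" "\<not> qcong p z 0"
        using residues_O_D residues_O_unique[of z 0] zero_one_residues by auto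
      then obtain i where "qcong p z (g ^ i)" using g(3) by blast
      also note periodic[OF j(1), of i]
      finally have "red (g ^ (i mod j)) = z" using z g by (intro red_eqI) (auto intro: qcong_sym)
      then show "z \<in> (\<lambda>i. red (g ^ i)) ` {..<j}" using j(2) by force
    qed
    then have "card (residues_O - {0}) \<le> card {..<j}"
      by (intro surj_card_le) auto
    moreover have "card (residues_O - {0}) = p ^ 2 - 1"
      using finite_residues_O card_residues_O zero_one_residues by simp
    ultimately show ?thesis by (simp add: N_def)
  qed
  have dvd: "N dvd j" if "qcong p (g ^ j) 1" for j
  proof -
    have "qcong p (g ^ (j mod N)) 1" using periodic[OF gN, of j] that qcong_sym qcong_trans by blast
    moreover have "j mod N < N" using N by simp
    ultimately have "j mod N = 0" using order[of "j mod N"] by auto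
    then show ?thesis by blast
  qed
  have "coprime N p"
  proof -
    have "coprime (p ^ 2 - 1) (p ^ 2)" using p_pos by (intro coprime_diff_one_left_nat) simp
    then show ?thesis by (simp add: N_def)
  qed
  \<comment> \<open>The \<open>p\<close>-th power of a generator modulo \<open>p\<close> is the required generator modulo \<open>p ^ 2\<close>.\<close>
  show thesis
  proof (rule that[of "g ^ p"])
    show "g ^ p \<in> \<O>" using g by simp
    have "(g ^ p) ^ (p ^ 2 - 1) = (g ^ N) ^ p" by (simp add: N_def mult.commute flip: power_mult)
    then show "qcong (p ^ 2) ((g ^ p) ^ (p ^ 2 - 1)) 1"
      using qcong_power_lift[OF gN] g p_pos by simp
    show "\<forall>j. qcong p ((g ^ p) ^ j) 1 \<longrightarrow> p ^ 2 - 1 dvd j"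
    proof (intro allI impI)
      fix j assume "qcong p ((g ^ p) ^ j) 1"
      then have "N dvd p * j" by (intro dvd) (simp add: power_mult)
      then show "p ^ 2 - 1 dvd j" using \<open>coprime N p\<close> by (simp add: N_def coprime_dvd_mult_right_iff)
    qed
    show "qcong (p ^ 2) ((g ^ p) ^ p) (cnj (g ^ p))"
      using qcong_power_lift[OF frobenius[OF g(1)]] g p_pos by simp
  qed
qed

end

section \<open>The Legendre symbol of traces\<close>

context prime_gt_3
begin

text \<open>
  For \<open>s\<close> prime to \<open>p\<close> the Legendre symbol is \<open>s ^ (p h)\<close> modulo \<open>p ^ 2\<close>.  The powers \<open>s ^ (h + (p - 1) j)\<close> are
  affine in \<open>j\<close> modulo \<open>p ^ 2\<close>, and \<open>p h\<close> is reached at \<open>j = h\<close> from the nodes \<open>j = 0\<close> and \<open>j = 1\<close>.  This keeps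
  the exponents small.
\<close>

lemma Legendre_interpolate:
  "[Legendre s (int p) = (1 - int h) * s ^ h + int h * s ^ (3 * h)] (mod (int p) ^ 2)"
proof -
  define f where "f = Legendre s (int p)"
  have "[f = s ^ h] (mod int p)"
    using euler_criterion[of p s] p_prime p_gt_3 by (simp add: h_def f_def)
  then obtain r where r: "s ^ h = f + int p * r"
    by (metis cong_iff_lin cong_sym)
  have f3: "f ^ 3 = f" using Legendre_values[of s "int p"] by (auto simp: f_def)
  have P: "int p = 2 * int h + 1" using p_eq by simp
  have "s ^ (3 * h) = (f + int p * r) ^ 3" using r by (simp add: mult.commute power_mult)
  also have "\<dots> = f + 3 * f ^ 2 * int p * r + (int p) ^ 2 * (3 * f * r ^ 2 + int p * r ^ 3)"
    using f3 by (simp add: power3_eq_cube power2_eq_square algebra_simps)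
  finally have s3: "s ^ (3 * h) = f + 3 * f ^ 2 * int p * r + (int p) ^ 2 * (3 * f * r ^ 2 + int p * r ^ 3)" .
  show ?thesis
  proof (cases "f = 0")
    case True
    have "int p dvd s ^ h" unfolding r using True by simp
    then have "int p dvd s" using p_prime prime_dvd_power[of "int p" s h] by simp
    then have "(int p) ^ 2 dvd s ^ 2" by (rule dvd_power_same)
    moreover have "s ^ 2 dvd s ^ h" using h_ge_2 by (rule le_imp_power_dvd)
    ultimately have *: "(int p) ^ 2 dvd s ^ h" by (rule dvd_trans)
    moreover have "s ^ h dvd s ^ (3 * h)" by (rule le_imp_power_dvd) simp
    ultimately have "(int p) ^ 2 dvd s ^ (3 * h)" by (rule dvd_trans)
    with * have "(int p) ^ 2 dvd (1 - int h) * s ^ h + int h * s ^ (3 * h)" by (intro dvd_add dvd_mult)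
    then have "[(1 - int h) * s ^ h + int h * s ^ (3 * h) = f] (mod (int p) ^ 2)"
      using True by (simp add: cong_iff_dvd_diff)
    then show ?thesis unfolding f_def by (rule cong_sym)
  next
    case False
    then have f2: "f ^ 2 = 1" using Legendre_values[of s "int p"] by (auto simp: f_def)
    have "(1 - int h) * s ^ h + int h * s ^ (3 * h) - f
        = (int p) ^ 2 * (r + int h * (3 * f * r ^ 2 + int p * r ^ 3))"
      unfolding s3 r f2 unfolding P by (simp add: power2_eq_square algebra_simps)
    then show ?thesis unfolding f_def[symmetric] by (metis cong_iff_dvd_diff cong_sym dvd_triv_left)
  qed
qed

end

text \<open>
  Coordinates with respect to \<open>1\<close>, \<open>\<rho>\<close> of the Lucas sequence \<open>v_0 = 2\<close>, \<open>v_1 = \<rho>\<close>,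
  \<open>v_(n + 2) = \<rho> v_(n + 1) + v_n\<close>, where \<open>\<rho> ^ 2 = - k\<close>.
\<close>

fun lucas :: "int \<Rightarrow> nat \<Rightarrow> int \<times> int" where
  "lucas k 0 = (2, 0)"
| "lucas k (Suc 0) = (0, 1)"
| "lucas k (Suc (Suc n)) = (fst (lucas k n) - k * snd (lucas k (Suc n)), snd (lucas k n) + fst (lucas k (Suc n)))"

lemma lucas_parity: "odd n \<Longrightarrow> fst (lucas k n) = 0" "even n \<Longrightarrow> snd (lucas k n) = 0"
proof -
  have "(odd n \<longrightarrow> fst (lucas k n) = 0) \<and> (even n \<longrightarrow> snd (lucas k n) = 0)"
    by (induction k n rule: lucas.induct) auto
  then show "odd n \<Longrightarrow> fst (lucas k n) = 0" "even n \<Longrightarrow> snd (lucas k n) = 0" by auto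
qed

lemma lucas_2_shift: "lucas 2 (n + 4) = (- fst (lucas 2 n), - snd (lucas 2 n))"
  by (simp add: numeral_eq_Suc)

lemma lucas_1_shift: "lucas 1 (n + 6) = (- fst (lucas 1 n), - snd (lucas 1 n))"
  by (simp add: numeral_eq_Suc)

lemma lucas_2_bound: "\<bar>fst (lucas 2 n)\<bar> \<le> 2 \<and> \<bar>snd (lucas 2 n)\<bar> \<le> 2"
proof (induction n rule: less_induct)
  case (less n)
  show ?case
  proof (cases "n < 4")
    case True
    then have "n = 0 \<or> n = 1 \<or> n = 2 \<or> n = 3" by auto
    then show ?thesis by (auto simp: numeral_eq_Suc)
  next
    case False
    then show ?thesis using less[of "n - 4"] lucas_2_shift[of "n - 4"] by simp
  qed
qed

text \<open>
  For \<open>k = 1\<close> the sequence has period \<open>12\<close> and changes sign after half a period.  The parity of the first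
  coordinate is needed to decide which of \<open>X\<close>, \<open>Y\<close> is even in \<open>X ^ 2 + Y ^ 2 = p\<close>.
\<close>

lemma lucas_1_bound: "\<bar>fst (lucas 1 n)\<bar> \<le> 2 \<and> \<bar>snd (lucas 1 n)\<bar> \<le> 2
    \<and> (odd (fst (lucas 1 n)) \<longleftrightarrow> even n \<and> \<not> 3 dvd n)"
proof (induction n rule: less_induct)
  case (less n)
  show ?case
  proof (cases "n < 6")
    case True
    then have "n = 0 \<or> n = 1 \<or> n = 2 \<or> n = 3 \<or> n = 4 \<or> n = 5" by auto
    moreover have "lucas 1 1 = (0, 1)" "lucas 1 2 = (1, 0)" "lucas 1 3 = (0, 2)" "lucas 1 4 = (- 1, 0)" "lucas 1 5 = (0, 1)"
      by (simp_all add: numeral_eq_Suc)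
    ultimately show ?thesis by auto
  next
    case False
    then obtain j where n: "n = j + 6" by (metis le_add_diff_inverse2 not_less)
    have "even n \<longleftrightarrow> even j" "3 dvd n \<longleftrightarrow> 3 dvd j" unfolding n by presburger+
    then show ?thesis using less[of j] lucas_1_shift[of j] n by simp
  qed
qed

text \<open>
  The bound \<open>2\<close> per term is halved because each coordinate vanishes at every other index.
\<close>

lemma sum_lucas_bound:
  assumes "\<And>n. \<bar>fst (lucas k n)\<bar> \<le> 2" "\<And>n. \<bar>snd (lucas k n)\<bar> \<le> 2"
  shows "(\<Sum>e=1..n. \<bar>fst (lucas k e)\<bar>) \<le> int n" "(\<Sum>e=1..n. \<bar>snd (lucas k e)\<bar>) \<le> int n + 1"
proof -
  have "(\<Sum>e=1..n. \<bar>fst (lucas k e)\<bar>) \<le> 2 * int (n div 2)"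
  proof (induction n)
    case (Suc n)
    show ?case
    proof (cases "even n")
      case True
      then show ?thesis using Suc lucas_parity(1)[of "Suc n" k] by simp
    next
      case False
      then have "int (Suc n div 2) = int (n div 2) + 1" by simp
      then show ?thesis using Suc assms(1)[of "Suc n"] by simp
    qed
  qed simp
  then show "(\<Sum>e=1..n. \<bar>fst (lucas k e)\<bar>) \<le> int n" by linarith
  have "(\<Sum>e=1..n. \<bar>snd (lucas k e)\<bar>) \<le> 2 * int ((n + 1) div 2)"
  proof (induction n)
    case (Suc n)
    show ?case
    proof (cases "even n")
      case False
      then show ?thesis using Suc lucas_parity(2)[of "Suc n" k] by simp
    next
      case True
      then have "int ((Suc n + 1) div 2) = int ((n + 1) div 2) + 1" by simp
      then show ?thesis using Suc assms(2)[of "Suc n"] by simp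
    qed
  qed simp
  then show "(\<Sum>e=1..n. \<bar>snd (lucas k e)\<bar>) \<le> int n + 1" by linarith
qed

lemma (in quadratic_order) qcong_cnj: "qcong n u v \<Longrightarrow> qcong n (cnj u) (cnj v)"
proof -
  assume "qcong n u v"
  then obtain w where w: "w \<in> \<O>" "u - v = of_nat n * w" by (auto simp: qcong_def)
  have "cnj u - cnj v = of_nat n * cnj w"
    using arg_cong[OF w(2), of cnj] by simp
  then show ?thesis using w by (intro qcongI[of "cnj w"]) auto
qed

text \<open>
  \<open>g\<close> generates the Teichmueller group modulo \<open>p ^ 2\<close>, and conjugation acts on it as Frobenius.
\<close>

locale eisenstein_sum = inert_order p D + eisenstein_prime p M m for p D M m :: nat +
  fixes g :: complex
  assumes gO: "g \<in> \<O>"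
    and g_order: "qcong (p ^ 2) (g ^ (p ^ 2 - 1)) 1"
    and g_order_dvd: "\<And>j. qcong p (g ^ j) 1 \<Longrightarrow> p ^ 2 - 1 dvd j"
    and g_frobenius: "qcong (p ^ 2) (g ^ p) (cnj g)"
begin

lemma order_eq: "p ^ 2 - 1 = 2 * h * (p + 1)"
proof -
  have "p ^ 2 = (2 * h + 1) ^ 2" using p_eq by simp
  also have "\<dots> = 2 * h * (2 * h + 2) + 1" by (simp add: power2_eq_square)
  also have "2 * h + 2 = p + 1" using p_eq by simp
  finally show ?thesis by simp
qed

lemma gpow_O [simp]: "g \<in> \<O>" "g ^ n \<in> \<O>" using gO by simp_all

lemma p2_dvd: "qcong (p ^ 2) u v \<Longrightarrow> qcong p u v"
  by (erule qcong_dvd) simp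

lemma gpow_period: "qcong (p ^ 2) (g ^ (i + 2 * h * (p + 1) * k)) (g ^ i)"
proof -
  have "qcong (p ^ 2) (g ^ i * (g ^ (p ^ 2 - 1)) ^ k) (g ^ i * 1 ^ k)"
    using g_order by (intro qcong_mult qcong_power qcong_refl) auto
  moreover have "g ^ (i + 2 * h * (p + 1) * k) = g ^ i * (g ^ (2 * h * (p + 1))) ^ k"
    by (simp only: power_add power_mult)
  ultimately show ?thesis unfolding order_eq by simp
qed

lemma gpow_half: "qcong (p ^ 2) (g ^ (h * (p + 1))) (- 1)"
proof -
  define y where "y = g ^ (h * (p + 1))"
  have yO: "y \<in> \<O>" by (simp add: y_def)
  have "y * y = g ^ (p ^ 2 - 1)" unfolding y_def order_eq by (simp flip: power_add mult_2 add: mult.assoc)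
  then have "qcong (p ^ 2) (y * y) 1" using g_order by simp
  then have "qcong (p ^ 2) (y * y - 1) (1 - 1)" by (rule qcong_diff) simp
  then have "qcong (p ^ 2) ((y - 1) * (y + 1)) ((y - 1) * 0)" by (simp add: algebra_simps)
  moreover have "\<not> qcong p (y - 1) 0"
  proof
    assume "qcong p (y - 1) 0"
    then have "qcong p y 1" using qcong_iff_diff[of p y 1] by blast
    then have "p ^ 2 - 1 dvd h * (p + 1)" unfolding y_def by (rule g_order_dvd)
    then show False using h_ge_2 unfolding order_eq by (auto dest: dvd_imp_le)
  qed
  ultimately have "qcong (p ^ 2) (y + 1) 0" using yO qcong_cancel[of "y - 1" "y + 1" 0] by simp
  then show ?thesis unfolding y_def using qcong_iff_diff[of "p ^ 2" _ "- 1"] by simp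
qed

text \<open>
  The floor only converts the value to an integer: twice the real part of an element of the order is one.
\<close>

definition trace :: "nat \<Rightarrow> int" where "trace e = \<lfloor>2 * Re (g ^ e)\<rfloor>"

lemma of_int_trace: "of_int (trace e) = g ^ e + cnj (g ^ e)"
proof -
  obtain a b where ab: "g ^ e = of_int a + of_int b * \<omega>" using gpow_O(2)[of e] by (elim OrderE)
  have "Re (g ^ e) = real_of_int a" unfolding ab by simp
  then have "trace e = 2 * a" unfolding trace_def by (metis floor_of_int of_int_mult of_int_numeral)
  then show ?thesis unfolding ab by simp
qed

lemma gpow_frobenius: "qcong (p ^ 2) (g ^ (p * e)) (cnj (g ^ e))"
proof -
  have "qcong (p ^ 2) ((g ^ p) ^ e) (cnj g ^ e)" using g_frobenius gO by (intro qcong_power) auto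
  then show ?thesis by (simp add: power_mult)
qed

lemma trace_cong: "qcong (p ^ 2) (of_int (trace e)) (g ^ (p * e) + g ^ e)"
  unfolding of_int_trace add.commute[of "g ^ e"]
  by (intro qcong_add qcong_refl qcong_sym[OF gpow_frobenius])

definition trace_symbol :: "nat \<Rightarrow> int" where "trace_symbol e = Legendre (trace e) (int p)"

lemma trace_symbol_values: "trace_symbol e \<in> {- 1, 0, 1}" unfolding trace_symbol_def by (rule Legendre_values)

lemma trace_symbol_cong: "[trace_symbol e = trace e ^ h] (mod int p)"
  using euler_criterion[of p "trace e"] p_prime p_gt_3 by (simp add: trace_symbol_def h_def)

text \<open>
  \<open>g ^ (p + 1)\<close> is the norm of \<open>g\<close>, a primitive root and hence a nonresidue modulo \<open>p\<close>.
\<close>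

lemma trace_symbol_shift: "trace_symbol (e + (p + 1)) = - trace_symbol e"
proof -
  obtain a b where ab: "g = of_int a + of_int b * \<omega>" using gO by (elim OrderE)
  define n where "n = a * a + int D * (b * b)"
  have "qcong (p ^ 2) (g ^ p * g) (cnj g * g)" using g_frobenius gO by (intro qcong_mult) auto
  then have n: "qcong (p ^ 2) (g ^ (p + 1)) (of_int n)"
    using cnj_norm[of a b] unfolding ab[symmetric] n_def by (simp add: mult.commute)
  have "qcong (p ^ 2) (g ^ (h * (p + 1))) (of_int (n ^ h))"
  proof -
    have "qcong (p ^ 2) ((g ^ (p + 1)) ^ h) (of_int n ^ h)" by (rule qcong_power[OF n]) auto
    moreover have "(g ^ (p + 1)) ^ h = g ^ (h * (p + 1))" by (simp only: power_mult[symmetric] mult.commute)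
    ultimately show ?thesis by (simp only: of_int_power)
  qed
  then have "qcong p (of_int (n ^ h)) (of_int (- 1))"
    using p2_dvd[OF qcong_trans[OF qcong_sym gpow_half]] by simp
  then have nh: "[n ^ h = - 1] (mod int p)" unfolding qcong_of_int_iff .
  have 1: "qcong (p ^ 2) (g ^ (e + (p + 1))) (g ^ e * of_int n)"
    unfolding power_add[of g e] by (intro qcong_mult n) auto
  have "qcong (p ^ 2) (of_int (trace (e + (p + 1)))) (g ^ e * of_int n + cnj (g ^ e * of_int n))"
    unfolding of_int_trace by (intro qcong_add qcong_cnj 1)
  also have "g ^ e * of_int n + cnj (g ^ e * of_int n) = of_int (trace e * n)"
    by (simp add: of_int_trace algebra_simps)
  finally have "[trace (e + (p + 1)) = trace e * n] (mod int p)"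
    using p2_dvd qcong_of_int_iff by blast
  then have "[trace (e + (p + 1)) ^ h = (trace e * n) ^ h] (mod int p)" by (rule cong_pow)
  also have "(trace e * n) ^ h = trace e ^ h * n ^ h" by (rule power_mult_distrib)
  also have "[trace e ^ h * n ^ h = trace_symbol e * (- 1)] (mod int p)"
    by (intro cong_mult nh cong_sym[OF trace_symbol_cong])
  finally have "[trace_symbol (e + (p + 1)) = - trace_symbol e] (mod int p)" using trace_symbol_cong cong_trans by fastforce
  then show ?thesis by (rule sign_cong_imp_eq) (use trace_symbol_values[of e] trace_symbol_values[of "e + (p + 1)"] in auto)
qed

lemma trace_symbol_shift_mult: "trace_symbol (e + (p + 1) * k) = (- 1) ^ k * trace_symbol e"
proof (induction k)
  case (Suc k)
  have "trace_symbol (e + (p + 1) * Suc k) = trace_symbol (e + (p + 1) * k + (p + 1))" by (simp add: algebra_simps)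
  then show ?case unfolding trace_symbol_shift Suc by simp
qed simp

lemma trace_symbol_frobenius: "trace_symbol (p * e) = trace_symbol e"
proof -
  have 1: "qcong (p ^ 2) (of_int (trace (p * e))) (of_int (trace e))"
  proof -
    have "qcong (p ^ 2) (g ^ (p * e) + cnj (g ^ (p * e))) (cnj (g ^ e) + cnj (cnj (g ^ e)))"
      by (intro qcong_add qcong_cnj gpow_frobenius)
    then show ?thesis unfolding of_int_trace by (simp add: add.commute)
  qed
  then have "[trace (p * e) = trace e] (mod int p)" using p2_dvd qcong_of_int_iff by blast
  then have "[trace (p * e) ^ h = trace e ^ h] (mod int p)" by (rule cong_pow)
  then have "[trace_symbol (p * e) = trace_symbol e] (mod int p)" using trace_symbol_cong cong_sym cong_trans by meson
  then show ?thesis by (rule sign_cong_imp_eq) (use trace_symbol_values in auto)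
qed

text \<open>
  \<open>p e = (p + 1) (e - 1) + (p + 1 - e)\<close>, combined with the invariance of the trace under Frobenius.
\<close>

lemma trace_symbol_reflect:
  assumes "1 \<le> e" "e \<le> p" shows "trace_symbol (p + 1 - e) = (- 1) ^ Suc e * trace_symbol e"
proof -
  obtain k where e: "e = Suc k" using assms by (cases e) auto
  have "p * e = (p + 1 - e) + (p + 1) * k" using assms unfolding e by (simp add: algebra_simps)
  then have "trace_symbol e = (- 1) ^ k * trace_symbol (p + 1 - e)" using trace_symbol_shift_mult trace_symbol_frobenius by metis
  then have "(- 1) ^ k * trace_symbol e = trace_symbol (p + 1 - e)" by (simp flip: power_add mult.assoc add: mult_2[symmetric])
  then show ?thesis unfolding e by simp
qed

text \<open>
  \<open>g ^ (h + 1)\<close> represents the only line of elements of trace zero.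
\<close>

lemma trace_symbol_half: "trace_symbol (h + 1) = 0"
proof -
  have eq: "p * (h + 1) = (h + 1) + h * (p + 1)"
    using p_eq by (simp add: algebra_simps)
  have "g ^ (p * (h + 1)) = g ^ (h + 1) * g ^ (h * (p + 1))"
    unfolding eq by (rule power_add)
  then have "g ^ (p * (h + 1)) + g ^ (h + 1) = g ^ (h + 1) * (g ^ (h * (p + 1)) + 1)"
    by (simp only: distrib_left mult_1_right)
  also have "qcong (p ^ 2) \<dots> (g ^ (h + 1) * (- 1 + 1))"
    by (intro qcong_mult qcong_add gpow_half) auto
  finally have "qcong (p ^ 2) (g ^ (p * (h + 1)) + g ^ (h + 1)) (of_int 0)" by simp
  then have "qcong p (of_int (trace (h + 1))) (of_int 0)" using trace_cong qcong_trans p2_dvd by blast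
  then have "[trace (h + 1) = 0] (mod int p)" unfolding qcong_of_int_iff .
  then show ?thesis by (simp add: trace_symbol_def Legendre_def)
qed

text \<open>
  Trace zero means \<open>g ^ ((p - 1) e) \<equiv> - 1\<close>, which forces \<open>h + 1\<close> to divide \<open>e\<close>, and at \<open>e = 0\<close> the trace is \<open>2\<close>.
\<close>

lemma trace_symbol_nonzero:
  assumes "e \<le> h" shows "odd (trace_symbol e)"
proof -
  have "\<not> int p dvd trace e"
  proof
    assume "int p dvd trace e"
    then have "qcong p (of_int (trace e)) (of_int 0)" unfolding qcong_of_int_iff by (simp add: cong_0_iff)
    then have "qcong p (g ^ (p * e) + g ^ e) 0" using qcong_trans[OF qcong_sym[OF p2_dvd[OF trace_cong[of e]]], of 0] by simp
    moreover have "p * e = e + 2 * h * e"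
    proof -
      have "p * e = (2 * h + 1) * e" using p_eq by simp
      then show ?thesis by simp
    qed
    then have "g ^ (p * e) = g ^ e * g ^ (2 * h * e)" by (simp only: power_add)
    then have "g ^ (p * e) + g ^ e = g ^ e * (g ^ (2 * h * e) + 1)" by (simp only: distrib_left mult_1_right)
    ultimately have 1: "qcong p (g ^ e * (g ^ (2 * h * e) + 1)) 0" by (simp only:)
    have e: "p ^ 2 - 1 = (p ^ 2 - 1 - e) + e"
    proof -
      have "e \<le> 2 * h * (p + 1)" using assms by (simp add: trans_le_add1)
      then show ?thesis unfolding order_eq by simp
    qed
    have "g ^ (p ^ 2 - 1) * (g ^ (2 * h * e) + 1) = g ^ (p ^ 2 - 1 - e) * (g ^ e * (g ^ (2 * h * e) + 1))"
      by (subst e, subst power_add) (simp only: mult.assoc)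
    also have "qcong p \<dots> (g ^ (p ^ 2 - 1 - e) * 0)"
      by (rule qcong_mult[OF qcong_refl 1]) auto
    finally have 2: "qcong p (g ^ (p ^ 2 - 1) * (g ^ (2 * h * e) + 1)) 0" by simp
    have "qcong p (g ^ (p ^ 2 - 1) * (g ^ (2 * h * e) + 1)) (1 * (g ^ (2 * h * e) + 1))"
      by (rule qcong_mult[OF p2_dvd[OF g_order] qcong_refl]) auto
    from qcong_trans[OF qcong_sym[OF this] 2] have x: "qcong p (g ^ (2 * h * e) + 1) 0" by simp
    then have "qcong p (g ^ (2 * h * e)) (- 1)" using qcong_iff_diff[of p _ "- 1"] by simp
    then have "qcong p ((g ^ (2 * h * e)) ^ 2) ((- 1) ^ 2)" by (intro qcong_power) auto
    then have "qcong p (g ^ (2 * h * e * 2)) 1" by (simp only: power_mult power2_minus power_one)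
    then have "2 * h * (p + 1) dvd 2 * h * e * 2" unfolding order_eq[symmetric] by (rule g_order_dvd)
    then have "2 * h * (p + 1) dvd 2 * h * (e * 2)" by (simp only: mult.assoc)
    moreover have "0 < 2 * h" using h_ge_2 by simp
    ultimately have dvd: "p + 1 dvd e * 2" using nat_mult_dvd_cancel1 by blast
    have "e * 2 < p + 1" using assms p_eq by simp
    then have "e = 0" using dvd by (cases "e = 0") (auto dest: dvd_imp_le)
    then have "qcong p (of_int 2) (of_int 0)" using x by simp
    then show False unfolding qcong_of_int_iff using not_p_dvd_2 by (simp add: cong_0_iff)
  qed
  then have "trace_symbol e \<noteq> 0" by (simp add: trace_symbol_def Legendre_def cong_0_iff)
  then show ?thesis using trace_symbol_values[of e] by auto
qed

end

section \<open>Evaluation of Eisenstein sums\<close>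

lemma dvd_less_double:
  assumes "n dvd x" "0 < x" "x < 2 * n" shows "x = (n::nat)"
proof -
  obtain c where c: "x = n * c" using assms(1) by blast
  have "c \<noteq> 0" using assms(2) c by auto
  moreover have "\<not> 2 \<le> c" using assms(3) mult_le_mono2[of 2 c n] unfolding c by auto
  ultimately have "c = 1" by simp
  then show ?thesis using c by simp
qed

lemma dvd_less_triple:
  assumes "n dvd x" "0 < x" "x < 3 * n" shows "x = (n::nat) \<or> x = 2 * n"
proof -
  obtain c where c: "x = n * c" using assms(1) by blast
  have "c \<noteq> 0" using assms(2) c by auto
  moreover have "\<not> 3 \<le> c" using assms(3) mult_le_mono2[of 3 c n] unfolding c by auto
  ultimately have "c = 1 \<or> c = 2" by auto
  then show ?thesis using c by auto
qed

lemma sum_binomial_select: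
  assumes "finite K" "\<And>k. k \<le> B \<Longrightarrow> P k \<longleftrightarrow> k \<in> K"
  shows "(\<Sum>k\<le>B. int (B choose k) * (if P k then 1 else 0)) = (\<Sum>k\<in>K. int (B choose k))"
proof -
  have "(\<Sum>k\<le>B. int (B choose k) * (if P k then 1 else 0)) = (\<Sum>k\<in>{..B} \<inter> K. int (B choose k))"
    unfolding sum.inter_restrict[OF finite_atMost] using assms(2) by (intro sum.cong) auto
  also have "\<dots> = (\<Sum>k\<in>K. int (B choose k))"
    using assms(1) by (intro sum.mono_neutral_left) (auto simp: binomial_eq_0 not_le)
  finally show ?thesis .
qed

context eisenstein_sum
begin

lemma gpow_geometric:
  "qcong (p ^ 2) (\<Sum>e\<le>p. g ^ (2 * h * j * e)) (of_int (if (p + 1) dvd j then int p + 1 else 0))"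
proof (cases "(p + 1) dvd j")
  case True
  then obtain i where j: "j = (p + 1) * i" by blast
  have "qcong (p ^ 2) (\<Sum>e\<le>p. g ^ (2 * h * j * e)) (\<Sum>e\<le>p. 1)"
  proof (rule qcong_sum)
    fix e
    have "0 + 2 * h * (p + 1) * (i * e) = 2 * h * j * e" unfolding j by (simp only: mult.assoc add_0)
    then show "qcong (p ^ 2) (g ^ (2 * h * j * e)) 1" using gpow_period[of 0 "i * e"] by (simp only: power_0)
  qed
  then show ?thesis using True by (simp add: add.commute)
next
  case False
  define x where "x = g ^ (2 * h * j)"
  have xO: "x \<in> \<O>" by (simp add: x_def)
  have S: "(\<Sum>e\<le>p. g ^ (2 * h * j * e)) = (\<Sum>e\<le>p. x ^ e)" by (simp only: x_def power_mult)
  have "x ^ (p + 1) = g ^ (0 + 2 * h * (p + 1) * j)" unfolding x_def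
    by (simp only: power_mult[symmetric]) (simp only: ac_simps add_0)
  then have "qcong (p ^ 2) (x ^ (p + 1)) 1" using gpow_period[of 0 j] by (simp only: power_0)
  then have "qcong (p ^ 2) (x ^ (p + 1) - 1) (1 - 1)" by (rule qcong_diff) simp
  moreover have "x ^ (p + 1) - 1 = (x - 1) * (\<Sum>e\<le>p. x ^ e)"
    using power_diff_1_eq[of x "p + 1"] by (simp add: lessThan_Suc_atMost)
  ultimately have 1: "qcong (p ^ 2) ((x - 1) * (\<Sum>e\<le>p. x ^ e)) ((x - 1) * 0)" by simp
  have "\<not> qcong p (x - 1) 0"
  proof
    assume "qcong p (x - 1) 0"
    then have "qcong p x 1" using qcong_iff_diff by blast
    then have "2 * h * (p + 1) dvd 2 * h * j" unfolding x_def order_eq[symmetric] by (rule g_order_dvd)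
    moreover have "0 < 2 * h" using h_ge_2 by simp
    ultimately have "p + 1 dvd j" using nat_mult_dvd_cancel1 by blast
    then show False using False by blast
  qed
  then have "qcong (p ^ 2) (\<Sum>e\<le>p. x ^ e) 0" using 1 xO by (intro qcong_cancel[of "x - 1" "\<Sum>e\<le>p. x ^ e" 0]) auto
  then show ?thesis using False S by simp
qed

text \<open>
  Expanding the power of the trace \<open>g ^ (p e) + g ^ e\<close> leaves geometric sums in \<open>g ^ (2h)\<close>, an element of
  order \<open>p + 1\<close>; only the terms with exponent divisible by \<open>p + 1\<close> survive.
\<close>

lemma twisted_power_sum:
  assumes "c + B = 2 * h * q"
  shows "qcong (p ^ 2) (\<Sum>e\<le>p. g ^ (c * e) * of_int (trace e ^ B))
    (of_int ((int p + 1) * (\<Sum>k\<le>B. int (B choose k) * (if (p + 1) dvd q + k then 1 else 0))))"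
proof -
  have "qcong (p ^ 2) (\<Sum>e\<le>p. g ^ (c * e) * of_int (trace e ^ B)) (\<Sum>e\<le>p. g ^ (c * e) * (g ^ (p * e) + g ^ e) ^ B)"
    unfolding of_int_power by (intro qcong_sum qcong_mult qcong_refl qcong_power trace_cong) auto
  also have "(\<Sum>e\<le>p. g ^ (c * e) * (g ^ (p * e) + g ^ e) ^ B)
      = (\<Sum>e\<le>p. \<Sum>k\<le>B. of_nat (B choose k) * g ^ (2 * h * (q + k) * e))"
  proof (rule sum.cong[OF refl])
    fix e
    have "g ^ (c * e) * (of_nat (B choose k) * (g ^ (p * e)) ^ k * (g ^ e) ^ (B - k))
        = of_nat (B choose k) * g ^ (2 * h * (q + k) * e)" if "k \<le> B" for k
    proof -
      have "p * k = 2 * h * k + k" using p_eq by (metis add_mult_distrib mult_1)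
      then have "c + p * k + (B - k) = 2 * h * (q + k)"
        using assms that by (simp add: distrib_left)
      then have "c * e + p * e * k + e * (B - k) = 2 * h * (q + k) * e"
        by (metis add_mult_distrib mult.assoc mult.commute)
      moreover have "g ^ (c * e) * (of_nat (B choose k) * (g ^ (p * e)) ^ k * (g ^ e) ^ (B - k))
        = of_nat (B choose k) * g ^ (c * e + p * e * k + e * (B - k))"
      proof -
        have "(g ^ (p * e)) ^ k = g ^ (p * e * k)" "(g ^ e) ^ (B - k) = g ^ (e * (B - k))"
          by (simp_all only: power_mult)
        then show ?thesis by (simp only: power_add mult.left_commute mult.assoc)
      qed
      ultimately show ?thesis by (simp only:)
    qed
    then show "g ^ (c * e) * (g ^ (p * e) + g ^ e) ^ B = (\<Sum>k\<le>B. of_nat (B choose k) * g ^ (2 * h * (q + k) * e))"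
      unfolding binomial_ring sum_distrib_left by (intro sum.cong) auto
  qed
  also have "\<dots> = (\<Sum>k\<le>B. of_nat (B choose k) * (\<Sum>e\<le>p. g ^ (2 * h * (q + k) * e)))"
    unfolding sum_distrib_left by (rule sum.swap)
  also have "qcong (p ^ 2) \<dots> (\<Sum>k\<le>B. of_nat (B choose k) * of_int (if (p + 1) dvd q + k then int p + 1 else 0))"
    by (intro qcong_sum qcong_mult qcong_refl gpow_geometric) auto
  also have "(\<Sum>k\<le>B. of_nat (B choose k) * of_int (if (p + 1) dvd q + k then int p + 1 else 0) :: complex)
     = of_int ((int p + 1) * (\<Sum>k\<le>B. int (B choose k) * (if (p + 1) dvd q + k then 1 else 0)))"
    unfolding sum_distrib_left of_int_sum by (intro sum.cong) (auto simp: mult.commute)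
  finally show ?thesis .
qed

text \<open>
  For \<open>\<chi>(g) = g ^ c\<close>, where \<open>c\<close> is one of the two exponents introduced below, this is the Eisenstein sum over the lines \<open>g ^ 0, \<dots>, g ^ p\<close>.
\<close>

definition Esum :: "nat \<Rightarrow> complex" where "Esum c = (\<Sum>e\<le>p. g ^ (c * e) * of_int (trace_symbol e))"

text \<open>
  The two sums come from the two powers of the trace in \<open>Legendre_interpolate\<close>; \<open>K\<close> and \<open>K'\<close> collect the
  surviving binomial terms.
\<close>

lemma Esum_cong:
  assumes "c + h = 2 * h * q" "finite K" "\<And>k. k \<le> h \<Longrightarrow> (p + 1) dvd q + k \<longleftrightarrow> k \<in> K"
    "finite K'" "\<And>k. k \<le> 3 * h \<Longrightarrow> (p + 1) dvd q + 1 + k \<longleftrightarrow> k \<in> K'"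
  shows "qcong (p ^ 2) (Esum c) (of_int ((int p + 1) *
     ((1 - int h) * (\<Sum>k\<in>K. int (h choose k)) + int h * (\<Sum>k\<in>K'. int (3 * h choose k)))))"
proof -
  have q: "c + 3 * h = 2 * h * (q + 1)" using assms(1) by simp
  have "qcong (p ^ 2) (Esum c) (\<Sum>e\<le>p. g ^ (c * e) * of_int ((1 - int h) * trace e ^ h + int h * trace e ^ (3 * h)))"
    unfolding Esum_def trace_symbol_def
    by (intro qcong_sum qcong_mult qcong_refl)
      (use Legendre_interpolate in \<open>auto simp: qcong_of_int_iff simp del: of_int_add of_int_mult\<close>)
  also have "\<dots> = of_int (1 - int h) * (\<Sum>e\<le>p. g ^ (c * e) * of_int (trace e ^ h))
      + of_int (int h) * (\<Sum>e\<le>p. g ^ (c * e) * of_int (trace e ^ (3 * h)))"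
    unfolding sum_distrib_left sum.distrib[symmetric] by (intro sum.cong) (auto simp: algebra_simps)
  also have "qcong (p ^ 2) \<dots> (of_int (1 - int h) * of_int ((int p + 1) * (\<Sum>k\<in>K. int (h choose k)))
      + of_int (int h) * of_int ((int p + 1) * (\<Sum>k\<in>K'. int (3 * h choose k))))"
  proof -
    have s: "(\<Sum>k\<le>h. int (h choose k) * (if (p + 1) dvd q + k then 1 else 0)) = (\<Sum>k\<in>K. int (h choose k))"
      "(\<Sum>k\<le>3 * h. int (3 * h choose k) * (if (p + 1) dvd q + 1 + k then 1 else 0)) = (\<Sum>k\<in>K'. int (3 * h choose k))"
      by (rule sum_binomial_select; use assms in blast)+
    have "qcong (p ^ 2) (\<Sum>e\<le>p. g ^ (c * e) * of_int (trace e ^ h)) (of_int ((int p + 1) * (\<Sum>k\<in>K. int (h choose k))))"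
      "qcong (p ^ 2) (\<Sum>e\<le>p. g ^ (c * e) * of_int (trace e ^ (3 * h))) (of_int ((int p + 1) * (\<Sum>k\<in>K'. int (3 * h choose k))))"
      using twisted_power_sum[OF assms(1)] twisted_power_sum[OF q] unfolding s by blast+
    then show ?thesis
      by (intro qcong_add qcong_mult qcong_refl Order_of_int Order_sum Order_mult gpow_O)
  qed
  finally show ?thesis by (simp add: algebra_simps)
qed

text \<open>
  Both exponents are odd multiples of \<open>(p ^ 2 - 1) / (2M)\<close>, so \<open>g ^ chi_exp\<close> is a \<open>2M\<close>-th root of unity, and the
  two add up to \<open>p ^ 2 - 1\<close>.
\<close>

definition chi_exp :: nat where "chi_exp = h * (p + 2 * m + 2)"
definition chi_exp_conj :: nat where "chi_exp_conj = h * (p - 2 * m)"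

text \<open>
  The surviving binomial terms are those with \<open>h + m + 2 + k = p + 1\<close> in the power \<open>h\<close> of the trace, and with
  \<open>h + m + 3 + k\<close> equal to \<open>p + 1\<close> or \<open>2 (p + 1)\<close> in the power \<open>3h\<close>.
\<close>

lemma Esum_chi_exp: "qcong (p ^ 2) (Esum chi_exp) (of_int E_unit)"
proof -
  have p: "p = 2 * h + 1" by (rule p_eq)
  have 1: "chi_exp + h = 2 * h * (h + m + 2)"
  proof -
    have "chi_exp + h = h * (p + 2 * m + 3)" by (simp add: chi_exp_def algebra_simps)
    also have "p + 2 * m + 3 = 2 * (h + m + 2)" using p by simp
    finally show ?thesis by simp
  qed
  have 2: "(p + 1) dvd h + m + 2 + k \<longleftrightarrow> k \<in> {h - m}" if "k \<le> h" for k
  proof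
    assume "(p + 1) dvd h + m + 2 + k"
    then have "h + m + 2 + k = p + 1" using that m_less p by (intro dvd_less_double) auto
    then show "k \<in> {h - m}" using p by simp
  next
    assume "k \<in> {h - m}"
    then have "h + m + 2 + k = p + 1" using p m_less by simp
    then show "(p + 1) dvd h + m + 2 + k" by simp
  qed
  have 3: "(p + 1) dvd h + m + 2 + 1 + k \<longleftrightarrow> k \<in> {h - m - 1, h - m + p}" if "k \<le> 3 * h" for k
  proof
    assume "(p + 1) dvd h + m + 2 + 1 + k"
    then have "h + m + 2 + 1 + k = p + 1 \<or> h + m + 2 + 1 + k = 2 * (p + 1)"
      using that m_less p by (intro dvd_less_triple) auto
    then show "k \<in> {h - m - 1, h - m + p}" using p m_less by auto
  next
    assume "k \<in> {h - m - 1, h - m + p}"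
    then have "h + m + 2 + 1 + k = (p + 1) * 1 \<or> h + m + 2 + 1 + k = (p + 1) * 2" using p m_less by auto
    then show "(p + 1) dvd h + m + 2 + 1 + k" by (metis dvd_triv_left)
  qed
  have "qcong (p ^ 2) (Esum chi_exp) (of_int ((int p + 1) *
     ((1 - int h) * (\<Sum>k\<in>{h - m}. int (h choose k)) + int h * (\<Sum>k\<in>{h - m - 1, h - m + p}. int (3 * h choose k)))))"
    by (rule Esum_cong[OF 1 _ 2 _ 3]) auto
  moreover have "h - m - 1 \<noteq> h - m + p" using p_gt_3 by linarith
  ultimately show ?thesis by (simp add: E_unit_def)
qed

text \<open>
  Here the power \<open>h\<close> of the trace contributes nothing, which is why the sum is divisible by \<open>p\<close>.
\<close>

lemma Esum_chi_exp_conj: "qcong (p ^ 2) (Esum chi_exp_conj) (of_int E_nonunit)"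
proof -
  have p: "p = 2 * h + 1" by (rule p_eq)
  have 1: "chi_exp_conj + h = 2 * h * (h + 1 - m)"
  proof -
    have "chi_exp_conj + h = h * (p - 2 * m + 1)" by (simp add: chi_exp_conj_def algebra_simps)
    also have "p - 2 * m + 1 = 2 * (h + 1 - m)" using p m_less by simp
    finally show ?thesis by simp
  qed
  have 2: "(p + 1) dvd h + 1 - m + k \<longleftrightarrow> k \<in> {}" if "k \<le> h" for k
  proof -
    have "0 < h + 1 - m + k" "h + 1 - m + k < p + 1" using that m_less p by auto
    then show ?thesis by (auto dest: dvd_imp_le)
  qed
  have 3: "(p + 1) dvd h + 1 - m + 1 + k \<longleftrightarrow> k \<in> {h + m}" if "k \<le> 3 * h" for k
  proof
    assume "(p + 1) dvd h + 1 - m + 1 + k"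
    then have "h + 1 - m + 1 + k = p + 1" using that m_less p by (intro dvd_less_double) auto
    then show "k \<in> {h + m}" using p m_less by simp
  next
    assume "k \<in> {h + m}"
    then have "h + 1 - m + 1 + k = p + 1" using p m_less by simp
    then show "(p + 1) dvd h + 1 - m + 1 + k" by simp
  qed
  have "qcong (p ^ 2) (Esum chi_exp_conj) (of_int ((int p + 1) *
     ((1 - int h) * (\<Sum>k\<in>{}. int (h choose k)) + int h * (\<Sum>k\<in>{h + m}. int (3 * h choose k)))))"
    by (rule Esum_cong[OF 1 _ 2 _ 3]) auto
  then show ?thesis by (simp add: E_nonunit_def)
qed

lemma gpow_chi_exp_inverse: "qcong (p ^ 2) (g ^ chi_exp * g ^ chi_exp_conj) 1"
proof -
  have "chi_exp + chi_exp_conj = h * ((p + 2 * m + 2) + (p - 2 * m))" by (simp add: chi_exp_def chi_exp_conj_def distrib_left)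
  also have "(p + 2 * m + 2) + (p - 2 * m) = 2 * (p + 1)" using m_less by simp
  finally have "chi_exp + chi_exp_conj = 0 + 2 * h * (p + 1) * 1" by simp
  then have "g ^ chi_exp * g ^ chi_exp_conj = g ^ (0 + 2 * h * (p + 1) * 1)" by (simp only: power_add[symmetric])
  then show ?thesis using gpow_period[of 0 1] by (simp only: power_0)
qed

lemma gpow_odd_half: "qcong (p ^ 2) (g ^ (h * (p + 1) * (2 * k + 1))) (- 1)"
proof -
  have "h * (p + 1) * (2 * k + 1) = h * (p + 1) + 2 * h * (p + 1) * k"
    by (simp add: algebra_simps)
  then show ?thesis using qcong_trans[OF gpow_period gpow_half] by (simp only:)
qed

lemma gpow_chi_exp_M: "qcong (p ^ 2) ((g ^ chi_exp) ^ M) (- 1)"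
proof -
  obtain k where k: "M = 2 * k" using M_cases by (metis (no_types) even_numeral evenE numeral_Bit0_eq_double)
  have "p + 2 * m + 2 = (2 * k + 1) * (2 * m + 1)" using p_plus_1 k by simp
  then have "chi_exp * M = h * (M * (2 * m + 1)) * (2 * k + 1)" by (simp only: chi_exp_def ac_simps)
  then show ?thesis using gpow_odd_half[of k] by (simp only: power_mult[symmetric] p_plus_1[symmetric])
qed

lemma gpow_chi_exp_p_plus_1: "qcong (p ^ 2) ((g ^ chi_exp) ^ (p + 1)) (- 1)" "qcong (p ^ 2) ((g ^ chi_exp_conj) ^ (p + 1)) (- 1)"
proof -
  have "p + 2 * m + 2 = 2 * (h + m + 1) + 1" using p_eq by simp
  then have "chi_exp * (p + 1) = h * (p + 1) * (2 * (h + m + 1) + 1)" by (simp only: chi_exp_def ac_simps)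
  then show "qcong (p ^ 2) ((g ^ chi_exp) ^ (p + 1)) (- 1)"
    using gpow_odd_half[of "h + m + 1"] by (simp only: power_mult[symmetric])
  have "p - 2 * m = 2 * (h - m) + 1" using p_eq m_less by simp
  then have "chi_exp_conj * (p + 1) = h * (p + 1) * (2 * (h - m) + 1)" by (simp only: chi_exp_conj_def ac_simps)
  then show "qcong (p ^ 2) ((g ^ chi_exp_conj) ^ (p + 1)) (- 1)"
    using gpow_odd_half[of "h - m"] by (simp only: power_mult[symmetric])
qed

text \<open>
  The terms for \<open>e\<close> and \<open>p + 1 - e\<close> are combined, and the middle term \<open>e = h + 1\<close> is zero.  In this form the
  coefficients are Lucas numbers, hence lie in a quadratic order.
\<close>

lemma Esum_fold:
  assumes cd: "qcong (p ^ 2) (g ^ c * g ^ d) 1" and c: "qcong (p ^ 2) ((g ^ c) ^ (p + 1)) (- 1)"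
  shows "qcong (p ^ 2) (Esum c) (of_int (trace_symbol 0) + (\<Sum>e=1..h. ((g ^ c) ^ e + (- (g ^ d)) ^ e) * of_int (trace_symbol e)))"
proof -
  define T where "T e = (g ^ c) ^ e * of_int (trace_symbol e)" for e
  have "{..p} = insert 0 {1..h} \<union> insert (h + 1) {h + 2..p}" using p_eq by auto
  then have "Esum c = (\<Sum>e\<in>insert 0 {1..h} \<union> insert (h + 1) {h + 2..p}. T e)"
    by (simp add: Esum_def T_def power_mult)
  also have "\<dots> = T 0 + (\<Sum>e=1..h. T e) + (T (h + 1) + (\<Sum>e=h+2..p. T e))"
    by (subst sum.union_disjoint) auto
  also have "T 0 = of_int (trace_symbol 0)" by (simp add: T_def)
  also have "T (h + 1) = 0" unfolding T_def trace_symbol_half by simp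
  also have "(\<Sum>e=h+2..p. T e) = (\<Sum>e=1..h. T (p + 1 - e))"
    by (rule sum.reindex_bij_witness[of _ "\<lambda>e. p + 1 - e" "\<lambda>e. p + 1 - e"]) (use p_eq in auto)
  also have "of_int (trace_symbol 0) + (\<Sum>e=1..h. T e) + (0 + (\<Sum>e=1..h. T (p + 1 - e)))
      = of_int (trace_symbol 0) + (\<Sum>e=1..h. T e + T (p + 1 - e))" by (simp add: sum.distrib)
  also have "qcong (p ^ 2) \<dots> (of_int (trace_symbol 0) + (\<Sum>e=1..h. T e + (- (g ^ d)) ^ e * of_int (trace_symbol e)))"
  proof (intro qcong_add qcong_sum qcong_refl)
    fix e assume e: "e \<in> {1..h}"
    then have e': "1 \<le> e" "e \<le> p" using p_eq by auto
    have "qcong (p ^ 2) ((g ^ c) ^ (p + 1 - e) * (g ^ c * g ^ d) ^ e) ((g ^ c) ^ (p + 1 - e) * 1 ^ e)"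
      by (intro qcong_mult qcong_power cd qcong_refl) auto
    moreover have "(g ^ c) ^ (p + 1 - e) * (g ^ c * g ^ d) ^ e = (g ^ c) ^ (p + 1) * (g ^ d) ^ e"
    proof -
      have "(g ^ c) ^ (p + 1) = (g ^ c) ^ (p + 1 - e) * (g ^ c) ^ e"
        using e' by (simp only: power_add[symmetric] le_add_diff_inverse2 trans_le_add1)
      then show ?thesis by (simp only: power_mult_distrib mult.assoc)
    qed
    moreover have "qcong (p ^ 2) ((g ^ c) ^ (p + 1) * (g ^ d) ^ e) (- 1 * (g ^ d) ^ e)"
      by (intro qcong_mult c qcong_refl) auto
    ultimately have "qcong (p ^ 2) ((g ^ c) ^ (p + 1 - e)) (- 1 * (g ^ d) ^ e)"
      by (simp only: power_one mult_1_right) (rule qcong_trans[OF qcong_sym])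
    then have "qcong (p ^ 2) (T (p + 1 - e)) (- 1 * (g ^ d) ^ e * of_int (trace_symbol (p + 1 - e)))"
      unfolding T_def by (intro qcong_mult qcong_refl) auto
    also have "- 1 * (g ^ d) ^ e * of_int (trace_symbol (p + 1 - e)) = (- (g ^ d)) ^ e * of_int (trace_symbol e)"
      unfolding trace_symbol_reflect[OF e'] power_minus[of "g ^ d" e] by simp
    finally show "qcong (p ^ 2) (T (p + 1 - e)) ((- (g ^ d)) ^ e * of_int (trace_symbol e))" .
  qed
  finally show ?thesis by (simp add: T_def distrib_right)
qed

definition norm_coeff :: int where "norm_coeff = (if M = 4 then 2 else 1)"
definition rho :: complex where "rho = g ^ chi_exp - g ^ chi_exp_conj"

lemma rho_O [simp]: "rho \<in> \<O>" by (simp add: rho_def)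

text \<open>
  \<open>\<rho> = x - 1/x\<close> for a primitive root of unity \<open>x\<close> of order \<open>8\<close> or \<open>12\<close>, whose \<open>M\<close>-th power is \<open>- 1\<close>.  For
  \<open>M = 6\<close> this only yields \<open>(x ^ 2 + 1) (x ^ 4 - x ^ 2 + 1) \<equiv> 0\<close>, and the order of \<open>x\<close> is used to cancel the
  first factor.
\<close>

lemma rho_square: "qcong (p ^ 2) (rho * rho) (of_int (- norm_coeff))"
proof -
  define x where "x = g ^ chi_exp"
  define y where "y = g ^ chi_exp_conj"
  have O: "x \<in> \<O>" "y \<in> \<O>" by (simp_all add: x_def y_def)
  have xy: "qcong (p ^ 2) (x * y) 1" unfolding x_def y_def by (rule gpow_chi_exp_inverse)
  have xM: "qcong (p ^ 2) (x ^ M) (- 1)" unfolding x_def by (rule gpow_chi_exp_M)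
  have xy2: "qcong (p ^ 2) ((x * y) ^ 2) (1 ^ 2)" using xy O by (intro qcong_power) auto
  have y2: "qcong (p ^ 2) (y ^ 2) (- (x ^ (M - 2)))"
  proof -
    have 1: "qcong (p ^ 2) (x ^ (M - 2) * (x * y) ^ 2) (x ^ (M - 2) * 1 ^ 2)"
      using xy2 O by (intro qcong_mult) auto
    have 2: "x ^ (M - 2) * (x * y) ^ 2 = x ^ M * y ^ 2"
    proof -
      have "M = (M - 2) + 2" using M_cases by auto
      then have "x ^ (M - 2) * x ^ 2 = x ^ M" by (metis power_add)
      then show ?thesis by (simp only: power_mult_distrib flip: mult.assoc)
    qed
    have 3: "qcong (p ^ 2) (x ^ M * y ^ 2) (- 1 * y ^ 2)"
      using xM O by (intro qcong_mult) auto
    have "qcong (p ^ 2) (- 1 * y ^ 2) (x ^ (M - 2) * 1 ^ 2)"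
      using qcong_trans[OF qcong_sym[OF 3]] 1 unfolding 2 by blast
    then have "qcong (p ^ 2) (- (- 1 * y ^ 2)) (- (x ^ (M - 2) * 1 ^ 2))" by (rule qcong_uminus)
    then show ?thesis by simp
  qed
  have "rho * rho = x ^ 2 + y ^ 2 - (x * y + x * y)"
    by (simp add: rho_def x_def y_def power2_eq_square algebra_simps)
  also have "qcong (p ^ 2) \<dots> (x ^ 2 + - (x ^ (M - 2)) - (1 + 1))"
    by (intro qcong_add qcong_diff y2 xy qcong_refl)
  finally have 1: "qcong (p ^ 2) (rho * rho) (x ^ 2 - x ^ (M - 2) - 2)" by simp
  show ?thesis
  proof (cases "M = 4")
    case True
    then have "norm_coeff = 2" unfolding norm_coeff_def by simp
    with 1 True show ?thesis by simp
  next
    case False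
    then have M: "M = 6" using M_cases by simp
    have "(x ^ 2 + 1) * (x ^ 4 - x ^ 2 + 1) = x ^ 6 + 1" by (simp add: algebra_simps flip: power_add)
    also have "qcong (p ^ 2) \<dots> (- 1 + 1)" using xM unfolding M by (intro qcong_add) auto
    finally have 2: "qcong (p ^ 2) ((x ^ 2 + 1) * (x ^ 4 - x ^ 2 + 1)) ((x ^ 2 + 1) * 0)" by simp
    have "\<not> qcong p (x ^ 2 + 1) 0"
    proof
      assume "qcong p (x ^ 2 + 1) 0"
      then have "qcong p (x ^ 2) (- 1)" using qcong_iff_diff[of p "x ^ 2" "- 1"] by simp
      then have "qcong p ((x ^ 2) ^ 2) ((- 1) ^ 2)" using O by (intro qcong_power) auto
      then have "qcong p (g ^ (chi_exp * 4)) 1" by (simp add: x_def mult.commute flip: power_mult)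
      then have "2 * h * (p + 1) dvd chi_exp * 4" unfolding order_eq[symmetric] by (rule g_order_dvd)
      moreover have "2 * h * (p + 1) = (h * (2 * m + 1)) * 12" unfolding p_plus_1 M by (simp add: algebra_simps)
      moreover have "chi_exp * 4 = (h * (2 * m + 1)) * 28"
      proof -
        have eq: "p + 2 * m + 2 = 7 * (2 * m + 1)" using p_plus_1 M by simp
        show ?thesis unfolding chi_exp_def eq by (simp add: algebra_simps)
      qed
      moreover have "0 < h * (2 * m + 1)" using h_ge_2 by simp
      ultimately have "12 dvd (28::nat)" using nat_mult_dvd_cancel1 by metis
      then show False by presburger
    qed
    then have "qcong (p ^ 2) (x ^ 4 - x ^ 2 + 1) 0"
      using 2 O qcong_cancel[of "x ^ 2 + 1" "x ^ 4 - x ^ 2 + 1" 0] by simp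
    then have "qcong (p ^ 2) (- (x ^ 4 - x ^ 2 + 1) - 1) (- 0 - 1)"
      by (intro qcong_diff qcong_uminus qcong_refl)
    then have 3: "qcong (p ^ 2) (x ^ 2 - x ^ (M - 2) - 2) (- 1)" using M by (simp add: algebra_simps)
    have k: "norm_coeff = 1" unfolding norm_coeff_def using M by simp
    show ?thesis unfolding k using qcong_trans[OF 1 3] by simp
  qed
qed

abbreviation "lucas_re e \<equiv> fst (lucas norm_coeff e)"
abbreviation "lucas_im e \<equiv> snd (lucas norm_coeff e)"

text \<open>
  The two powers are those of numbers with sum \<open>\<rho>\<close> and, modulo \<open>p ^ 2\<close>, product \<open>- 1\<close>.
\<close>

lemma lucas_cong: "qcong (p ^ 2) ((g ^ chi_exp) ^ e + (- (g ^ chi_exp_conj)) ^ e) (of_int (lucas_re e) + of_int (lucas_im e) * rho)"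
proof (induction norm_coeff e rule: lucas.induct)
  case 1
  then show ?case by simp
next
  case 2
  then show ?case by (simp add: rho_def)
next
  case (3 n)
  define v where "v e = (g ^ chi_exp) ^ e + (- (g ^ chi_exp_conj)) ^ e" for e
  have vO: "v e \<in> \<O>" for e by (simp add: v_def)
  have "v (Suc (Suc n)) = rho * v (Suc n) + (g ^ chi_exp * g ^ chi_exp_conj) * v n"
    by (simp add: v_def rho_def algebra_simps)
  also have "qcong (p ^ 2) \<dots> (rho * (of_int (lucas_re (Suc n)) + of_int (lucas_im (Suc n)) * rho) + 1 * (of_int (lucas_re n) + of_int (lucas_im n) * rho))"
    using 3 vO unfolding v_def[symmetric] by (intro qcong_add qcong_mult gpow_chi_exp_inverse qcong_refl) auto
  also have "rho * (of_int (lucas_re (Suc n)) + of_int (lucas_im (Suc n)) * rho) + 1 * (of_int (lucas_re n) + of_int (lucas_im n) * rho)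
      = of_int (lucas_re n) + of_int (lucas_im (Suc n)) * (rho * rho) + of_int (lucas_im n + lucas_re (Suc n)) * rho"
    by (simp add: algebra_simps)
  also have "qcong (p ^ 2) \<dots> (of_int (lucas_re n) + of_int (lucas_im (Suc n)) * of_int (- norm_coeff) + of_int (lucas_im n + lucas_re (Suc n)) * rho)"
    by (intro qcong_add qcong_mult rho_square qcong_refl) auto
  finally show ?case unfolding v_def by (simp add: algebra_simps)
qed

definition eis_X :: int where "eis_X = trace_symbol 0 + (\<Sum>e=1..h. lucas_re e * trace_symbol e)"
definition eis_Y :: int where "eis_Y = (\<Sum>e=1..h. lucas_im e * trace_symbol e)"

lemma Esum_chi_exp_XY: "qcong (p ^ 2) (Esum chi_exp) (of_int eis_X + of_int eis_Y * rho)"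
proof -
  note Esum_fold[OF gpow_chi_exp_inverse gpow_chi_exp_p_plus_1(1)]
  also have "qcong (p ^ 2) (of_int (trace_symbol 0) + (\<Sum>e=1..h. ((g ^ chi_exp) ^ e + (- (g ^ chi_exp_conj)) ^ e) * of_int (trace_symbol e)))
     (of_int (trace_symbol 0) + (\<Sum>e=1..h. (of_int (lucas_re e) + of_int (lucas_im e) * rho) * of_int (trace_symbol e)))"
    by (intro qcong_add qcong_sum qcong_mult lucas_cong qcong_refl) auto
  also have "\<dots> = of_int eis_X + of_int eis_Y * rho"
    by (simp add: eis_X_def eis_Y_def sum.distrib sum_distrib_left sum_distrib_right algebra_simps)
  finally show ?thesis .
qed

lemma Esum_chi_exp_conj_XY: "qcong (p ^ 2) (Esum chi_exp_conj) (of_int eis_X - of_int eis_Y * rho)"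
proof -
  have v: "qcong (p ^ 2) ((g ^ chi_exp_conj) ^ e + (- (g ^ chi_exp)) ^ e) (of_int (lucas_re e) - of_int (lucas_im e) * rho)" for e
  proof -
    have "(g ^ chi_exp_conj) ^ e + (- (g ^ chi_exp)) ^ e = (- 1) ^ e * ((g ^ chi_exp) ^ e + (- (g ^ chi_exp_conj)) ^ e)"
      unfolding power_minus[of "g ^ chi_exp" e] power_minus[of "g ^ chi_exp_conj" e]
      by (simp add: algebra_simps flip: power_add mult.assoc mult_2)
    also have "qcong (p ^ 2) \<dots> ((- 1) ^ e * (of_int (lucas_re e) + of_int (lucas_im e) * rho))"
      by (intro qcong_mult lucas_cong qcong_refl) auto
    also have "(- 1) ^ e * (of_int (lucas_re e) + of_int (lucas_im e) * rho) = of_int (lucas_re e) - of_int (lucas_im e) * rho"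
      using lucas_parity[of e norm_coeff] by (cases "even e") auto
    finally show ?thesis .
  qed
  have "qcong (p ^ 2) (g ^ chi_exp_conj * g ^ chi_exp) 1" using gpow_chi_exp_inverse by (simp add: mult.commute)
  note Esum_fold[OF this gpow_chi_exp_p_plus_1(2)]
  also have "qcong (p ^ 2) (of_int (trace_symbol 0) + (\<Sum>e=1..h. ((g ^ chi_exp_conj) ^ e + (- (g ^ chi_exp)) ^ e) * of_int (trace_symbol e)))
     (of_int (trace_symbol 0) + (\<Sum>e=1..h. (of_int (lucas_re e) - of_int (lucas_im e) * rho) * of_int (trace_symbol e)))"
    by (intro qcong_add qcong_sum qcong_mult v qcong_refl) auto
  also have "\<dots> = of_int eis_X - of_int eis_Y * rho"
    by (simp add: eis_X_def eis_Y_def sum.distrib sum_subtractf sum_distrib_left sum_distrib_right algebra_simps)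
  finally show ?thesis .
qed

end

section \<open>Representation of p by the norm form\<close>

context eisenstein_sum
begin

lemma norm_coeff_cases: "norm_coeff = 2 \<and> M = 4 \<or> norm_coeff = 1 \<and> M = 6"
  using M_cases unfolding norm_coeff_def by auto

lemma lucas_bound: "\<bar>lucas_re e\<bar> \<le> 2" "\<bar>lucas_im e\<bar> \<le> 2"
  using norm_coeff_cases lucas_1_bound[of e] lucas_2_bound[of e] by auto

lemma X_bound: "\<bar>eis_X\<bar> \<le> int h + 1" and Y_bound: "\<bar>eis_Y\<bar> \<le> int h + 1"
proof -
  have f1: "\<bar>trace_symbol e\<bar> \<le> 1" for e using trace_symbol_values[of e] by auto
  have s: "\<bar>\<Sum>e=1..h. u e * trace_symbol e\<bar> \<le> (\<Sum>e=1..h. \<bar>u e\<bar>)" for u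
  proof -
    have "\<bar>\<Sum>e=1..h. u e * trace_symbol e\<bar> \<le> (\<Sum>e=1..h. \<bar>u e * trace_symbol e\<bar>)" by (rule sum_abs)
    also have "\<dots> \<le> (\<Sum>e=1..h. \<bar>u e\<bar> * 1)"
      unfolding abs_mult by (intro sum_mono mult_left_mono f1) auto
    finally show ?thesis by simp
  qed
  show "\<bar>eis_X\<bar> \<le> int h + 1"
    using s[of lucas_re] f1[of 0] sum_lucas_bound(1)[OF lucas_bound, of h] unfolding eis_X_def by linarith
  show "\<bar>eis_Y\<bar> \<le> int h + 1"
    using s[of lucas_im] sum_lucas_bound(2)[OF lucas_bound, of h] unfolding eis_Y_def by linarith
qed

lemma XY_cong_E: "qcong (p ^ 2) (of_int eis_X + of_int eis_Y * rho) (of_int E_unit)"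
    "qcong (p ^ 2) (of_int eis_X - of_int eis_Y * rho) (of_int E_nonunit)"
  using qcong_trans[OF qcong_sym[OF Esum_chi_exp_XY] Esum_chi_exp] qcong_trans[OF qcong_sym[OF Esum_chi_exp_conj_XY] Esum_chi_exp_conj] by auto

lemma XY_norm_cong: "[eis_X ^ 2 + norm_coeff * eis_Y ^ 2 = E_unit * E_nonunit] (mod (int p) ^ 2)"
proof -
  have "(of_int (eis_X ^ 2 + norm_coeff * eis_Y ^ 2) :: complex) = of_int (eis_X ^ 2) - of_int (eis_Y ^ 2) * of_int (- norm_coeff)" by simp
  also have "qcong (p ^ 2) \<dots> (of_int (eis_X ^ 2) - of_int (eis_Y ^ 2) * (rho * rho))"
    by (intro qcong_diff qcong_mult qcong_refl qcong_sym[OF rho_square]) auto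
  also have "of_int (eis_X ^ 2) - of_int (eis_Y ^ 2) * (rho * rho) = (of_int eis_X + of_int eis_Y * rho) * (of_int eis_X - of_int eis_Y * rho)"
    by (simp add: power2_eq_square algebra_simps)
  also have "qcong (p ^ 2) \<dots> (of_int E_unit * of_int E_nonunit)"
    by (intro qcong_mult XY_cong_E) auto
  finally have "qcong (p ^ 2) (of_int (eis_X ^ 2 + norm_coeff * eis_Y ^ 2)) (of_int (E_unit * E_nonunit))" by simp
  then show ?thesis unfolding qcong_of_int_iff by simp
qed

lemma X_cong: "[2 * eis_X = E_unit + E_nonunit] (mod (int p) ^ 2)"
proof -
  have "qcong (p ^ 2) (of_int eis_X + of_int eis_Y * rho + (of_int eis_X - of_int eis_Y * rho)) (of_int E_unit + of_int E_nonunit)"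
    by (intro qcong_add XY_cong_E)
  then have "qcong (p ^ 2) (of_int (2 * eis_X)) (of_int (E_unit + E_nonunit))" by simp
  then show ?thesis unfolding qcong_of_int_iff by simp
qed

text \<open>
  Multiplying \<open>X + Y \<rho>\<close> by its conjugate gives \<open>X ^ 2 + k Y ^ 2 \<equiv> p\<close> modulo \<open>p ^ 2\<close>; the left-hand side lies
  between \<open>0\<close> and \<open>3 (h + 1) ^ 2 < p ^ 2 + p\<close>, so equality holds.
\<close>

lemma XY_norm: "eis_X ^ 2 + norm_coeff * eis_Y ^ 2 = int p"
proof -
  obtain c where "E_nonunit = int p * c" "[E_unit * E_nonunit = int p] (mod (int p) ^ 2)"
    by (rule E_unit_E_nonunit)
  then have "[eis_X ^ 2 + norm_coeff * eis_Y ^ 2 = int p] (mod (int p) ^ 2)" using XY_norm_cong cong_trans by blast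
  then obtain d where d: "eis_X ^ 2 + norm_coeff * eis_Y ^ 2 = int p + (int p) ^ 2 * d"
    by (metis cong_iff_lin cong_sym)
  have k: "0 \<le> norm_coeff" "norm_coeff \<le> 2" using norm_coeff_cases by auto
  have "eis_X ^ 2 \<le> (int h + 1) ^ 2" "eis_Y ^ 2 \<le> (int h + 1) ^ 2"
    using X_bound Y_bound by (metis abs_ge_zero power2_abs power_mono)+
  then have "eis_X ^ 2 + norm_coeff * eis_Y ^ 2 \<le> 3 * (int h + 1) ^ 2"
    using mult_mono[of norm_coeff 2 "eis_Y ^ 2" "(int h + 1) ^ 2"] k by simp
  also have "\<dots> < int p + (int p) ^ 2"
  proof -
    have P: "int p = 2 * int h + 1" using p_eq by simp
    have "2 * 2 \<le> int h * int h" using h_ge_2 by (intro mult_mono) auto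
    then show ?thesis unfolding P using h_ge_2 by (simp add: power2_eq_square algebra_simps)
  qed
  finally have "int p + (int p) ^ 2 * d < int p + (int p) ^ 2 * 1" using d by simp
  then have "d < 1" using p_gt_3 by (simp add: mult_less_cancel_left_pos)
  moreover have "- 1 < d"
  proof (rule ccontr)
    assume "\<not> - 1 < d"
    then have "(int p) ^ 2 * d \<le> (int p) ^ 2 * (- 1)" by (intro mult_left_mono) auto
    moreover have "int p < (int p) ^ 2" using p_gt_3 by (simp add: power2_eq_square)
    moreover have "0 \<le> eis_X ^ 2 + norm_coeff * eis_Y ^ 2" using k by simp
    ultimately show False using d by linarith
  qed
  ultimately show ?thesis using d by simp
qed

lemma E_unit_square_cong: "[E_unit ^ 2 = 4 * eis_X ^ 2 - 2 * int p] (mod (int p) ^ 2)"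
proof -
  obtain c where c: "E_nonunit = int p * c" "[E_unit * E_nonunit = int p] (mod (int p) ^ 2)"
    by (rule E_unit_E_nonunit)
  have "[(2 * eis_X) ^ 2 = (E_unit + E_nonunit) ^ 2] (mod (int p) ^ 2)" by (rule cong_pow[OF X_cong])
  then have "[4 * eis_X ^ 2 - 2 * int p = (E_unit + E_nonunit) ^ 2 - 2 * (E_unit * E_nonunit)] (mod (int p) ^ 2)"
    by (intro cong_diff cong_mult cong_sym[OF c(2)]) (auto simp: power_mult_distrib)
  also have "(E_unit + E_nonunit) ^ 2 - 2 * (E_unit * E_nonunit) = E_unit ^ 2 + (int p) ^ 2 * c ^ 2"
    unfolding c(1) by (simp add: power2_eq_square algebra_simps)
  also have "[\<dots> = E_unit ^ 2] (mod (int p) ^ 2)" by (simp add: cong_iff_dvd_diff)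
  finally show ?thesis by (rule cong_sym)
qed

text \<open>
  Modulo \<open>2\<close> all the symbols in question are \<open>1\<close>, so the parity of \<open>X\<close> is decided by the number of odd
  coefficients, which are those at even indices prime to \<open>3\<close>, and by the term outside the sum.  Each block of
  six indices contains two odd coefficients.
\<close>

lemma even_X:
  assumes "M = 6" shows "even eis_X"
proof -
  have "norm_coeff = 1" using assms norm_coeff_cases by auto
  then have A: "even (lucas_re e) \<longleftrightarrow> odd e \<or> 3 dvd e" for e using lucas_1_bound[of e] by auto
  have blocks: "odd (\<Sum>e=1..6*j+2. lucas_re e * trace_symbol e)" if "6 * j + 2 \<le> h" for j
    using that
  proof (induction j)
    case 0
    have "even (lucas_re 1)" "odd (lucas_re 2)" unfolding A by auto
    moreover have "odd (trace_symbol 2)" using h_ge_2 by (rule trace_symbol_nonzero)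
    ultimately show ?case by (simp add: numeral_2_eq_2)
  next
    case (Suc j)
    define n where "n = 6 * j + 2"
    have eq: "6 * Suc j + 2 = Suc (Suc (Suc (Suc (Suc (Suc n)))))" by (simp add: n_def)
    have "even (lucas_re (n + 1))" "odd (lucas_re (n + 2))" "even (lucas_re (n + 3))" "even (lucas_re (n + 4))" "even (lucas_re (n + 5))" "odd (lucas_re (n + 6))"
      unfolding A n_def by presburger+
    moreover have "odd (trace_symbol (n + 2))" "odd (trace_symbol (n + 6))" using Suc.prems unfolding n_def by (intro trace_symbol_nonzero; simp)+
    moreover have "odd (\<Sum>e=1..n. lucas_re e * trace_symbol e)" using Suc unfolding n_def by simp
    ultimately show ?case unfolding eq by (simp add: numeral_eq_Suc)
  qed
  have "6 * m + 2 = h" using p_plus_1 p_eq assms by simp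
  then have "odd (\<Sum>e=1..h. lucas_re e * trace_symbol e)" using blocks[of m] by (metis order_refl)
  moreover have "odd (trace_symbol 0)" by (rule trace_symbol_nonzero) simp
  ultimately show ?thesis unfolding eis_X_def by simp
qed

end

context eisenstein_prime
begin

text \<open>
  \<open>- 1\<close> is a nonresidue for \<open>p = 8m + 3\<close>, and \<open>- 3\<close> is one for \<open>p = 12m + 5\<close>.
\<close>

lemma inert_discriminant:
  "[(- int (if M = 4 then 1 else 3)) ^ h = - 1] (mod int p)"
proof (cases "M = 4")
  case True
  have "2 * h + 1 + 1 = 4 * (2 * m + 1)" using p_plus_1 True p_eq by simp
  then have "odd h" by presburger
  then show ?thesis using True by simp
next
  case False
  then have M: "M = 6" using M_cases by simp
  then have p: "p = 12 * m + 5" using p_plus_1 by simp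
  have "2 * h + 1 = 12 * m + 5" using p p_eq by simp
  then have h: "even h" by presburger
  have "p mod 3 = 2" unfolding p by presburger
  then have "Legendre (int p) 3 = - 1" unfolding Legendre_p_3 by simp
  moreover have "Legendre (int p) (int 3) * Legendre (int 3) (int p) = (- 1) ^ ((p - 1) div 2 * ((3 - 1) div 2))"
    using p_prime p_gt_3 by (intro Quadratic_Reciprocity) auto
  moreover have "(p - 1) div 2 * ((3 - 1) div 2) = h" by (simp add: h_def)
  ultimately have "Legendre 3 (int p) = - 1" using h by simp
  then have "[3 ^ h = - 1] (mod int p)"
    using euler_criterion[of p 3] p_prime p_gt_3 by (simp add: h_def cong_sym)
  moreover have "(- 3 :: int) ^ h = 3 ^ h" using h by simp
  ultimately show ?thesis using False by simp
qed

lemma norm_form_cong: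
  "\<exists>X Y :: int. X ^ 2 + (if M = 4 then 2 else 1) * Y ^ 2 = int p
     \<and> [E_unit ^ 2 = 4 * X ^ 2 - 2 * int p] (mod (int p) ^ 2) \<and> (M = 6 \<longrightarrow> even X)"
proof -
  \<comment> \<open>Any \<open>D\<close> with \<open>- D\<close> a nonresidue would do; these two are uniform in \<open>p\<close>.\<close>
  define D :: nat where "D = (if M = 4 then 1 else 3)"
  interpret inert_order p D
    by unfold_locales (use inert_discriminant in \<open>auto simp: D_def\<close>)
  obtain g where g: "g \<in> Order" "qcong (p ^ 2) (g ^ (p ^ 2 - 1)) 1"
    "\<forall>j. qcong p (g ^ j) 1 \<longrightarrow> p ^ 2 - 1 dvd j" "qcong (p ^ 2) (g ^ p) (cnj g)"
    by (rule teichmueller_generator) (rule that)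
  interpret eisenstein_sum p D M m g
    by unfold_locales (use g in auto)
  show ?thesis
    using XY_norm E_unit_square_cong even_X unfolding norm_coeff_def by blast
qed

end

text \<open>
  The classical argument: \<open>p\<close> divides \<open>x Y - X y\<close> or \<open>x Y + X y\<close>, and by Brahmagupta's identity the quotient
  \<open>c\<close> satisfies \<open>k c ^ 2 \<le> 1\<close>.  The value \<open>c = 0\<close> gives equal representations, and the other case is the exchange
  of the two squares, possible for \<open>k = 1\<close> only.
\<close>

lemma norm_form_unique:
  fixes x y X Y k :: int
  assumes "prime p" "x ^ 2 + k * y ^ 2 = int p" "X ^ 2 + k * Y ^ 2 = int p" "k = 1 \<or> k = 2"
  shows "X ^ 2 = x ^ 2 \<or> k = 1 \<and> X ^ 2 = y ^ 2"
proof -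
  define P where "P = int p"
  have P: "prime P" "P > 0" using assms(1) by (auto simp: P_def prime_gt_0_nat)
  have x2: "x ^ 2 = P - k * y ^ 2" and X2: "X ^ 2 = P - k * Y ^ 2" using assms(2,3) by (auto simp: P_def)
  have main: "X ^ 2 = x ^ 2 \<or> k = 1 \<and> X ^ 2 = y ^ 2" if dvd: "P dvd x * Y - X * y" and xy: "x ^ 2 = P - k * y ^ 2" for y
  proof -
    obtain c where c: "x * Y - X * y = P * c" using dvd by blast
    define A where "A = x * X + k * y * Y"
    have "A ^ 2 + k * (x * Y - X * y) ^ 2 = (x ^ 2 + k * y ^ 2) * (X ^ 2 + k * Y ^ 2)"
      unfolding A_def by (simp add: power2_eq_square algebra_simps)
    also have "\<dots> = P ^ 2" using xy assms(3) by (simp add: P_def power2_eq_square)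
    finally have A: "A ^ 2 + k * (P * c) ^ 2 = P ^ 2" unfolding c .
    show ?thesis
    proof (cases "c = 0")
      case True
      then have "(x * Y) ^ 2 = (X * y) ^ 2" using c by simp
      then have "(P - k * y ^ 2) * Y ^ 2 = (P - k * Y ^ 2) * y ^ 2"
        unfolding power_mult_distrib xy X2 .
      then have "P * Y ^ 2 = P * y ^ 2" by (simp add: algebra_simps)
      then have "Y ^ 2 = y ^ 2" using P by simp
      then show ?thesis using xy assms(3) by (simp add: P_def)
    next
      case False
      have P2: "0 < P ^ 2" using P by simp
      have c1: "1 \<le> c ^ 2" using False by (simp add: power2_eq_square) (smt (verit) mult_pos_pos mult_neg_neg)
      have "P ^ 2 * (k * c ^ 2) \<le> P ^ 2 * 1" using A by (simp add: power_mult_distrib algebra_simps) (smt (verit) zero_le_power2)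
      then have kc: "k * c ^ 2 \<le> 1" using P2 by (simp only: mult_le_cancel_left_pos)
      have k: "k = 1" using kc c1 assms(4) by auto
      then have "c ^ 2 = 1" using kc c1 by simp
      then have "A ^ 2 = 0" using A k by (simp add: power_mult_distrib)
      then have "x * X = - (y * Y)" using k by (simp add: A_def)
      then have "(x * X) ^ 2 = (y * Y) ^ 2" by simp
      moreover have "(x * X) ^ 2 = (P - y ^ 2) * X ^ 2" "(y * Y) ^ 2 = y ^ 2 * (P - X ^ 2)"
        unfolding power_mult_distrib xy using X2 k by simp_all
      ultimately have "P * X ^ 2 = P * y ^ 2" by (simp add: algebra_simps)
      then show ?thesis using P k by simp
    qed
  qed
  have "(x * Y - X * y) * (x * Y + X * y) = x ^ 2 * Y ^ 2 - X ^ 2 * y ^ 2"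
    by (simp add: power2_eq_square algebra_simps)
  also have "\<dots> = P * (Y ^ 2 - y ^ 2)" unfolding x2 X2 by (simp add: algebra_simps)
  finally have "P dvd (x * Y - X * y) * (x * Y + X * y)" by simp
  then have "P dvd x * Y - X * y \<or> P dvd x * Y - X * (- y)" using P(1) by (simp add: prime_dvd_mult_iff)
  then show ?thesis using main[of y] main[of "- y"] x2 by auto
qed

context eisenstein_prime
begin

lemma trunc_sum_cong_norm_form:
  assumes "x ^ 2 + (if M = 4 then 2 else 1) * y ^ 2 = int p" "M = 6 \<longrightarrow> odd x"
  shows "loc_cong p 2 (trunc_sum 0 (- (1 / of_nat M))) (of_int (if M = 4 then 4 * x ^ 2 - 2 * int p else 2 * int p - 4 * x ^ 2))"
proof -
  define k :: int where "k = (if M = 4 then 2 else 1)"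
  obtain X Y where XY: "X ^ 2 + k * Y ^ 2 = int p"
    "[E_unit ^ 2 = 4 * X ^ 2 - 2 * int p] (mod (int p) ^ 2)" "M = 6 \<longrightarrow> even X"
    using norm_form_cong unfolding k_def by blast
  have "X ^ 2 = x ^ 2 \<or> k = 1 \<and> X ^ 2 = y ^ 2"
    using assms XY by (intro norm_form_unique[OF p_prime]) (auto simp: k_def)
  moreover have "X ^ 2 \<noteq> x ^ 2" if "M = 6"
  proof -
    have "even (X ^ 2)" "odd (x ^ 2)" using that XY(3) assms(2) by auto
    then show ?thesis by metis
  qed
  moreover have "y ^ 2 = int p - x ^ 2" if "M = 6" using assms(1) that by simp
  ultimately have "4 * X ^ 2 - 2 * int p = (if M = 4 then 4 * x ^ 2 - 2 * int p else 2 * int p - 4 * x ^ 2)"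
    using M_cases by (auto simp: k_def)
  then have "loc_cong p 2 (of_int (E_unit ^ 2)) (of_int (if M = 4 then 4 * x ^ 2 - 2 * int p else 2 * int p - 4 * x ^ 2))"
    using XY(2) unfolding loc_cong_of_int_iff by simp
  then show ?thesis using trunc_sum_cong_square loc_cong_trans by blast
qed

end

section \<open>The congruences\<close>

context prime_gt_3
begin

text \<open>
  \<open>n\<close> is the residue of \<open>- 1/r\<close> modulo \<open>p\<close>.
\<close>

lemma trunc_sum_vanish_nat:
  assumes "r * n + 1 = c * p" "c < r" "\<not> p dvd r" "odd d \<longleftrightarrow> even n"
  shows "loc_cong p 2 (trunc_sum (int d) (- (1 / of_nat r))) 0"
proof (rule trunc_sum_vanish)
  have "c * p < r * p" using assms(2) p_gt_3 by simp
  then have "r * n < r * p" using assms(1) by linarith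
  then show "n < p" by simp
qed (use assms in auto)

lemma parity_of_sign:
  assumes "[int d = (1 + (if b then 1 else - 1)) div 2] (mod 2)"
  shows "odd d \<longleftrightarrow> b"
proof (cases b)
  case True
  then have "int d mod 2 = 1" using assms by (simp add: cong_def)
  then show ?thesis using True by presburger
next
  case False
  then have "int d mod 2 = 0" using assms by (simp add: cong_def)
  then show ?thesis using False by presburger
qed

lemma trunc_sum_third_vanish:
  assumes "[int d = (1 + Legendre (int p) 3) div 2] (mod 2)"
  shows "loc_cong p 2 (trunc_sum (int d) (- (1 / 3))) 0"
proof -
  have d: "odd d \<longleftrightarrow> p mod 3 = 1" using assms unfolding Legendre_p_3 by (rule parity_of_sign)
  obtain n c where "3 * n + 1 = c * p" "c < 3" "odd d \<longleftrightarrow> even n"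
  proof (cases "p mod 3 = 1")
    case True
    define i where "i = p div 3"
    have "p = 3 * i + 1" using True unfolding i_def by presburger
    then show thesis using d True odd_p by (intro that[of i 1]) presburger+
  next
    case False
    define i where "i = p div 3"
    have "p = 3 * i + 2" using False p_mod_3 unfolding i_def by presburger
    then show thesis using d False by (intro that[of "2 * i + 1" 2]) presburger+
  qed
  then show ?thesis using trunc_sum_vanish_nat[of 3 n c d] not_p_dvd by simp
qed

lemma trunc_sum_quarter_vanish:
  assumes "[int d = (1 + Legendre (- 2) (int p)) div 2] (mod 2)"
  shows "loc_cong p 2 (trunc_sum (int d) (- (1 / 4))) 0"
proof -
  have d: "odd d \<longleftrightarrow> p mod 8 = 1 \<or> p mod 8 = 3" using assms unfolding Legendre_minus_2 by (rule parity_of_sign)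
  define i where "i = p div 4"
  have "p = 4 * i + 1 \<or> p = 4 * i + 3" using odd_p unfolding i_def by presburger
  then obtain n c where "4 * n + 1 = c * p" "c < 4" "odd d \<longleftrightarrow> even n"
  proof
    assume "p = 4 * i + 1"
    then show thesis using d by (intro that[of i 1]) presburger+
  next
    assume "p = 4 * i + 3"
    then show thesis using d by (intro that[of "3 * i + 2" 3]) presburger+
  qed
  then show ?thesis using trunc_sum_vanish_nat[of 4 n c d] not_p_dvd by simp
qed

lemma trunc_sum_sixth_vanish:
  assumes "[int d = (1 + Legendre (- 1) (int p)) div 2] (mod 2)"
  shows "loc_cong p 2 (trunc_sum (int d) (- (1 / 6))) 0"
proof -
  have d: "odd d \<longleftrightarrow> p mod 4 = 1" using assms unfolding Legendre_minus_1 by (rule parity_of_sign)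
  define i where "i = p div 6"
  have "p = 6 * i + 1 \<or> p = 6 * i + 5" using odd_p p_mod_3 unfolding i_def by presburger
  then obtain n c where "6 * n + 1 = c * p" "c < 6" "odd d \<longleftrightarrow> even n"
  proof
    assume "p = 6 * i + 1"
    then show thesis using d by (intro that[of i 1]) presburger+
  next
    assume "p = 6 * i + 5"
    then show thesis using d by (intro that[of "5 * i + 4" 5]) presburger+
  qed
  then show ?thesis using trunc_sum_vanish_nat[of 6 n c d] not_p_dvd by simp
qed

lemma trunc_sum_quarter_norm_form:
  assumes "[p = 3] (mod 8)" "int p = x^2 + 2 * y^2"
  shows "loc_cong p 2 (trunc_sum 0 (- (1 / 4))) (of_int (4 * x^2 - 2 * int p))"
proof -
  have "p mod 8 = 3" using assms(1) by (simp add: cong_def)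
  then have "p = 8 * (p div 8) + 3" using mult_div_mod_eq[of 8 p] by simp
  then interpret eisenstein_prime p 4 "p div 8" by unfold_locales auto
  show ?thesis using trunc_sum_cong_norm_form[of x y] assms(2) by simp
qed

lemma trunc_sum_sixth_norm_form:
  assumes "[p = 5] (mod 12)" "int p = x^2 + y^2" "\<not> 2 dvd x"
  shows "loc_cong p 2 (trunc_sum 0 (- (1 / 6))) (of_int (2 * int p - 4 * x^2))"
proof -
  have "p mod 12 = 5" using assms(1) by (simp add: cong_def)
  then have "p = 12 * (p div 12) + 5" using mult_div_mod_eq[of 12 p] by simp
  then interpret eisenstein_prime p 6 "p div 12" by unfold_locales auto
  show ?thesis using trunc_sum_cong_norm_form[of x y] assms(2,3) by simp
qed

end

theorem theorem1p3:
  fixes p :: nat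
  assumes "prime p" and "p > 3"
  shows
    "(\<forall>d::nat \<in> {0..p-1}.
        ([int d = (1 + Legendre (int p) 3) div 2] (mod 2) \<longrightarrow>
           loc_cong p 2
             (\<Sum>k=0..p-1. of_nat ((2*k choose (k+d)) * (2*k choose k) * (3*k choose k)) / 108 ^ k) 0) \<and>
        ([int d = (1 + Legendre (-2) (int p)) div 2] (mod 2) \<longrightarrow>
           loc_cong p 2
             (\<Sum>k=0..p-1. of_nat ((2*k choose (k+d)) * (2*k choose k) * (4*k choose (2*k))) / 256 ^ k) 0) \<and>
        ([int d = (1 + Legendre (-1) (int p)) div 2] (mod 2) \<longrightarrow>
           loc_cong p 2
             (\<Sum>k=0..p-1. of_nat ((2*k choose (k+d)) * (3*k choose k) * (6*k choose (3*k))) / 12 ^ (3*k)) 0))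
     \<and> (\<forall>x y :: int. [p = 3] (mod 8) \<and> int p = x^2 + 2 * y^2 \<longrightarrow>
           loc_cong p 2
             (\<Sum>k=0..p-1. of_nat ((2*k choose k)^2 * (4*k choose (2*k))) / 256 ^ k)
             (of_int (4 * x^2 - 2 * int p)))
     \<and> (\<forall>x y :: int. [p = 5] (mod 12) \<and> int p = x^2 + y^2 \<and> \<not> 2 dvd x \<and> 2 dvd y \<longrightarrow>
           loc_cong p 2
             (\<Sum>k=0..p-1. of_nat ((2*k choose k) * (3*k choose k) * (6*k choose (3*k))) / 12 ^ (3*k))
             (of_int (2 * int p - 4 * x^2)))"
proof -
  interpret prime_gt_3 p using assms by (rule prime_gt_3.intro)
  have sum_ii: "(\<Sum>k=0..p-1. of_nat ((2*k choose k)^2 * (4*k choose (2*k))) / 256 ^ k) = trunc_sum 0 (- (1 / 4))"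
    using trunc_sum_quarter[of 0] by (simp only: power2_eq_square add_0_right of_nat_0)
  have sum_iii: "(\<Sum>k=0..p-1. of_nat ((2*k choose k) * (3*k choose k) * (6*k choose (3*k))) / 12 ^ (3*k)) = trunc_sum 0 (- (1 / 6))"
    using trunc_sum_sixth[of 0] by (simp only: add_0_right of_nat_0)
  show ?thesis
    unfolding trunc_sum_third trunc_sum_quarter trunc_sum_sixth sum_ii sum_iii
    by (intro conjI ballI allI impI; (elim conjE)?)
      (rule trunc_sum_third_vanish trunc_sum_quarter_vanish trunc_sum_sixth_vanish trunc_sum_quarter_norm_form trunc_sum_sixth_norm_form; assumption)+
qed

end
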